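(* Let $\mathbf C\in\mathrm{VILRS}[\boldsymbol\beta,\boldsymbol\xi,s;\mathbf n,k]$ and $\mathbf Y=\mathbf C+\mathbf E\in\mathbb F_{q^m}^{s\times n}$, where $\mathbf E$ is drawn uniformly at random from the set of all matrices in $\mathbb F_{q^m}^{s\times n}$ of sum-rank weight $\tau$ (with respect to $\mathbf n$), with $\tau\le\tau_{\max}:=\frac{s}{s+1}(n-k)$. For $j=1,\dots,s$ let $\mathbf s_j=(s_{j,1},\dots,s_{j,n-k}):=\mathbf y_j\mathbf H^\top$, where $\mathbf y_j$ is the $j$-th row of $\mathbf Y$, and put $\bar s_{j,l}:=\theta^{\,n-k-l}(s_{j,n-k+1-l})$ for $l=1,\dots,n-k$. Let $\bar{\mathbf S}_j\in\mathbb F_{q^m}^{(n-k-\tau)\times\tau}$ be the matrix whose entry in row $r$ and column $c$ is $\theta^{-c}(\bar s_{j,\tau+r-c})$, and let $\bar{\mathbf S}\in\mathbb F_{q^m}^{s(n-k-\tau)\times\tau}$ be obtained by stacking $\bar{\mathbf S}_1,\dots,\bar{\mathbf S}_s$ vertically. Then $$\Pr\left\{\mathrm{rk}_{q^m}(\bar{\mathbf S})<\tau\right\}\le\kappa_q^{\ell+1}\,q^{-m\left((s+1)(\tau_{\max}-\tau)+1\right)}.$$ Moreover, $\mathrm{rk}_{q^m}(\bar{\mathbf S})=\tau$ is guaranteed for any error $\mathbf E$ of sum-rank weight $\tau\le\frac12(n-k)$.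
   Context: Let $q$ be a prime power, $m\ge1$, and $\theta$ a field automorphism of $\mathbb F_{q^m}$ with fixed field exactly $\mathbb F_q$. A length partition of $n$ is a vector $\mathbf n=(n_1,\dots,n_\ell)$ of positive integers with $\sum_i n_i=n$; vectors of length $n$ (and matrices with $n$ columns) are split into $\ell$ blocks, the $i$-th having $n_i$ entries (columns). $\mathrm{rk}_q$ of a matrix over $\mathbb F_{q^m}$ is the maximum number of $\mathbb F_q$-linearly independent columns; $\mathrm{rk}_{q^m}$ is the usual rank over $\mathbb F_{q^m}$. The sum-rank weight of $\mathbf X\in\mathbb F_{q^m}^{s\times n}$ is $\mathrm{wt}_{\Sigma R}(\mathbf X)=\sum_{i=1}^{\ell}\mathrm{rk}_q(\mathbf X^{(i)})$. For an automorphism $\phi\in\{\theta,\theta^{-1}\}$ and $a,b\in\mathbb F_{q^m}$ put $\mathcal N_\phi^i(a)=\prod_{j=0}^{i-1}\phi^j(a)$ and $\mathcal D_\phi^i(b)_a=\phi^i(b)\,\mathcal N_\phi^i(a)$. In the skew polynomial ring $\mathbb F_{q^m}[x;\phi]$ ($xa=\phi(a)x$), the generalized operator evaluation of $f=\sum_i f_ix^{i-1}$ is $f(b)_a=\sum_i f_i\mathcal D_\phi^{i-1}(b)_a$. For $\mathbf b$ split into $\ell$ blocks and $\mathbf a\in\mathbb F_{q^m}^\ell$, $f(\mathbf b)_{\mathbf a}$ and $\mathcal D_\phi^i(\mathbf b)_{\mathbf a}$ are taken entrywise, using parameter $a_i$ for the $i$-th block. The generalized Moore matrix $\mathfrak M_\phi^d(\mathbf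 b)_{\mathbf a}$ has rows $\mathbf b,\mathcal D_\phi(\mathbf b)_{\mathbf a},\dots,\mathcal D_\phi^{d-1}(\mathbf b)_{\mathbf a}$. The conjugacy class of $a$ is $\{\theta(c)ac^{-1}:c\in\mathbb F_{q^m}^*\}$; it is nontrivial if $a\ne0$. Let $\boldsymbol\beta\in\mathbb F_{q^m}^n$ have blocks each consisting of $\mathbb F_q$-linearly independent entries and let $\boldsymbol\xi\in\mathbb F_{q^m}^\ell$ have entries in pairwise distinct nontrivial conjugacy classes. $\mathrm{LRS}[\boldsymbol\beta,\boldsymbol\xi;\mathbf n,k]=\{f(\boldsymbol\beta)_{\boldsymbol\xi}: f\in\mathbb F_{q^m}[x;\theta],\deg f<k\}$; $\mathrm{VILRS}[\boldsymbol\beta,\boldsymbol\xi,s;\mathbf n,k]$ is the set of matrices in $\mathbb F_{q^m}^{s\times n}$ all of whose rows lie in this LRS code. Its component code has the parity-check matrix $\mathbf H=\mathfrak M_{\theta^{-1}}^{n-k}(\mathbf h)_{\widetilde{\boldsymbol\xi}}$, where $\widetilde{\boldsymbol\xi}=\theta^{-1}(\boldsymbol\xi)$ (entrywise) and $\mathbf h\in\mathbb F_{q^m}^n$ satisfies $\mathbf h\cdot(\mathcal D_\theta^{l-1}(\boldsymbol\beta)_{\boldsymbol\xi})^\top=0$ for $l=1,\dots,n-1$ and has sum-rank weight $n$. $\kappa_q:=\prod_{i=1}^\infty\frac1{1-q^{-i}}$ (one has $\kappa_q<3.5$). *)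

theory Defs
  imports
    "HOL-Analysis.Infinite_Products"
    "HOL-Probability.Probability_Mass_Function"
    "Jordan_Normal_Form.DL_Rank"
begin

(* Vectors and matrices are those of Jordan_Normal_Form, not those of HOL-Analysis. *)
unbundle no vec_syntax and no inner_syntax
hide_type (open) Finite_Cartesian_Product.vec
hide_const (open) Finite_Cartesian_Product.vec Determinants.det

section \<open>Fields\<close>

(* The subfield of order q of a finite field extending it consists of the roots of x^q - x. *)
definition Fq :: "nat \<Rightarrow> 'a::field set" where
  "Fq q = {x. x ^ q = x}"

definition conj_class :: "('a::field \<Rightarrow> 'a) \<Rightarrow> 'a \<Rightarrow> 'a set" where
  "conj_class \<theta> a = {\<theta> c * a * inverse c | c. c \<noteq> 0}"

section \<open>Length partitions and sum-rank weight\<close>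

definition length_partition :: "nat list \<Rightarrow> nat \<Rightarrow> bool" where
  "length_partition ns n \<longleftrightarrow> (\<forall>x\<in>set ns. 0 < x) \<and> sum_list ns = n"

(* Blocks, like all positions, are counted from 0. *)
definition block_start :: "nat list \<Rightarrow> nat \<Rightarrow> nat" where
  "block_start ns i = sum_list (take i ns)"

(* the index of the block that contains position j, for j < sum_list ns *)
definition block_of :: "nat list \<Rightarrow> nat \<Rightarrow> nat" where
  "block_of ns j = (LEAST i. j < block_start ns (Suc i))"

definition block :: "nat list \<Rightarrow> nat \<Rightarrow> 'a mat \<Rightarrow> 'a mat" where
  "block ns i X = mat (dim_row X) (ns ! i) (\<lambda>(r, c). X $$ (r, block_start ns i + c))"

(* Linear independence over the subfield K of the family of columns of X indexed by J;
   a repeated column makes the family dependent. *)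
definition indep_cols :: "'a::field set \<Rightarrow> 'a mat \<Rightarrow> nat set \<Rightarrow> bool" where
  "indep_cols K X J \<longleftrightarrow>
     (\<forall>c. (\<forall>j\<in>J. c j \<in> K) \<and> (\<forall>r<dim_row X. (\<Sum>j\<in>J. c j * X $$ (r, j)) = 0)
          \<longrightarrow> (\<forall>j\<in>J. c j = 0))"

definition rk_over :: "'a::field set \<Rightarrow> 'a mat \<Rightarrow> nat" where
  "rk_over K X = Max {card J | J. J \<subseteq> {..<dim_col X} \<and> indep_cols K X J}"

definition sum_rank_wt :: "'a::field set \<Rightarrow> nat list \<Rightarrow> 'a mat \<Rightarrow> nat" where
  "sum_rank_wt K ns X = (\<Sum>i<length ns. rk_over K (block ns i X))"

section \<open>Generalized operator evaluation\<close>

definition gen_norm :: "('a::field \<Rightarrow> 'a) \<Rightarrow> nat \<Rightarrow> 'a \<Rightarrow> 'a" where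
  "gen_norm \<phi> i a = (\<Prod>j<i. (\<phi> ^^ j) a)"

definition gen_op :: "('a::field \<Rightarrow> 'a) \<Rightarrow> nat \<Rightarrow> 'a \<Rightarrow> 'a \<Rightarrow> 'a" where
  "gen_op \<phi> i b a = (\<phi> ^^ i) b * gen_norm \<phi> i a"

definition gen_op_vec :: "('a::field \<Rightarrow> 'a) \<Rightarrow> nat list \<Rightarrow> nat \<Rightarrow> 'a vec \<Rightarrow> 'a vec \<Rightarrow> 'a vec" where
  "gen_op_vec \<phi> ns i b a =
     vec (sum_list ns) (\<lambda>j. gen_op \<phi> i (b $ j) (a $ block_of ns j))"

(* A skew polynomial with coefficients written on the left is represented by its coefficient
   sequence, i.e. by an element of type 'a poly. Only coefficients and degree matter here:
   the (commutative) product and the evaluation of 'a poly are never used. *)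
definition op_eval :: "('a::field \<Rightarrow> 'a) \<Rightarrow> 'a poly \<Rightarrow> 'a \<Rightarrow> 'a \<Rightarrow> 'a" where
  "op_eval \<phi> f b a = (\<Sum>i\<le>degree f. coeff f i * gen_op \<phi> i b a)"

definition op_eval_vec :: "('a::field \<Rightarrow> 'a) \<Rightarrow> nat list \<Rightarrow> 'a poly \<Rightarrow> 'a vec \<Rightarrow> 'a vec \<Rightarrow> 'a vec" where
  "op_eval_vec \<phi> ns f b a =
     vec (sum_list ns) (\<lambda>j. op_eval \<phi> f (b $ j) (a $ block_of ns j))"

definition moore :: "('a::field \<Rightarrow> 'a) \<Rightarrow> nat list \<Rightarrow> nat \<Rightarrow> 'a vec \<Rightarrow> 'a vec \<Rightarrow> 'a mat" where
  "moore \<phi> ns d b a = mat_of_rows (sum_list ns) (map (\<lambda>i. gen_op_vec \<phi> ns i b a) [0..<d])"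

section \<open>Linearized Reed-Solomon codes\<close>

(* The zero polynomial has degree 0 in the library but degree minus infinity here. *)
definition LRS :: "('a::field \<Rightarrow> 'a) \<Rightarrow> 'a vec \<Rightarrow> 'a vec \<Rightarrow> nat list \<Rightarrow> nat \<Rightarrow> 'a vec set" where
  "LRS \<theta> \<beta> \<xi> ns k = {op_eval_vec \<theta> ns f \<beta> \<xi> | f. f = 0 \<or> degree f < k}"

definition VILRS ::
  "('a::field \<Rightarrow> 'a) \<Rightarrow> 'a vec \<Rightarrow> 'a vec \<Rightarrow> nat \<Rightarrow> nat list \<Rightarrow> nat \<Rightarrow> 'a mat set" where
  "VILRS \<theta> \<beta> \<xi> s ns k =
     {C \<in> carrier_mat s (sum_list ns). \<forall>j<s. row C j \<in> LRS \<theta> \<beta> \<xi> ns k}"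

section \<open>Syndrome matrix\<close>

(* In the following three definitions d = n - k is the number of rows of the parity-check
   matrix H. Row j of Y * H^T is the syndrome s_j, so that entry (j, d - l), counted from 0, is
   s_{j,d+1-l}; the index l runs over 1..d, while the row index j of Y is counted from 0. *)
definition mod_syndrome :: "('a::field \<Rightarrow> 'a) \<Rightarrow> 'a mat \<Rightarrow> 'a mat \<Rightarrow> nat \<Rightarrow> nat \<Rightarrow> 'a" where
  "mod_syndrome \<theta> H Y j l =
     (let d = dim_row H in (\<theta> ^^ (d - l)) ((Y * transpose_mat H) $$ (j, d - l)))"

(* Suc r and Suc c are the row and column numbers counted from 1;
   the natural number subtraction does not truncate, as c < t. *)
definition syndrome_block ::
  "('a::field \<Rightarrow> 'a) \<Rightarrow> 'a mat \<Rightarrow> nat \<Rightarrow> 'a mat \<Rightarrow> nat \<Rightarrow> 'a mat" where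
  "syndrome_block \<theta> H t Y j =
     mat (dim_row H - t) t
       (\<lambda>(r, c). (inv_into UNIV \<theta> ^^ Suc c) (mod_syndrome \<theta> H Y j (t + Suc r - Suc c)))"

definition syndrome_mat ::
  "('a::field \<Rightarrow> 'a) \<Rightarrow> 'a mat \<Rightarrow> nat \<Rightarrow> 'a mat \<Rightarrow> 'a mat" where
  "syndrome_mat \<theta> H t Y =
     mat_of_rows t (concat (map (\<lambda>j. rows (syndrome_block \<theta> H t Y j)) [0..<dim_row Y]))"

definition mat_rank :: "'a::field mat \<Rightarrow> nat" where
  "mat_rank A = vec_space.rank (dim_row A) A"

definition kappa :: "nat \<Rightarrow> real" where
  "kappa q = (\<Prod>i. 1 / (1 - 1 / real q ^ Suc i))"

end

theory Submission
  imports Defs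
begin

text \<open>Let \<open>\<phi>\<close> be the inverse of \<open>\<theta>\<close> and \<open>D\<^sup>e\<close> the operator \<open>gen_op \<phi> e\<close>. Codewords have
  syndrome zero, and the \<open>j\<close>-th syndrome block has the entry
  \<open>\<theta>\<^sup>e(\<Sum>\<^sub>p E\<^sub>j\<^sub>p D\<^sup>e\<^sup>+\<^sup>c(h\<^sub>p))\<close> in column \<open>c\<close>, where \<open>e < N = n - k - \<tau>\<close>. Hence \<open>u \<noteq> 0\<close> lies in the kernel of the
  syndrome matrix only if each row of \<open>E\<close> is orthogonal to \<open>D\<^sup>e(v)\<close> for all \<open>e < N\<close>, with
  \<open>v = \<Sum>\<^sub>c u\<^sub>c D\<^sup>c(h)\<close>.

  Write \<open>E = A B\<close> where \<open>A\<close> consists of \<open>\<tau>\<close> columns of \<open>E\<close> that are independent within each block and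
  \<open>B\<close> has entries in the small field. The condition becomes orthogonality of the rows of \<open>A\<close>
  to \<open>D\<^sup>e(w)\<close> with \<open>w = v B\<^sup>T\<close>, and \<open>w \<noteq> 0\<close> because square generalized Moore matrices are invertible.
  If \<open>w\<close> has sum-rank weight at most \<open>N\<close>, then the condition is a nontrivial relation between columns
  of \<open>A\<close>, which is impossible; this settles the case \<open>2\<tau> \<le> n - k\<close>. Otherwise the \<open>N\<close> conditions are
  independent and leave at most \<open>|F|\<^sup>s\<^sup>(\<^sup>\<tau>\<^sup>-\<^sup>N\<^sup>)\<close> choices of \<open>A\<close>, out of at least
  \<open>|F|\<^sup>s\<^sup>\<tau> / \<kappa>\<^sup>\<ell>\<close>. The union bound over the \<open>u\<close> up to scalars costs the remaining factor, at most
  \<open>\<kappa> |F|\<^sup>\<tau>\<^sup>-\<^sup>1\<close>.\<close>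

section \<open>Blockwise relations and generalized Moore matrices\<close>

text \<open>The relations hold in every block separately, so that independence of the family indexed by
  \<open>J\<close> means sum-rank weight \<open>card J\<close>. A vector of field elements is the case of a single row.\<close>

definition rels :: "'a::field set \<Rightarrow> ('i \<Rightarrow> nat) \<Rightarrow> nat \<Rightarrow> (nat \<Rightarrow> 'i \<Rightarrow> 'a) \<Rightarrow> 'i set \<Rightarrow> ('i \<Rightarrow> 'a) set"
  where "rels K blk s X J =
    {c. (\<forall>j\<in>J. c j \<in> K) \<and> (\<forall>b. \<forall>r<s. (\<Sum>j\<in>{j\<in>J. blk j = b}. c j * X r j) = 0)}"

definition bindep :: "'a::field set \<Rightarrow> ('i \<Rightarrow> nat) \<Rightarrow> nat \<Rightarrow> (nat \<Rightarrow> 'i \<Rightarrow> 'a) \<Rightarrow> 'i set \<Rightarrow> bool"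
  where "bindep K blk s X J \<longleftrightarrow> (\<forall>c\<in>rels K blk s X J. \<forall>j\<in>J. c j = 0)"

lemma bindepD: "bindep K blk s X J \<Longrightarrow> c \<in> rels K blk s X J \<Longrightarrow> j \<in> J \<Longrightarrow> c j = 0"
  unfolding bindep_def by blast

lemma bindep_subset:
  assumes "bindep K blk s X J" "finite J" "J' \<subseteq> J" "0 \<in> K"
  shows "bindep K blk s X J'"
  unfolding bindep_def
proof (intro ballI)
  fix c j assume c: "c \<in> rels K blk s X J'" and j: "j \<in> J'"
  let ?d = "\<lambda>j. if j \<in> J' then c j else 0"
  have eq: "(\<Sum>j\<in>{j \<in> J. blk j = b}. ?d j * X r j) = (\<Sum>j\<in>{j \<in> J'. blk j = b}. c j * X r j)" for b r
    by (rule sum.mono_neutral_cong_right) (use assms in auto)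
  have d: "?d \<in> rels K blk s X J"
    using c assms(3,4) unfolding rels_def mem_Collect_eq eq by auto
  show "c j = 0" using bindepD[OF assms(1) d, of j] assms(3) j by auto
qed

lemma gen_op_0 [simp]: "gen_op \<phi> 0 x a = x"
  by (simp add: gen_op_def gen_norm_def)

text \<open>Stated for a bare map, so that it can be interpreted for the automorphism, for its
  inverse and for the iterates of both.\<close>

locale field_aut =
  fixes \<phi> :: "'a::field \<Rightarrow> 'a"
  assumes hom_add: "\<phi> (x + y) = \<phi> x + \<phi> y"
    and hom_mult: "\<phi> (x * y) = \<phi> x * \<phi> y"
    and bij: "bij \<phi>"
begin

abbreviation fixed :: "'a set" where "fixed \<equiv> {x. \<phi> x = x}"

lemma hom_zero [simp]: "\<phi> 0 = 0"
  using hom_add[of 0 0] by (metis add_cancel_right_right)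

lemma hom_eq_iff [simp]: "\<phi> x = \<phi> y \<longleftrightarrow> x = y"
  using bij by (auto simp: bij_def inj_def)

lemma hom_eq_0_iff [simp]: "\<phi> x = 0 \<longleftrightarrow> x = 0"
  using hom_eq_iff[of x 0] by simp

lemma hom_one [simp]: "\<phi> 1 = 1"
  using hom_mult[of 1 1] by simp

lemma hom_uminus: "\<phi> (- x) = - \<phi> x"
  using hom_add[of x "- x"] by (simp add: eq_neg_iff_add_eq_0 add.commute)

lemma hom_diff: "\<phi> (x - y) = \<phi> x - \<phi> y"
  using hom_add[of x "- y"] by (simp add: hom_uminus)

lemma hom_divide: "\<phi> (x / y) = \<phi> x / \<phi> y"
  using hom_mult[of "x / y" y] by (cases "y = 0") (simp_all add: field_simps)

lemma hom_sum: "\<phi> (\<Sum>x\<in>A. f x) = (\<Sum>x\<in>A. \<phi> (f x))"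
  by (induction A rule: infinite_finite_induct) (simp_all add: hom_add)

lemma field_aut_funpow: "field_aut (\<phi> ^^ i)"
proof
  show "bij (\<phi> ^^ i)" by (rule bij_fn[OF bij])
qed (induction i; simp add: hom_add hom_mult)+

lemma funpow_fixed: "x \<in> fixed \<Longrightarrow> (\<phi> ^^ i) x = x"
  by (induction i) simp_all

text \<open>Cocycle rule: the product of \<open>i + j\<close> factors splits after the first
  \<open>i\<close>, and the rest is the image under \<open>\<phi> ^^ i\<close> of the first
  \<open>j\<close> factors.\<close>

lemma gen_norm_add: "gen_norm \<phi> (i + j) a = gen_norm \<phi> i a * (\<phi> ^^ i) (gen_norm \<phi> j a)"
proof -
  interpret p: field_aut "\<phi> ^^ i" by (rule field_aut_funpow)
  show ?thesis
  proof (induction j)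
    case 0
    show ?case by (simp add: gen_norm_def)
  next
    case (Suc j)
    have Suc_eq: "gen_norm \<phi> (Suc k) a = gen_norm \<phi> k a * (\<phi> ^^ k) a" for k
      by (simp add: gen_norm_def)
    show ?case
      by (simp add: Suc_eq Suc.IH p.hom_mult funpow_add mult.assoc)
  qed
qed

text \<open>\<open>gen_op \<phi> i _ a\<close> is the \<open>i\<close>-th iterate of the additive
  map sending \<open>x\<close> to \<open>\<phi> x * a\<close>; this is the composition rule of the
  iterates.\<close>

lemma gen_op_add: "gen_op \<phi> (i + j) x a = (\<phi> ^^ i) (gen_op \<phi> j x a) * gen_norm \<phi> i a"
proof -
  interpret p: field_aut "\<phi> ^^ i" by (rule field_aut_funpow)
  show ?thesis
    by (simp add: gen_op_def gen_norm_add p.hom_mult funpow_add)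
qed

lemma gen_op_Suc: "gen_op \<phi> (Suc i) x a = \<phi> (gen_op \<phi> i x a) * a"
  using gen_op_add[of 1 i x a] by (simp add: gen_norm_def)

text \<open>Powers of \<open>\<phi>\<close> fix the coefficients, so for one parameter
  \<open>a\<close> the operators are linear over the fixed field.\<close>

lemma gen_op_lincomb:
  assumes "\<And>p. p \<in> P \<Longrightarrow> c p \<in> fixed"
  shows "gen_op \<phi> i (\<Sum>p\<in>P. c p * x p) a = (\<Sum>p\<in>P. c p * gen_op \<phi> i (x p) a)"
proof -
  interpret p: field_aut "\<phi> ^^ i" by (rule field_aut_funpow)
  show ?thesis using assms
    by (simp add: gen_op_def p.hom_sum p.hom_mult funpow_fixed sum_distrib_right mult.assoc)
qed

text \<open>Field parameters of distinct blocks lie in distinct nontrivial conjugacy classes.\<close>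

definition separated :: "('i \<Rightarrow> nat) \<Rightarrow> (nat \<Rightarrow> 'a) \<Rightarrow> 'i set \<Rightarrow> bool" where
  "separated blk \<alpha> J \<longleftrightarrow> (\<forall>j\<in>J. \<alpha> (blk j) \<noteq> 0) \<and>
    (\<forall>j\<in>J. \<forall>j'\<in>J. \<forall>t. t \<noteq> 0 \<longrightarrow> \<alpha> (blk j) * t = \<phi> t * \<alpha> (blk j') \<longrightarrow> blk j = blk j')"

lemma separated_nonzero: "separated blk \<alpha> J \<Longrightarrow> j \<in> J \<Longrightarrow> \<alpha> (blk j) \<noteq> 0"
  unfolding separated_def by blast

lemma separated_subset: "separated blk \<alpha> J \<Longrightarrow> J' \<subseteq> J \<Longrightarrow> separated blk \<alpha> J'"
  unfolding separated_def by (meson subsetD)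

text \<open>Artin's argument: subtracting a multiple of the image under \<open>\<phi>\<close> of a relation from its shift
  removes one index, so by induction the difference is the zero relation. Then the coefficients
  satisfy \<open>a j * \<alpha> (blk j) = l * \<phi> (a j)\<close> for a constant \<open>l\<close>; hence they are supported on one block
  and proportional to elements of the fixed field.\<close>

lemma moore_indep:
  assumes "finite J" "bindep fixed blk 1 (\<lambda>_. x) J"
    and "separated blk \<alpha> J"
    and "\<And>i. i < card J \<Longrightarrow> (\<Sum>j\<in>J. a j * gen_op \<phi> i (x j) (\<alpha> (blk j))) = 0"
  shows "\<forall>j\<in>J. a j = 0"
  using assms
proof (induction "card J" arbitrary: J a)
  case 0
  from "0.hyps" "0.prems"(1) have "J = {}" by simp
  then show ?case by simp
next
  case (Suc N)
  note fin = Suc.prems(1) and ind = Suc.prems(2) and sep = Suc.prems(3) and eqs = Suc.prems(4) and cardJ = Suc.hyps(2)[symmetric]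
  note nz = separated_nonzero[OF sep]
  show ?case
  proof (rule ccontr)
    assume "\<not> ?thesis"
    then obtain j0 where j0: "j0 \<in> J" "a j0 \<noteq> 0" by auto
    \<comment> \<open>\<open>lam\<close> makes the coefficient at \<open>j0\<close> vanish. Taking
      preimages under \<open>\<phi>\<close> turns the combination of the terms
      \<open>\<phi> (gen_op \<phi> i (x j) _)\<close> back into a system of the original form, with
      one index and one equation fewer.\<close>
    define lam where "lam = a j0 * \<alpha> (blk j0) / \<phi> (a j0)"
    define b where "b j = inv_into UNIV \<phi> (a j * \<alpha> (blk j) - lam * \<phi> (a j))" for j
    have \<phi>b: "\<phi> (b j) = a j * \<alpha> (blk j) - lam * \<phi> (a j)" for j
      unfolding b_def using bij by (simp add: bij_inv_eq_iff[symmetric] bij_is_surj surj_f_inv_f)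
    have lam: "lam * \<phi> (a j0) = a j0 * \<alpha> (blk j0)" using j0 by (simp add: lam_def)
    have eqs': "(\<Sum>j\<in>J - {j0}. b j * gen_op \<phi> i (x j) (\<alpha> (blk j))) = 0" if i: "i < N" for i
    proof -
      let ?g = "\<lambda>j. gen_op \<phi> i (x j) (\<alpha> (blk j))"
      have "(\<Sum>j\<in>J. a j * gen_op \<phi> (Suc i) (x j) (\<alpha> (blk j))) = 0"
        using eqs[of "Suc i"] cardJ i by simp
      hence 1: "(\<Sum>j\<in>J. a j * \<alpha> (blk j) * \<phi> (?g j)) = 0" by (simp add: gen_op_Suc mult_ac)
      have "\<phi> (\<Sum>j\<in>J. a j * ?g j) = 0" using eqs[of i] cardJ i by simp
      hence 2: "(\<Sum>j\<in>J. \<phi> (a j) * \<phi> (?g j)) = 0" by (simp add: hom_sum hom_mult)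
      have "\<phi> (\<Sum>j\<in>J. b j * ?g j)
          = (\<Sum>j\<in>J. a j * \<alpha> (blk j) * \<phi> (?g j)) - lam * (\<Sum>j\<in>J. \<phi> (a j) * \<phi> (?g j))"
        by (simp add: hom_sum hom_mult \<phi>b left_diff_distrib sum_subtractf sum_distrib_left mult.assoc)
      hence "\<phi> (\<Sum>j\<in>J. b j * ?g j) = 0" using 1 2 by simp
      moreover have "\<phi> (b j0) = 0" by (simp only: \<phi>b lam) simp
      ultimately show ?thesis using sum.remove[OF fin j0(1), of "\<lambda>j. b j * ?g j"] by simp
    qed
    have "\<forall>j\<in>J - {j0}. b j = 0"
    proof (rule Suc.hyps(1))
      show "N = card (J - {j0})" using cardJ j0 by simp
      show "bindep fixed blk 1 (\<lambda>_. x) (J - {j0})"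
        by (rule bindep_subset[OF ind fin]) auto
      show "\<And>i. i < card (J - {j0}) \<Longrightarrow> (\<Sum>j\<in>J - {j0}. b j * gen_op \<phi> i (x j) (\<alpha> (blk j))) = 0"
        using eqs' cardJ j0 by simp
      show "separated blk \<alpha> (J - {j0})" by (rule separated_subset[OF sep]) auto
    qed (use fin in simp)
    hence b0: "b j = 0" if "j \<in> J" "j \<noteq> j0" for j using that by blast
    have eqv: "a j * \<alpha> (blk j) = lam * \<phi> (a j)" if "j \<in> J" for j
    proof (cases "j = j0")
      case True
      then show ?thesis by (simp only: lam)
    next
      case False
      then show ?thesis using \<phi>b[of j] b0[OF that] by simp
    qed
    \<comment> \<open>Comparing \<open>eqv\<close> at \<open>j\<close> and at \<open>j0\<close>
      eliminates \<open>lam\<close> and shows that \<open>c j\<close>, if nonzero, conjugates one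
      parameter into the other. Separation puts \<open>j\<close> into the block of
      \<open>j0\<close>; cancelling the common parameter then leaves
      \<open>\<phi> (c j) = c j\<close>.\<close>
    define c where "c j = a j / a j0" for j
    have same: "blk j = blk j0 \<and> c j \<in> fixed" if j: "j \<in> J" "a j \<noteq> 0" for j
    proof -
      have c0: "c j \<noteq> 0" using j j0 by (simp add: c_def)
      have "\<phi> (a j0) * (a j * \<alpha> (blk j)) = \<phi> (a j) * (a j0 * \<alpha> (blk j0))"
        unfolding eqv[OF j(1)] lam[symmetric] by (simp only: mult_ac)
      hence eq: "\<alpha> (blk j) * c j = \<phi> (c j) * \<alpha> (blk j0)"
        using j0 by (simp add: c_def hom_divide nonzero_eq_divide_eq mult_ac)
      hence "blk j = blk j0" using sep j(1) j0(1) c0 unfolding separated_def by blast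
      with eq nz[OF j0(1)] show ?thesis by simp
    qed
    have "c \<in> rels fixed blk 1 (\<lambda>_. x) J"
    proof -
      have fixd: "c j \<in> fixed" if "j \<in> J" for j
        using same[OF that] by (cases "a j = 0") (simp_all add: c_def)
      have "(\<Sum>j\<in>{j \<in> J. blk j = b}. c j * x j) = 0" for b
      proof (cases "b = blk j0")
        case True
        \<comment> \<open>The coefficients vanish outside this block, so the equation for
          \<open>i = 0\<close>, where the operator is the identity, is already a relation within the
          block.\<close>
        have "(\<Sum>j\<in>{j \<in> J. blk j = b}. c j * x j) = (\<Sum>j\<in>J. c j * x j)"
          by (rule sum.mono_neutral_left) (use fin same True in \<open>auto simp: c_def\<close>)
        also have "\<dots> = (\<Sum>j\<in>J. a j * x j) / a j0" by (simp add: c_def sum_divide_distrib)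
        also have "\<dots> = 0" using eqs[of 0] cardJ by simp
        finally show ?thesis .
      next
        case False
        then show ?thesis using same by (intro sum.neutral) (auto simp: c_def)
      qed
      thus ?thesis using fixd by (simp add: rels_def)
    qed
    hence "c j0 = 0" by (rule bindepD[OF ind _ j0(1)])
    thus False using j0 by (simp add: c_def)
  qed
qed

end


section \<open>Bases of column families\<close>

text \<open>\<open>B\<close> is the coefficient matrix that expresses the columns in
  \<open>P\<close> by basis columns in \<open>J\<close>. Its block structure is what makes it
  compatible with operators whose parameter depends on the block.\<close>

definition basis_coeffs ::
    "'a::field set \<Rightarrow> ('i \<Rightarrow> nat) \<Rightarrow> 'i set \<Rightarrow> 'i set \<Rightarrow> ('i \<Rightarrow> 'i \<Rightarrow> 'a) \<Rightarrow> bool"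
  where "basis_coeffs K blk P J B \<longleftrightarrow>
    (\<forall>j\<in>J. \<forall>p\<in>P. B j p \<in> K \<and> (blk j \<noteq> blk p \<longrightarrow> B j p = 0)) \<and>
    (\<forall>j\<in>J. \<forall>p\<in>J. B j p = (if j = p then 1 else 0))"

lemma basis_coeffsD:
  assumes "basis_coeffs K blk P J B" "j \<in> J"
  shows "p \<in> P \<Longrightarrow> B j p \<in> K" "p \<in> P \<Longrightarrow> blk j \<noteq> blk p \<Longrightarrow> B j p = 0"
    "p \<in> J \<Longrightarrow> B j p = (if j = p then 1 else 0)"
  using assms unfolding basis_coeffs_def by blast+

text \<open>Maximality is tested only against adding one column, which is enough to force every
  other column into the span of those in \<open>J\<close>.\<close>

definition maximal_bindep ::
    "'a::field set \<Rightarrow> ('i \<Rightarrow> nat) \<Rightarrow> nat \<Rightarrow> (nat \<Rightarrow> 'i \<Rightarrow> 'a) \<Rightarrow> 'i set \<Rightarrow> 'i set \<Rightarrow> bool"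
  where "maximal_bindep K blk s X P J \<longleftrightarrow>
    J \<subseteq> P \<and> bindep K blk s X J \<and> (\<forall>p\<in>P - J. \<not> bindep K blk s X (insert p J))"

lemma maximal_bindep_exists:
  assumes "finite P"
  shows "\<exists>J. maximal_bindep K blk s X P J"
proof -
  have "finite {J. J \<subseteq> P \<and> bindep K blk s X J}" using assms by simp
  moreover have "{} \<in> {J. J \<subseteq> P \<and> bindep K blk s X J}" by (simp add: bindep_def)
  ultimately have "\<exists>J\<in>{J. J \<subseteq> P \<and> bindep K blk s X J}. {} \<subseteq> J \<and>
      (\<forall>J'\<in>{J. J \<subseteq> P \<and> bindep K blk s X J}. J \<subseteq> J' \<longrightarrow> J = J')"
    by (rule finite_has_maximal2)
  then obtain J where J: "J \<in> {J. J \<subseteq> P \<and> bindep K blk s X J}"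
    and mx: "\<forall>J'\<in>{J. J \<subseteq> P \<and> bindep K blk s X J}. J \<subseteq> J' \<longrightarrow> J = J'"
    by blast
  have "\<not> bindep K blk s X (insert p J)" if "p \<in> P - J" for p
    using bspec[OF mx, of "insert p J"] J that by blast
  thus ?thesis using J unfolding maximal_bindep_def by blast
qed

text \<open>\<open>B j p\<close> vanishes unless \<open>j\<close> and \<open>p\<close> share a
  block, so the restriction to block \<open>b\<close> may be put on either index.\<close>

lemma basis_coeffs_sum_swap:
  assumes "finite P" "finite J" "basis_coeffs K blk P J B"
  shows "(\<Sum>p\<in>{p\<in>P. blk p = b}. \<Sum>j\<in>J. f j p * B j p) = (\<Sum>j\<in>{j\<in>J. blk j = b}. \<Sum>p\<in>P. f j p * B j p)"
proof -
  have "(\<Sum>p\<in>{p\<in>P. blk p = b}. \<Sum>j\<in>J. f j p * B j p)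
      = (\<Sum>p\<in>P. \<Sum>j\<in>J. if blk p = b then f j p * B j p else 0)"
    using assms(1) by (simp add: sum.inter_filter) (intro sum.cong; simp)
  also have "\<dots> = (\<Sum>p\<in>P. \<Sum>j\<in>J. if blk j = b then f j p * B j p else 0)"
  proof (intro sum.cong refl)
    fix p j assume "p \<in> P" "j \<in> J"
    thus "(if blk p = b then f j p * B j p else 0) = (if blk j = b then f j p * B j p else 0)"
      using basis_coeffsD(2)[OF assms(3)] by (cases "blk j = blk p") simp_all
  qed
  also have "\<dots> = (\<Sum>j\<in>J. \<Sum>p\<in>P. if blk j = b then f j p * B j p else 0)"
    by (rule sum.swap)
  also have "\<dots> = (\<Sum>j\<in>{j\<in>J. blk j = b}. \<Sum>p\<in>P. f j p * B j p)"
    using assms(2) by (simp add: sum.inter_filter) (intro sum.cong; simp)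
  finally show ?thesis .
qed

context field_aut
begin

text \<open>Exchange argument: a relation with nonzero coefficient at \<open>p\<close> can be solved
  for column \<open>p\<close> within its block, with coefficients that stay in the fixed
  field.\<close>

lemma bindep_insert:
  assumes finJ: "finite J" and p: "p \<notin> J" and ind: "bindep fixed blk s X J"
    and indep: "\<not> (\<exists>c. (\<forall>j\<in>J. c j \<in> fixed) \<and>
      (\<forall>r<s. X r p = (\<Sum>j\<in>{j\<in>J. blk j = blk p}. c j * X r j)))"
  shows "bindep fixed blk s X (insert p J)"
  unfolding bindep_def
proof (intro ballI)
  fix c j assume c: "c \<in> rels fixed blk s X (insert p J)" and j: "j \<in> insert p J"
  have split: "(\<Sum>j\<in>{j \<in> insert p J. blk j = b}. c j * X r j)
      = (if blk p = b then c p * X r p else 0) + (\<Sum>j\<in>{j \<in> J. blk j = b}. c j * X r j)" for b r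
  proof (cases "blk p = b")
    case True
    hence "{j \<in> insert p J. blk j = b} = insert p {j \<in> J. blk j = b}" by auto
    with True p finJ show ?thesis by simp
  next
    case False
    hence "{j \<in> insert p J. blk j = b} = {j \<in> J. blk j = b}" by auto
    with False show ?thesis by simp
  qed
  have c0: "(\<Sum>j\<in>{j \<in> insert p J. blk j = b}. c j * X r j) = 0" if "r < s" for b r
    using c that unfolding rels_def mem_Collect_eq by blast
  have cfix: "\<phi> (c j) = c j" if "j \<in> insert p J" for j
    using c that unfolding rels_def by blast
  have cp: "c p = 0"
  proof (rule ccontr)
    assume cp: "c p \<noteq> 0"
    have "\<forall>r<s. X r p = (\<Sum>j\<in>{j\<in>J. blk j = blk p}. (- c j / c p) * X r j)"
    proof (intro allI impI)
      fix r assume "r < s"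
      have "c p * X r p + (\<Sum>j\<in>{j \<in> J. blk j = blk p}. c j * X r j) = 0"
        using c0[OF \<open>r < s\<close>, of "blk p"] unfolding split by simp
      hence "X r p = - (\<Sum>j\<in>{j \<in> J. blk j = blk p}. c j * X r j) / c p"
        using cp by (simp add: field_simps eq_neg_iff_add_eq_0)
      thus "X r p = (\<Sum>j\<in>{j\<in>J. blk j = blk p}. (- c j / c p) * X r j)"
        by (simp add: sum_negf sum_divide_distrib)
    qed
    moreover have "\<forall>j\<in>J. - c j / c p \<in> fixed" using cfix by (simp add: hom_divide hom_uminus)
    ultimately have "\<exists>c. (\<forall>j\<in>J. c j \<in> fixed) \<and>
        (\<forall>r<s. X r p = (\<Sum>j\<in>{j\<in>J. blk j = blk p}. c j * X r j))"
      by (intro exI[of _ "\<lambda>j. - c j / c p"] conjI)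
    thus False using indep by contradiction
  qed
  have "(\<Sum>j\<in>{j \<in> J. blk j = b}. c j * X r j) = 0" if "r < s" for b r
    using c0[OF that, of b] cp unfolding split by (cases "blk p = b") simp_all
  hence "c \<in> rels fixed blk s X J" using cfix by (simp add: rels_def)
  thus "c j = 0" using bindepD[OF ind, of c j] cp j by blast
qed

text \<open>A column outside \<open>J\<close> is expanded by the contrapositive of
  \<open>bindep_insert\<close>, a column in \<open>J\<close> by a unit vector. This yields the
  factorization into independent columns and a matrix over the fixed field.\<close>

lemma maximal_bindep_coeffs:
  assumes fin: "finite P" and mx: "maximal_bindep fixed blk s X P J"
  shows "\<exists>B. basis_coeffs fixed blk P J B \<and> (\<forall>r<s. \<forall>p\<in>P. X r p = (\<Sum>j\<in>J. B j p * X r j))"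
proof -
  have J: "J \<subseteq> P" "bindep fixed blk s X J" using mx by (auto simp: maximal_bindep_def)
  have finJ: "finite J" by (rule finite_subset[OF J(1) fin])
  have "\<exists>B. (\<forall>j\<in>J. B j \<in> fixed \<and> (blk j \<noteq> blk p \<longrightarrow> B j = 0)) \<and>
      (p \<in> J \<longrightarrow> (\<forall>j\<in>J. B j = (if j = p then 1 else 0))) \<and>
      (\<forall>r<s. X r p = (\<Sum>j\<in>J. B j * X r j))" if p: "p \<in> P" for p
  proof (cases "p \<in> J")
    case True
    have "(\<Sum>j\<in>J. (if j = p then 1 else 0) * X r j) = X r p" for r
      using finJ True by (simp add: if_distrib[of "\<lambda>x. x * _"] cong: if_cong)
    then show ?thesis by (intro exI[of _ "\<lambda>j. if j = p then 1 else 0"]) auto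
  next
    case False
    with mx p have "\<not> bindep fixed blk s X (insert p J)" by (auto simp: maximal_bindep_def)
    then obtain c where c: "\<forall>j\<in>J. c j \<in> fixed"
      "\<forall>r<s. X r p = (\<Sum>j\<in>{j\<in>J. blk j = blk p}. c j * X r j)"
      using bindep_insert[OF finJ False J(2)] by blast
    define B where "B j = (if blk j = blk p then c j else 0)" for j
    have "(\<Sum>j\<in>{j\<in>J. blk j = blk p}. c j * X r j) = (\<Sum>j\<in>J. B j * X r j)" for r
      by (rule sum.mono_neutral_cong_left) (use finJ in \<open>auto simp: B_def\<close>)
    then show ?thesis using False c by (intro exI[of _ B]) (auto simp: B_def)
  qed
  hence "\<exists>B. \<forall>p\<in>P. (\<forall>j\<in>J. B p j \<in> fixed \<and> (blk j \<noteq> blk p \<longrightarrow> B p j = 0)) \<and>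
      (p \<in> J \<longrightarrow> (\<forall>j\<in>J. B p j = (if j = p then 1 else 0))) \<and>
      (\<forall>r<s. X r p = (\<Sum>j\<in>J. B p j * X r j))"
    by (intro bchoice ballI)
  then obtain B where B: "\<forall>p\<in>P. (\<forall>j\<in>J. B p j \<in> fixed \<and> (blk j \<noteq> blk p \<longrightarrow> B p j = 0)) \<and>
      (p \<in> J \<longrightarrow> (\<forall>j\<in>J. B p j = (if j = p then 1 else 0))) \<and>
      (\<forall>r<s. X r p = (\<Sum>j\<in>J. B p j * X r j))"
    by blast
  show ?thesis
  proof (intro exI[of _ "\<lambda>j p. B p j"] conjI allI impI ballI)
    show "basis_coeffs fixed blk P J (\<lambda>j p. B p j)"
      unfolding basis_coeffs_def
    proof (intro conjI ballI)
      fix j p assume "j \<in> J" "p \<in> P"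
      thus "B p j \<in> fixed" "blk j \<noteq> blk p \<longrightarrow> B p j = 0" using B by blast+
    next
      fix j p assume "j \<in> J" "p \<in> J"
      thus "B p j = (if j = p then 1 else 0)" using B J(1) by blast
    qed
    show "X r p = (\<Sum>j\<in>J. B p j * X r j)" if "r < s" "p \<in> P" for r p
      using bspec[OF B that(2)] that(1) by simp
  qed
qed

text \<open>Moves \<open>B\<close> from the coefficients into the argument of the operator: the
  entries of \<open>B\<close> are fixed by \<open>\<phi>\<close>, and wherever \<open>B j p\<close>
  is nonzero the positions \<open>j\<close> and \<open>p\<close> have the same parameter.\<close>

lemma gen_op_contract:
  assumes "finite P" "finite J" "basis_coeffs fixed blk P J B"
  shows "(\<Sum>p\<in>P. (\<Sum>j\<in>J. B j p * a j) * gen_op \<phi> e (v p) (\<alpha> (blk p)))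
       = (\<Sum>j\<in>J. a j * gen_op \<phi> e (\<Sum>p\<in>P. B j p * v p) (\<alpha> (blk j)))"
proof -
  have "(\<Sum>p\<in>P. (\<Sum>j\<in>J. B j p * a j) * gen_op \<phi> e (v p) (\<alpha> (blk p)))
      = (\<Sum>p\<in>P. \<Sum>j\<in>J. a j * (B j p * gen_op \<phi> e (v p) (\<alpha> (blk j))))"
    unfolding sum_distrib_right
  proof (intro sum.cong refl)
    fix p j assume "p \<in> P" "j \<in> J"
    hence "B j p = 0 \<or> blk j = blk p" using basis_coeffsD(2)[OF assms(3)] by blast
    thus "B j p * a j * gen_op \<phi> e (v p) (\<alpha> (blk p)) = a j * (B j p * gen_op \<phi> e (v p) (\<alpha> (blk j)))"
      by auto
  qed
  also have "\<dots> = (\<Sum>j\<in>J. \<Sum>p\<in>P. a j * (B j p * gen_op \<phi> e (v p) (\<alpha> (blk j))))"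
    by (rule sum.swap)
  also have "\<dots> = (\<Sum>j\<in>J. a j * gen_op \<phi> e (\<Sum>p\<in>P. B j p * v p) (\<alpha> (blk j)))"
  proof (intro sum.cong refl)
    fix j assume "j \<in> J"
    hence "\<And>p. p \<in> P \<Longrightarrow> B j p \<in> fixed" using basis_coeffsD(1)[OF assms(3)] by blast
    thus "(\<Sum>p\<in>P. a j * (B j p * gen_op \<phi> e (v p) (\<alpha> (blk j))))
        = a j * gen_op \<phi> e (\<Sum>p\<in>P. B j p * v p) (\<alpha> (blk j))"
      by (simp add: gen_op_lincomb sum_distrib_left)
  qed
  finally show ?thesis .
qed

text \<open>A relation \<open>c\<close> of the contracted family pulls back to the relation
  \<open>d\<close>, the product of \<open>c\<close> and \<open>B\<close>, of the family
  \<open>h\<close>. On \<open>J\<close> it agrees with \<open>c\<close>, because \<open>B\<close> is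
  the identity there.\<close>

lemma bindep_contract:
  assumes "finite P" "J \<subseteq> P" "basis_coeffs fixed blk P J B" "bindep fixed blk 1 (\<lambda>_. h) P"
  shows "bindep fixed blk 1 (\<lambda>_ j. \<Sum>p\<in>P. B j p * h p) J"
  unfolding bindep_def
proof (intro ballI)
  fix c i assume c: "c \<in> rels fixed blk 1 (\<lambda>_ j. \<Sum>p\<in>P. B j p * h p) J" and i: "i \<in> J"
  have finJ: "finite J" by (rule finite_subset[OF assms(2,1)])
  define d where "d p = (\<Sum>j\<in>J. c j * B j p)" for p
  have "(\<Sum>p\<in>{p\<in>P. blk p = b}. d p * h p) = 0" for b
  proof -
    have "(\<Sum>p\<in>{p\<in>P. blk p = b}. d p * h p) = (\<Sum>p\<in>{p\<in>P. blk p = b}. \<Sum>j\<in>J. (c j * h p) * B j p)"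
      by (simp add: d_def sum_distrib_left sum_distrib_right mult_ac)
    also have "\<dots> = (\<Sum>j\<in>{j\<in>J. blk j = b}. \<Sum>p\<in>P. (c j * h p) * B j p)"
      using basis_coeffs_sum_swap[OF assms(1) finJ assms(3)] .
    also have "\<dots> = (\<Sum>j\<in>{j\<in>J. blk j = b}. c j * (\<Sum>p\<in>P. B j p * h p))"
      by (simp add: sum_distrib_left mult_ac)
    also have "\<dots> = 0" using c by (simp add: rels_def)
    finally show ?thesis .
  qed
  moreover have "d p \<in> fixed" if "p \<in> P" for p
  proof -
    have "c j \<in> fixed" "B j p \<in> fixed" if "j \<in> J" for j
      using c \<open>p \<in> P\<close> that basis_coeffsD(1)[OF assms(3)] by (auto simp: rels_def)
    thus ?thesis by (simp add: d_def hom_sum hom_mult)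
  qed
  ultimately have "d \<in> rels fixed blk 1 (\<lambda>_. h) P" by (simp add: rels_def)
  hence "d i = 0" using bindepD[OF assms(4), of d i] assms(2) i by blast
  moreover have "d i = (\<Sum>j\<in>J. if j = i then c j else 0)"
    unfolding d_def by (intro sum.cong refl) (simp add: basis_coeffsD(3)[OF assms(3) _ i])
  ultimately show "c i = 0" using i finJ by simp
qed

text \<open>As the columns in \<open>J\<close> are independent, a relation of all columns is the
  same as a vector over the fixed field annihilated by \<open>B\<close>. Hence the relations depend
  on \<open>B\<close> only, not on the values of the columns.\<close>

lemma rels_extend:
  assumes "finite P" "J \<subseteq> P" "basis_coeffs fixed blk P J B" "bindep fixed blk s X J"
    and X: "\<And>r p. r < s \<Longrightarrow> p \<in> P \<Longrightarrow> X r p = (\<Sum>j\<in>J. B j p * X r j)"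
  shows "rels fixed blk s X P = {c. (\<forall>p\<in>P. c p \<in> fixed) \<and> (\<forall>j\<in>J. (\<Sum>p\<in>P. c p * B j p) = 0)}"
proof -
  have finJ: "finite J" by (rule finite_subset[OF assms(2,1)])
  have "c \<in> rels fixed blk s X P \<longleftrightarrow> (\<forall>j\<in>J. (\<Sum>p\<in>P. c p * B j p) = 0)"
    if c: "\<forall>p\<in>P. c p \<in> fixed" for c
  proof -
    define d where "d j = (\<Sum>p\<in>P. c p * B j p)" for j
    have dfix: "\<forall>j\<in>J. d j \<in> fixed"
    proof
      fix j assume "j \<in> J"
      hence "\<phi> (c p) = c p" "\<phi> (B j p) = B j p" if "p \<in> P" for p
        using c that basis_coeffsD(1)[OF assms(3)] by auto
      thus "d j \<in> fixed" by (simp add: d_def hom_sum hom_mult)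
    qed
    have "(\<Sum>p\<in>{p\<in>P. blk p = b}. c p * X r p) = (\<Sum>j\<in>{j\<in>J. blk j = b}. d j * X r j)" if "r < s" for b r
    proof -
      have "(\<Sum>p\<in>{p\<in>P. blk p = b}. c p * X r p)
          = (\<Sum>p\<in>{p\<in>P. blk p = b}. \<Sum>j\<in>J. (c p * X r j) * B j p)"
      proof (intro sum.cong refl)
        fix p assume "p \<in> {p\<in>P. blk p = b}"
        hence "X r p = (\<Sum>j\<in>J. B j p * X r j)" using X that by blast
        thus "c p * X r p = (\<Sum>j\<in>J. (c p * X r j) * B j p)" by (simp add: sum_distrib_left mult_ac)
      qed
      also have "\<dots> = (\<Sum>j\<in>{j\<in>J. blk j = b}. \<Sum>p\<in>P. (c p * X r j) * B j p)"
        using basis_coeffs_sum_swap[OF assms(1) finJ assms(3)] .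
      also have "\<dots> = (\<Sum>j\<in>{j\<in>J. blk j = b}. d j * X r j)"
        by (simp add: d_def sum_distrib_left sum_distrib_right mult_ac)
      finally show ?thesis .
    qed
    hence "c \<in> rels fixed blk s X P \<longleftrightarrow> d \<in> rels fixed blk s X J"
      using c dfix by (simp add: rels_def)
    also have "\<dots> \<longleftrightarrow> (\<forall>j\<in>J. d j = 0)"
    proof
      assume "d \<in> rels fixed blk s X J"
      thus "\<forall>j\<in>J. d j = 0" using bindepD[OF assms(4)] by blast
    next
      assume "\<forall>j\<in>J. d j = 0"
      thus "d \<in> rels fixed blk s X J" by (simp add: rels_def)
    qed
    finally show ?thesis by (simp add: d_def)
  qed
  moreover have "c \<in> rels fixed blk s X P \<Longrightarrow> \<forall>p\<in>P. c p \<in> fixed" for c by (simp add: rels_def)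
  ultimately show ?thesis by blast
qed

end

section \<open>Row independence of square Moore matrices over finite fields\<close>

locale finite_field_aut = field_aut \<phi> for \<phi> :: "'a::{field,finite} \<Rightarrow> 'a"
begin

text \<open>Transpose of \<open>moore_indep\<close>. That lemma makes \<open>f\<close> injective
  between finite sets of equal size, hence onto; a preimage \<open>a\<close> of the
  \<open>k\<close>-th unit vector combines the given equations into \<open>u k = 0\<close>.\<close>

lemma moore_indep_rows:
  assumes fin: "finite J" and ind: "bindep fixed blk 1 (\<lambda>_. x) J"
    and sep: "separated blk \<alpha> J"
    and zero: "\<And>j. j \<in> J \<Longrightarrow> (\<Sum>i<card J. u i * gen_op \<phi> i (x j) (\<alpha> (blk j))) = 0"
    and k: "k < card J"
  shows "u k = 0"
proof -
  define f where "f a = (\<lambda>i\<in>{..<card J}. \<Sum>j\<in>J. a j * gen_op \<phi> i (x j) (\<alpha> (blk j)))" for a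
  let ?A = "PiE J (\<lambda>_. UNIV :: 'a set)" and ?B = "PiE {..<card J} (\<lambda>_. UNIV :: 'a set)"
  have "inj_on f ?A"
  proof (rule inj_onI)
    fix a a' assume a: "a \<in> ?A" "a' \<in> ?A" and eq: "f a = f a'"
    have "\<forall>j\<in>J. a j - a' j = 0"
    proof (rule moore_indep[OF fin ind sep])
      fix i assume "i < card J"
      thus "(\<Sum>j\<in>J. (a j - a' j) * gen_op \<phi> i (x j) (\<alpha> (blk j))) = 0"
        using fun_cong[OF eq, of i] by (simp add: f_def left_diff_distrib sum_subtractf)
    qed
    thus "a = a'" using a by (intro PiE_ext) auto
  qed
  moreover have "f ` ?A \<subseteq> ?B" by (intro image_subsetI) (simp add: f_def)
  moreover have "finite ?B" "card ?A = card ?B" using fin by (auto simp: card_PiE finite_PiE)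
  ultimately have "f ` ?A = ?B" by (metis card_image card_subset_eq)
  moreover have "(\<lambda>i\<in>{..<card J}. if i = k then 1 else 0) \<in> ?B" by simp
  ultimately obtain a where "f a = (\<lambda>i\<in>{..<card J}. if i = k then 1 else 0)" by (metis imageE)
  hence a: "(\<Sum>j\<in>J. a j * gen_op \<phi> i (x j) (\<alpha> (blk j))) = (if i = k then 1 else 0)" if "i < card J" for i
    using that by (auto simp: f_def dest!: fun_cong[of _ _ i])
  have "u k = (\<Sum>i<card J. u i * (if i = k then 1 else 0))"
    using k by (simp add: if_distrib cong: if_cong)
  also have "\<dots> = (\<Sum>i<card J. u i * (\<Sum>j\<in>J. a j * gen_op \<phi> i (x j) (\<alpha> (blk j))))"
    using a by simp
  also have "\<dots> = (\<Sum>j\<in>J. a j * (\<Sum>i<card J. u i * gen_op \<phi> i (x j) (\<alpha> (blk j))))"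
    unfolding sum_distrib_left by (subst sum.swap) (simp add: mult_ac)
  also have "\<dots> = 0" using zero by simp
  finally show ?thesis .
qed

text \<open>\<open>gen_op \<phi> (Suc i)\<close> is \<open>\<phi>\<close> of
  \<open>gen_op \<phi> i\<close> times a nonzero parameter, so pulling the coefficients back along
  \<open>\<phi>\<close> removes the shift by one.\<close>

lemma moore_indep_rows_Suc:
  assumes fin: "finite J" and ind: "bindep fixed blk 1 (\<lambda>_. x) J"
    and sep: "separated blk \<alpha> J"
    and zero: "\<And>j. j \<in> J \<Longrightarrow> (\<Sum>i<card J. u i * gen_op \<phi> (Suc i) (x j) (\<alpha> (blk j))) = 0"
    and k: "k < card J"
  shows "u k = 0"
proof -
  define w where "w i = inv_into UNIV \<phi> (u i)" for i
  have w: "\<phi> (w i) = u i" for i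
    unfolding w_def using bij by (simp add: bij_is_surj surj_f_inv_f)
  have "w k = 0"
  proof (rule moore_indep_rows[OF fin ind sep _ k])
    fix j assume j: "j \<in> J"
    have "\<phi> (\<Sum>i<card J. w i * gen_op \<phi> i (x j) (\<alpha> (blk j))) * \<alpha> (blk j) = 0"
      using zero[OF j] by (simp add: hom_sum hom_mult w gen_op_Suc sum_distrib_right mult.assoc)
    thus "(\<Sum>i<card J. w i * gen_op \<phi> i (x j) (\<alpha> (blk j))) = 0" using separated_nonzero[OF sep j] by simp
  qed
  thus ?thesis using w[of k] by simp
qed

end


section \<open>Solutions of Moore systems and column relations\<close>

context field_aut
begin

text \<open>Counterpart of \<open>gen_op_contract\<close>: here the argument of the operator is
  expanded in a subfamily, and the expansion passes to the coefficients.\<close>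

lemma gen_op_expand:
  assumes "finite J" "finite T" "basis_coeffs fixed blk J T B"
    and "\<And>p. p \<in> J \<Longrightarrow> w p = (\<Sum>t\<in>T. B t p * w t)"
  shows "(\<Sum>p\<in>J. a p * gen_op \<phi> e (w p) (\<alpha> (blk p)))
       = (\<Sum>t\<in>T. (\<Sum>p\<in>J. a p * B t p) * gen_op \<phi> e (w t) (\<alpha> (blk t)))"
proof -
  have "(\<Sum>p\<in>J. a p * gen_op \<phi> e (w p) (\<alpha> (blk p)))
      = (\<Sum>p\<in>J. \<Sum>t\<in>T. a p * B t p * gen_op \<phi> e (w t) (\<alpha> (blk t)))"
  proof (intro sum.cong refl)
    fix p assume p: "p \<in> J"
    have "gen_op \<phi> e (w p) (\<alpha> (blk p)) = gen_op \<phi> e (\<Sum>t\<in>T. B t p * w t) (\<alpha> (blk p))"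
      using assms(4)[OF p] by simp
    also have "\<dots> = (\<Sum>t\<in>T. B t p * gen_op \<phi> e (w t) (\<alpha> (blk p)))"
      using basis_coeffsD(1)[OF assms(3) _ p] by (intro gen_op_lincomb)
    also have "\<dots> = (\<Sum>t\<in>T. B t p * gen_op \<phi> e (w t) (\<alpha> (blk t)))"
    proof (intro sum.cong refl)
      fix t assume "t \<in> T"
      thus "B t p * gen_op \<phi> e (w t) (\<alpha> (blk p)) = B t p * gen_op \<phi> e (w t) (\<alpha> (blk t))"
        using basis_coeffsD(2)[OF assms(3) _ p] by (cases "blk t = blk p") simp_all
    qed
    finally show "a p * gen_op \<phi> e (w p) (\<alpha> (blk p))
        = (\<Sum>t\<in>T. a p * B t p * gen_op \<phi> e (w t) (\<alpha> (blk t)))"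
      by (simp add: sum_distrib_left mult.assoc)
  qed
  also have "\<dots> = (\<Sum>t\<in>T. \<Sum>p\<in>J. a p * B t p * gen_op \<phi> e (w t) (\<alpha> (blk t)))"
    by (rule sum.swap)
  finally show ?thesis by (simp add: sum_distrib_right)
qed

text \<open>Expanding \<open>w\<close> in the subfamily indexed by \<open>T\<close> turns the equations into a square or overdetermined
  Moore system, whose only solution is a relation between the columns of \<open>A\<close> over the fixed field.\<close>

lemma bindep_not_orthogonal:
  assumes fin: "finite J" and sep: "separated blk \<alpha> J" and w: "j0 \<in> J" "w j0 \<noteq> 0"
    and mx: "maximal_bindep fixed blk 1 (\<lambda>_. w) J T" and le: "card T \<le> N"
    and A: "bindep fixed blk s A J"
    and orth: "\<And>r e. r < s \<Longrightarrow> e < N \<Longrightarrow> (\<Sum>j\<in>J. A r j * gen_op \<phi> e (w j) (\<alpha> (blk j))) = 0"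
  shows False
proof -
  have T: "T \<subseteq> J" and indT: "bindep fixed blk 1 (\<lambda>_. w) T"
    using mx by (simp_all add: maximal_bindep_def)
  have finT: "finite T" by (rule finite_subset[OF T fin])
  obtain B where B: "basis_coeffs fixed blk J T B"
    and wB': "\<forall>r<1::nat. \<forall>p\<in>J. w p = (\<Sum>t\<in>T. B t p * w t)"
    using maximal_bindep_coeffs[OF fin mx] by (elim exE conjE)
  have wB: "w p = (\<Sum>t\<in>T. B t p * w t)" if "p \<in> J" for p
    using wB' that by simp
  have "T \<noteq> {}" using wB[OF w(1)] w(2) by auto
  then obtain t0 where t0: "t0 \<in> T" by blast
  have zero: "\<forall>t\<in>T. (\<Sum>p\<in>J. A r p * B t p) = 0" if r: "r < s" for r
  proof (rule moore_indep[OF finT indT separated_subset[OF sep T]])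
    fix e assume "e < card T"
    hence "(\<Sum>j\<in>J. A r j * gen_op \<phi> e (w j) (\<alpha> (blk j))) = 0" using orth[OF r] le by simp
    thus "(\<Sum>t\<in>T. (\<Sum>p\<in>J. A r p * B t p) * gen_op \<phi> e (w t) (\<alpha> (blk t))) = 0"
      using gen_op_expand[OF fin finT B, of w "A r" e \<alpha>] wB by simp
  qed
  have "(\<Sum>p\<in>{p\<in>J. blk p = b}. B t0 p * A r p) = 0" if r: "r < s" for r b
  proof (cases "b = blk t0")
    case True
    have "(\<Sum>p\<in>{p\<in>J. blk p = b}. B t0 p * A r p) = (\<Sum>p\<in>J. B t0 p * A r p)"
    proof (rule sum.mono_neutral_left[OF fin])
      show "\<forall>i\<in>J - {p \<in> J. blk p = b}. B t0 i * A r i = 0"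
      proof
        fix i assume "i \<in> J - {p \<in> J. blk p = b}"
        hence "B t0 i = 0" using basis_coeffsD(2)[OF B t0, of i] True by auto
        thus "B t0 i * A r i = 0" by simp
      qed
    qed blast
    also have "\<dots> = 0" using bspec[OF zero[OF r] t0] by (simp add: mult.commute)
    finally show ?thesis .
  next
    case False
    show ?thesis
    proof (intro sum.neutral ballI)
      fix i assume "i \<in> {p \<in> J. blk p = b}"
      hence "B t0 i = 0" using basis_coeffsD(2)[OF B t0, of i] False by auto
      thus "B t0 i * A r i = 0" by simp
    qed
  qed
  hence "B t0 \<in> rels fixed blk s A J"
    using basis_coeffsD(1)[OF B t0] by (simp add: rels_def)
  \<comment> \<open>Row \<open>t0\<close> of \<open>B\<close> is a nontrivial relation, since
    \<open>B\<close> is the identity on \<open>T\<close>.\<close>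
  hence "B t0 t0 = 0" by (rule bindepD[OF A]) (use T t0 in blast)
  thus False using basis_coeffsD(3)[OF B t0 t0] by simp
qed

text \<open>The difference of two solutions is supported on \<open>T\<close>, where the equations
  form a square Moore system. So the entries outside \<open>T\<close> determine the others.\<close>

lemma orthogonal_unique:
  assumes fin: "finite J" and sep: "separated blk \<alpha> J" and T: "T \<subseteq> J"
    and indT: "bindep fixed blk 1 (\<lambda>_. w) T"
    and a: "\<And>e. e < card T \<Longrightarrow> (\<Sum>j\<in>J. a j * gen_op \<phi> e (w j) (\<alpha> (blk j))) = 0"
    and a': "\<And>e. e < card T \<Longrightarrow> (\<Sum>j\<in>J. a' j * gen_op \<phi> e (w j) (\<alpha> (blk j))) = 0"
    and eq: "\<And>j. j \<in> J - T \<Longrightarrow> a j = a' j" and j: "j \<in> J"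
  shows "a j = a' j"
proof -
  have finT: "finite T" by (rule finite_subset[OF T fin])
  have "\<forall>j\<in>T. a j - a' j = 0"
  proof (rule moore_indep[OF finT indT separated_subset[OF sep T]])
    fix e assume e: "e < card T"
    have "(\<Sum>j\<in>T. (a j - a' j) * gen_op \<phi> e (w j) (\<alpha> (blk j)))
        = (\<Sum>j\<in>J. (a j - a' j) * gen_op \<phi> e (w j) (\<alpha> (blk j)))"
      by (rule sum.mono_neutral_left[OF fin T]) (use eq in simp)
    also have "\<dots> = 0" using a[OF e] a'[OF e] by (simp add: left_diff_distrib sum_subtractf)
    finally show "(\<Sum>j\<in>T. (a j - a' j) * gen_op \<phi> e (w j) (\<alpha> (blk j))) = 0" .
  qed
  thus ?thesis using eq[of j] j by (cases "j \<in> T") auto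
qed

end

text \<open>Encodes the expansion of column \<open>p\<close> in the basis as one relation, so that
  every matrix with the same relations inherits the expansion with the same coefficients.\<close>

lemma column_relation_iff:
  assumes fin: "finite P" and JP: "J \<subseteq> P" and B: "basis_coeffs K blk P J B"
    and p: "p \<in> P" "p \<notin> J" and K: "0 \<in> K" "- 1 \<in> K"
  shows "(\<lambda>i. if i = p then - 1 else if i \<in> J then B i p else 0) \<in> rels K blk s X P
    \<longleftrightarrow> (\<forall>r<s. X r p = (\<Sum>j\<in>J. B j p * X r j))"
proof -
  let ?c = "\<lambda>i. if i = p then - 1 else if i \<in> J then B i p else 0"
  have finJ: "finite J" by (rule finite_subset[OF JP fin])
  have cK: "\<forall>i\<in>P. ?c i \<in> K" using K basis_coeffsD(1)[OF B _ p(1)] by simp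
  have sum: "(\<Sum>i\<in>{i\<in>P. blk i = b}. ?c i * X r i)
      = (if b = blk p then (\<Sum>j\<in>J. B j p * X r j) - X r p else 0)" for b r
  proof (cases "b = blk p")
    case True
    have "(\<Sum>i\<in>{i\<in>P. blk i = b}. ?c i * X r i) = (\<Sum>i\<in>P. ?c i * X r i)"
    proof (rule sum.mono_neutral_left[OF fin])
      show "\<forall>i\<in>P - {i\<in>P. blk i = b}. ?c i * X r i = 0"
      proof
        fix i assume i: "i \<in> P - {i\<in>P. blk i = b}"
        hence "i \<noteq> p" "blk i \<noteq> blk p" using True by blast+
        thus "?c i * X r i = 0" using basis_coeffsD(2)[OF B _ p(1), of i] by simp
      qed
    qed blast
    also have "\<dots> = (\<Sum>i\<in>insert p J. ?c i * X r i)"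
      by (rule sum.mono_neutral_right[OF fin]) (use p JP in simp_all)
    also have "\<dots> = - X r p + (\<Sum>i\<in>J. ?c i * X r i)" using p finJ by simp
    also have "(\<Sum>i\<in>J. ?c i * X r i) = (\<Sum>j\<in>J. B j p * X r j)"
      by (intro sum.cong refl) (use p in auto)
    finally show ?thesis using True by simp
  next
    case False
    have "(\<Sum>i\<in>{i\<in>P. blk i = b}. ?c i * X r i) = 0"
    proof (intro sum.neutral ballI)
      fix i assume i: "i \<in> {i\<in>P. blk i = b}"
      hence "i \<noteq> p" "blk i \<noteq> blk p" using False by blast+
      thus "?c i * X r i = 0" using basis_coeffsD(2)[OF B _ p(1), of i] by simp
    qed
    then show ?thesis using False by simp
  qed
  show ?thesis (is "_ \<longleftrightarrow> ?R")
  proof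
    assume "?c \<in> rels K blk s X P"
    hence "(\<Sum>i\<in>{i\<in>P. blk i = blk p}. ?c i * X r i) = 0" if "r < s" for r
      unfolding rels_def mem_Collect_eq using that by blast
    thus ?R unfolding sum by simp
  next
    assume R: ?R
    show "?c \<in> rels K blk s X P"
      unfolding rels_def mem_Collect_eq
    proof (intro conjI allI impI cK)
      fix b r assume "r < s"
      thus "(\<Sum>i\<in>{i\<in>P. blk i = b}. ?c i * X r i) = 0" unfolding sum using R by simp
    qed
  qed
qed

text \<open>Relations of a subfamily, extended by zero, are relations of the whole family. So the
  latter decide which subfamilies are independent.\<close>

lemma bindep_cong_rels:
  assumes eq: "rels K blk s X P = rels K blk s Y P" and fin: "finite P" and JP: "J \<subseteq> P" and K: "0 \<in> K"
    and X: "bindep K blk s X J"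
  shows "bindep K blk s Y J"
  unfolding bindep_def
proof (intro ballI)
  fix c j assume c: "c \<in> rels K blk s Y J" and j: "j \<in> J"
  let ?d = "\<lambda>j. if j \<in> J then c j else 0"
  have finJ: "finite J" by (rule finite_subset[OF JP fin])
  have sum: "(\<Sum>j\<in>{j \<in> P. blk j = b}. ?d j * Z r j) = (\<Sum>j\<in>{j \<in> J. blk j = b}. c j * Z r j)" for b r Z
    by (rule sum.mono_neutral_cong_right) (use fin JP in auto)
  have "?d \<in> rels K blk s Y P"
    using c K unfolding rels_def mem_Collect_eq sum by simp
  hence "?d \<in> rels K blk s X P" using eq by simp
  hence "c \<in> rels K blk s X J"
    unfolding rels_def mem_Collect_eq sum using JP by (simp add: subset_iff split: if_splits)
  thus "c j = 0" by (rule bindepD[OF X _ j])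
qed

lemma bindep_iff_rels:
  assumes "rels K blk s X P = rels K blk s Y P" "finite P" "J \<subseteq> P" "0 \<in> K"
  shows "bindep K blk s X J \<longleftrightarrow> bindep K blk s Y J"
  using bindep_cong_rels[OF assms] bindep_cong_rels[OF assms(1)[symmetric] assms(2-4)] by blast


section \<open>Counting independent tuples\<close>

lemma kappa_factor_bounds:
  fixes y :: real
  assumes "2 \<le> y"
  shows "1 \<le> 1 / (1 - 1 / y)" "1 / (1 - 1 / y) - 1 \<le> 2 * (1 / y)" "0 < 1 - 1 / y"
proof -
  have y: "1 / (1 - 1 / y) = y / (y - 1)" using assms by (simp add: divide_simps)
  show "0 < 1 - 1 / y" using assms by (simp add: divide_simps)
  show "1 \<le> 1 / (1 - 1 / y)" unfolding y using assms by (simp add: divide_simps)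
  have "y / (y - 1) - 1 = 1 / (y - 1)" using assms by (simp add: divide_simps)
  also have "\<dots> \<le> 2 * (1 / y)" using assms by (simp add: divide_simps)
  finally show "1 / (1 - 1 / y) - 1 \<le> 2 * (1 / y)" unfolding y .
qed

lemma two_le_power_Suc: "2 \<le> q \<Longrightarrow> 2 \<le> real q ^ Suc i"
proof (induction i)
  case (Suc i)
  hence "2 * 1 \<le> real q * real q ^ Suc i" by (intro mult_mono) simp_all
  then show ?case by simp
qed simp

text \<open>All factors are at least one, so the partial products stay below the infinite product.
  Its convergence, without which \<open>prodinf\<close> says nothing, follows from a geometric
  majorant of \<open>f i - 1\<close>.\<close>

lemma kappa_ge_prod:
  assumes q: "2 \<le> q"
  shows "(\<Prod>i<n. 1 / (1 - 1 / real q ^ Suc i)) \<le> kappa q"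
proof -
  define f where "f i = 1 / (1 - 1 / real q ^ Suc i)" for i
  have ge1: "1 \<le> f i" for i
    unfolding f_def by (rule kappa_factor_bounds(1)[OF two_le_power_Suc[OF q]])
  have le: "f i - 1 \<le> 2 * (1 / real q) ^ Suc i" for i
    unfolding f_def power_one_over by (rule kappa_factor_bounds(2)[OF two_le_power_Suc[OF q]])
  have "summable (\<lambda>i. (1 / real q) ^ i)" using q by (intro summable_geometric) simp
  hence "summable (\<lambda>i. (1 / real q) ^ Suc i)" by (subst summable_Suc_iff)
  hence "summable (\<lambda>i. 2 * (1 / real q) ^ Suc i)" by (rule summable_mult)
  hence "summable (\<lambda>i. norm (f i - 1))"
    by (rule summable_comparison_test'[where N = 0]) (use ge1 le in simp)
  hence "abs_convergent_prod f" by (simp only: abs_convergent_prod_conv_summable)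
  hence "convergent_prod f" by (rule abs_convergent_prod_imp_convergent_prod)
  hence "f has_prod prodinf f" by (rule convergent_prod_has_prod)
  hence "prod f {..<n} \<le> prodinf f"
    by (rule prod_le_prodinf) (use ge1 order.trans[OF zero_le_one] in blast)+
  thus ?thesis unfolding kappa_def f_def .
qed

lemma kappa_ge_1: "2 \<le> q \<Longrightarrow> 1 \<le> kappa q"
  using kappa_ge_prod[of q 0] by simp

text \<open>The factor with index \<open>i\<close> is the reciprocal of the factor
  \<open>1 / (1 - 1 / q ^ (M - i))\<close> of \<open>kappa q\<close>. Distinct \<open>i\<close> use
  distinct factors, and those left out are at least one.\<close>

lemma prod_ge_inverse_kappa:
  assumes q: "2 \<le> q" and t: "t \<le> M"
  shows "1 / kappa q \<le> (\<Prod>i<t. 1 - real q ^ i / real q ^ M)"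
proof -
  define g where "g i = 1 / (1 - 1 / real q ^ Suc i)" for i
  have ge1: "1 \<le> g i" for i
    unfolding g_def by (rule kappa_factor_bounds(1)[OF two_le_power_Suc[OF q]])
  have "prod g {M-t..<M} \<le> prod g {..<M}"
    by (rule prod_mono2) (use ge1 order.trans[OF zero_le_one] in auto)
  also have "\<dots> \<le> kappa q" unfolding g_def by (rule kappa_ge_prod[OF q])
  finally have le: "prod g {M-t..<M} \<le> kappa q" .
  have "1 \<le> prod g {M-t..<M}" by (rule prod_ge_1) (rule ge1)
  hence "1 / kappa q \<le> 1 / prod g {M-t..<M}" using le by (intro divide_left_mono mult_pos_pos) linarith+
  also have "prod g {M-t..<M} = (\<Prod>i<t. g (M - Suc i))"
    by (rule prod.reindex_bij_witness[of _ "\<lambda>i. M - Suc i" "\<lambda>i. M - Suc i"]) (use t in auto)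
  also have "1 / \<dots> = (\<Prod>i<t. 1 / g (M - Suc i))" by (simp add: prod_dividef)
  also have "\<dots> = (\<Prod>i<t. 1 - real q ^ i / real q ^ M)"
  proof (rule prod.cong[OF refl])
    fix i assume "i \<in> {..<t}"
    hence i: "Suc (M - Suc i) = M - i" "i \<le> M" using t by auto
    have "1 / g (M - Suc i) = 1 - 1 / real q ^ (M - i)" by (simp only: g_def i(1)) simp
    also have "1 / real q ^ (M - i) = real q ^ i / real q ^ M"
      using q i(2) by (simp add: power_diff)
    finally show "1 / g (M - Suc i) = 1 - real q ^ i / real q ^ M" .
  qed
  finally show ?thesis .
qed


context finite_field_aut
begin

text \<open>The column index comes first, so that appending a column is a function update.
  Extensional functions make the set finite.\<close>

definition bindep_tuples :: "nat \<Rightarrow> ('i \<Rightarrow> nat) \<Rightarrow> 'i set \<Rightarrow> ('i \<Rightarrow> nat \<Rightarrow> 'a) set" where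
  "bindep_tuples s blk J =
    {A \<in> J \<rightarrow>\<^sub>E ({..<s} \<rightarrow>\<^sub>E UNIV). bindep fixed blk s (\<lambda>r j. A j r) J}"

text \<open>Independence survives when the new column lies outside \<open>W A\<close>, the span over
  the fixed field of the columns in the block of \<open>x\<close>. The span has no more elements
  than there are coefficient choices.\<close>

lemma card_bindep_tuples_insert:
  assumes fin: "finite J" and x: "x \<notin> J"
  shows "real (card (bindep_tuples s blk J)) *
      (real (CARD('a) ^ s) - real (card fixed) ^ card {j\<in>J. blk j = blk x})
    \<le> real (card (bindep_tuples s blk (insert x J)))"
proof -
  let ?V = "{..<s} \<rightarrow>\<^sub>E (UNIV :: 'a set)"
  let ?J = "{j\<in>J. blk j = blk x}"
  let ?C = "?J \<rightarrow>\<^sub>E fixed"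
  define W where "W A = (\<lambda>c. \<lambda>r\<in>{..<s}. \<Sum>j\<in>?J. c j * A j r) ` ?C" for A :: "'b \<Rightarrow> nat \<Rightarrow> 'a"
  have finV: "finite ?V" by (simp add: finite_PiE)
  have cardV: "card ?V = CARD('a) ^ s" by (simp add: card_PiE)
  have finT: "finite (bindep_tuples s blk J')" if "finite J'" for J' :: "'b set"
    unfolding bindep_tuples_def using that finV by (simp add: finite_PiE)
  have cardVW: "real (CARD('a) ^ s) - real (card fixed) ^ card ?J \<le> real (card (?V - W A))" for A
  proof -
    have "card (W A) \<le> card ?C" unfolding W_def using fin by (intro card_image_le finite_PiE) simp_all
    also have "\<dots> = card fixed ^ card ?J" using fin by (simp add: card_PiE)
    finally have W: "card (W A) \<le> card fixed ^ card ?J" .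
    have "W A \<subseteq> ?V" unfolding W_def by (intro image_subsetI) simp
    hence "card (?V - W A) = card ?V - card (W A)" "card (W A) \<le> card ?V"
      by (intro card_Diff_subset finite_subset[OF _ finV] card_mono[OF finV]; assumption)+
    hence "real (card (?V - W A)) = real (CARD('a) ^ s) - real (card (W A))"
      using cardV by (simp add: of_nat_diff)
    moreover have "real (card (W A)) \<le> real (card fixed) ^ card ?J"
      unfolding of_nat_power[symmetric] using W by (simp only: of_nat_le_iff)
    ultimately show ?thesis by linarith
  qed
  let ?S = "Sigma (bindep_tuples s blk J) (\<lambda>A. ?V - W A)"
  let ?f = "\<lambda>(A, w). A(x := w)"
  have "inj_on ?f ?S"
  proof (rule inj_onI)
    fix y y' assume y: "y \<in> ?S" "y' \<in> ?S" and eq: "?f y = ?f y'"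
    obtain A w A' w' where yy: "y = (A, w)" "y' = (A', w')" by (metis surj_pair)
    have AJ: "A \<in> J \<rightarrow>\<^sub>E ?V" "A' \<in> J \<rightarrow>\<^sub>E ?V" using y yy by (simp_all add: bindep_tuples_def)
    have undef: "A x = undefined" "A' x = undefined"
      by (rule PiE_arb[OF AJ(1) x] PiE_arb[OF AJ(2) x])+
    have eq': "A(x := w) = A'(x := w')" using eq yy by simp
    hence "w = w'" by (metis fun_upd_same)
    moreover have "A z = A' z" for z
      using fun_cong[OF eq', of z] undef by (cases "z = x") simp_all
    ultimately show "y = y'" using yy by auto
  qed
  moreover have "?f ` ?S \<subseteq> bindep_tuples s blk (insert x J)"
  proof (rule image_subsetI)
    fix y assume y: "y \<in> ?S"
    obtain A w where yy: "y = (A, w)" by (metis surj_pair)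
    have A: "A \<in> J \<rightarrow>\<^sub>E ?V" "bindep fixed blk s (\<lambda>r j. A j r) J" and w: "w \<in> ?V" "w \<notin> W A"
      using y yy by (simp_all add: bindep_tuples_def)
    let ?A = "A(x := w)"
    have "rels fixed blk s (\<lambda>r j. ?A j r) J = rels fixed blk s (\<lambda>r j. A j r) J"
    proof -
      have "(\<Sum>j\<in>{j\<in>J. blk j = b}. c j * ?A j r) = (\<Sum>j\<in>{j\<in>J. blk j = b}. c j * A j r)" for b c r
        by (intro sum.cong refl) (use x in auto)
      thus ?thesis unfolding rels_def by simp
    qed
    hence "bindep fixed blk s (\<lambda>r j. ?A j r) J" using A(2) by (simp add: bindep_def)
    hence "bindep fixed blk s (\<lambda>r j. ?A j r) (insert x J)"
    proof (rule bindep_insert[OF fin x], intro notI, elim exE conjE)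
      fix c assume c: "\<forall>j\<in>J. c j \<in> fixed" "\<forall>r<s. ?A x r = (\<Sum>j\<in>?J. c j * ?A j r)"
      have "w = (\<lambda>r\<in>{..<s}. \<Sum>j\<in>?J. restrict c ?J j * A j r)"
      proof
        fix r
        show "w r = (\<lambda>r\<in>{..<s}. \<Sum>j\<in>?J. restrict c ?J j * A j r) r"
        proof (cases "r < s")
          case True
          have "w r = (\<Sum>j\<in>?J. c j * ?A j r)" using c(2) True by simp
          also have "\<dots> = (\<Sum>j\<in>?J. restrict c ?J j * A j r)"
            by (intro sum.cong refl) (use x in auto)
          finally show ?thesis using True by simp
        next
          case False
          then show ?thesis using PiE_arb[OF w(1), of r] by simp
        qed
      qed
      moreover have "restrict c ?J \<in> ?C" using c(1) by simp
      ultimately have "w \<in> W A" unfolding W_def by (rule image_eqI)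
      thus False using w(2) by contradiction
    qed
    moreover have "?A \<in> insert x J \<rightarrow>\<^sub>E ?V"
      using A(1) w(1) by (intro PiE_fun_upd)
    ultimately show "?f y \<in> bindep_tuples s blk (insert x J)"
      using yy by (simp add: bindep_tuples_def)
  qed
  moreover have "finite (bindep_tuples s blk (insert x J))" using finT fin by blast
  ultimately have "card ?S \<le> card (bindep_tuples s blk (insert x J))" by (rule card_inj_on_le)
  moreover have "card ?S = (\<Sum>A\<in>bindep_tuples s blk J. card (?V - W A))"
    using finT[OF fin] finV by (intro card_SigmaI) simp_all
  ultimately have "(\<Sum>A\<in>bindep_tuples s blk J. real (card (?V - W A)))
      \<le> real (card (bindep_tuples s blk (insert x J)))"
    unfolding of_nat_sum[symmetric] by (simp only: of_nat_le_iff)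
  moreover have "real (card (bindep_tuples s blk J)) * (real (CARD('a) ^ s) - real (card fixed) ^ card ?J)
      \<le> (\<Sum>A\<in>bindep_tuples s blk J. real (card (?V - W A)))"
    using sum_bounded_below[of "bindep_tuples s blk J"
        "real (CARD('a) ^ s) - real (card fixed) ^ card ?J" "\<lambda>A. real (card (?V - W A))"] cardVW
    by simp
  ultimately show ?thesis by linarith
qed

text \<open>With \<open>Q = CARD('a) ^ s\<close>, a new column contributes the factor
  \<open>Q - card fixed ^ i\<close>, where \<open>i\<close> counts the earlier columns of its block;
  this gives one product per block. The bound on the block sizes keeps the factor
  nonnegative.\<close>

lemma card_bindep_tuples_ge:
  assumes "finite J" "blk ` J \<subseteq> {..<ell}"
    and "\<And>b. card fixed ^ card {j\<in>J. blk j = b} \<le> CARD('a) ^ s"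
  shows "real (CARD('a) ^ s) ^ card J *
      (\<Prod>b<ell. \<Prod>i<card {j\<in>J. blk j = b}. 1 - real (card fixed) ^ i / real (CARD('a) ^ s))
    \<le> real (card (bindep_tuples s blk J))"
  using assms
proof (induction J rule: finite_induct)
  case empty
  have "bindep_tuples s blk ({} :: 'b set) = {\<lambda>_. undefined}"
    by (auto simp: bindep_tuples_def bindep_def)
  then show ?case by simp
next
  case (insert x J)
  let ?Q = "real (CARD('a) ^ s)" and ?k = "real (card fixed)"
  let ?n = "\<lambda>J b. card {j\<in>J. blk j = b}"
  let ?p = "\<lambda>n. \<Prod>i<n. 1 - ?k ^ i / ?Q"
  have mono: "?n J b \<le> ?n (insert x J) b" for b
    using insert.hyps(1) by (intro card_mono) auto
  have kpos: "1 \<le> card fixed"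
  proof -
    have "fixed \<noteq> {}" using hom_zero by blast
    moreover have "finite fixed" by (rule finite)
    ultimately have "0 < card fixed" by (simp only: card_gt_0_iff simp_thms)
    thus ?thesis by simp
  qed
  have le: "card fixed ^ ?n J b \<le> CARD('a) ^ s" for b
    using power_increasing[OF mono[of b] kpos] insert.prems(2)[of b] by (rule order.trans)
  have IH: "?Q ^ card J * (\<Prod>b<ell. ?p (?n J b)) \<le> real (card (bindep_tuples s blk J))"
    by (rule insert.IH) (use insert.prems(1) le in auto)
  have Qpos: "0 < ?Q" by (simp add: card_gt_0_iff)
  have bx: "blk x \<in> {..<ell}" using insert.prems(1) by simp
  have same: "?n (insert x J) (blk x) = Suc (?n J (blk x))"
  proof -
    have "{j \<in> insert x J. blk j = blk x} = insert x {j\<in>J. blk j = blk x}" by auto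
    thus ?thesis using insert.hyps by simp
  qed
  have other: "?n (insert x J) b = ?n J b" if "b \<noteq> blk x" for b
  proof -
    have "{j \<in> insert x J. blk j = b} = {j\<in>J. blk j = b}" using that by auto
    thus ?thesis by simp
  qed
  have "(\<Prod>b<ell. ?p (?n (insert x J) b))
      = ?p (?n (insert x J) (blk x)) * (\<Prod>b\<in>{..<ell} - {blk x}. ?p (?n (insert x J) b))"
    by (rule prod.remove) (use bx in simp_all)
  also have "(\<Prod>b\<in>{..<ell} - {blk x}. ?p (?n (insert x J) b)) = (\<Prod>b\<in>{..<ell} - {blk x}. ?p (?n J b))"
    by (rule prod.cong) (use other in auto)
  also have "?p (?n (insert x J) (blk x)) = (1 - ?k ^ ?n J (blk x) / ?Q) * ?p (?n J (blk x))"
    unfolding same by simp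
  also have "\<dots> * (\<Prod>b\<in>{..<ell} - {blk x}. ?p (?n J b)) = (1 - ?k ^ ?n J (blk x) / ?Q) * (\<Prod>b<ell. ?p (?n J b))"
    using prod.remove[of "{..<ell}" "blk x" "\<lambda>b. ?p (?n J b)"] bx by simp
  finally have eq: "(\<Prod>b<ell. ?p (?n (insert x J) b)) = (1 - ?k ^ ?n J (blk x) / ?Q) * (\<Prod>b<ell. ?p (?n J b))" .
  have "?Q ^ card (insert x J) * (\<Prod>b<ell. ?p (?n (insert x J) b))
      = (?Q ^ card J * (\<Prod>b<ell. ?p (?n J b))) * (?Q * (1 - ?k ^ ?n J (blk x) / ?Q))"
    unfolding eq using insert.hyps by simp
  also have "?Q * (1 - ?k ^ ?n J (blk x) / ?Q) = ?Q - ?k ^ ?n J (blk x)"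
    using Qpos by (simp add: right_diff_distrib)
  also have "(?Q ^ card J * (\<Prod>b<ell. ?p (?n J b))) * (?Q - ?k ^ ?n J (blk x))
      \<le> real (card (bindep_tuples s blk J)) * (?Q - ?k ^ ?n J (blk x))"
  proof (rule mult_right_mono[OF IH])
    have "real (card fixed ^ ?n J (blk x)) \<le> real (CARD('a) ^ s)" using le by (simp only: of_nat_le_iff)
    thus "0 \<le> ?Q - ?k ^ ?n J (blk x)" by simp
  qed
  also have "\<dots> \<le> real (card (bindep_tuples s blk (insert x J)))"
    by (rule card_bindep_tuples_insert[OF insert.hyps])
  finally show ?case .
qed

end


section \<open>Errors with the same column relations\<close>

lemma rels_cong:
  assumes "\<And>r j. r < s \<Longrightarrow> j \<in> J \<Longrightarrow> X r j = Y r j"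
  shows "rels K blk s X J = rels K blk s Y J"
proof -
  have "(\<Sum>j\<in>{j\<in>J. blk j = b}. c j * X r j) = (\<Sum>j\<in>{j\<in>J. blk j = b}. c j * Y r j)" if "r < s" for c b r
    by (intro sum.cong refl) (use assms[OF that] in simp)
  thus ?thesis unfolding rels_def by simp
qed

lemma bindep_cong:
  assumes "\<And>r j. r < s \<Longrightarrow> j \<in> J \<Longrightarrow> X r j = Y r j"
  shows "bindep K blk s X J \<longleftrightarrow> bindep K blk s Y J"
proof -
  have "rels K blk s X J = rels K blk s Y J" by (rule rels_cong) (rule assms)
  thus ?thesis by (simp only: bindep_def)
qed

lemma finite_carrier_mat: "finite (carrier_mat s n :: 'a::finite mat set)"
proof (rule finite_subset)
  show "carrier_mat s n \<subseteq> (\<lambda>f. mat s n f) ` (({..<s} \<times> {..<n}) \<rightarrow>\<^sub>E (UNIV :: 'a set))"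
  proof
    fix E :: "'a mat" assume "E \<in> carrier_mat s n"
    hence eq: "mat s n (\<lambda>ij\<in>{..<s} \<times> {..<n}. E $$ ij) = E" by (intro eq_matI) auto
    have "mat s n (\<lambda>ij\<in>{..<s} \<times> {..<n}. E $$ ij) \<in> (\<lambda>f. mat s n f) ` (({..<s} \<times> {..<n}) \<rightarrow>\<^sub>E UNIV)"
      by (intro imageI restrict_PiE_iff[THEN iffD2] ballI UNIV_I)
    thus "E \<in> (\<lambda>f. mat s n f) ` (({..<s} \<times> {..<n}) \<rightarrow>\<^sub>E UNIV)" by (simp only: eq)
  qed
qed (intro finite_imageI finite_PiE; simp)

abbreviation entry :: "'a mat \<Rightarrow> nat \<Rightarrow> nat \<Rightarrow> 'a" where
  "entry E r p \<equiv> E $$ (r, p)"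

context finite_field_aut
begin

text \<open>Fixing the relations amounts to fixing \<open>B\<close> in the factorization of an error
  and letting its independent columns vary.\<close>

definition fiber :: "nat \<Rightarrow> nat \<Rightarrow> (nat \<Rightarrow> nat) \<Rightarrow> 'a mat \<Rightarrow> 'a mat set" where
  "fiber s n blk E0 = {E \<in> carrier_mat s n.
    rels fixed blk s (entry E) {..<n} = rels fixed blk s (entry E0) {..<n}}"

definition orthogonal :: "(nat \<Rightarrow> nat) \<Rightarrow> (nat \<Rightarrow> 'a) \<Rightarrow> nat \<Rightarrow> (nat \<Rightarrow> 'a) \<Rightarrow> 'a mat \<Rightarrow> bool" where
  "orthogonal blk \<alpha> N v E \<longleftrightarrow> (\<forall>r<dim_row E. \<forall>e<N.
    (\<Sum>p<dim_col E. E $$ (r, p) * gen_op \<phi> e (v p) (\<alpha> (blk p))) = 0)"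

lemma finite_fiber: "finite (fiber s n blk E0)"
  by (rule finite_subset[OF _ finite_carrier_mat[of s n]]) (auto simp: fiber_def)

context
  fixes s n :: nat and blk :: "nat \<Rightarrow> nat" and J :: "nat set" and B :: "nat \<Rightarrow> nat \<Rightarrow> 'a" and E0 :: "'a mat"
  assumes JP: "J \<subseteq> {..<n}"
    and B: "basis_coeffs fixed blk {..<n} J B"
    and ind0: "bindep fixed blk s (entry E0) J"
    and lin0: "\<forall>r<s. \<forall>p\<in>{..<n}. entry E0 r p = (\<Sum>j\<in>J. B j p * entry E0 r j)"
begin

lemma finite_fiber_basis: "finite J"
  by (rule finite_subset[OF JP]) simp

lemma fiber_bindep:
  assumes "E \<in> fiber s n blk E0"
  shows "bindep fixed blk s (entry E) J"
proof (rule bindep_cong_rels[OF _ _ JP _ ind0])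
  show "rels fixed blk s (entry E0) {..<n} = rels fixed blk s (entry E) {..<n}"
    using assms by (simp add: fiber_def)
qed simp_all

text \<open>The expansion of a column of \<open>E0\<close> is one of its relations by
  \<open>column_relation_iff\<close>, hence also one of \<open>E\<close>.\<close>

lemma fiber_lincomb:
  assumes E: "E \<in> fiber s n blk E0" and r: "r < s" and p: "p < n"
  shows "entry E r p = (\<Sum>j\<in>J. B j p * entry E r j)"
proof (cases "p \<in> J")
  case True
  have "(\<Sum>j\<in>J. B j p * entry E r j) = (\<Sum>j\<in>J. if j = p then entry E r j else 0)"
    by (intro sum.cong refl) (use basis_coeffsD(3)[OF B _ True] in simp)
  thus ?thesis using True finite_fiber_basis by simp
next
  case False
  have p': "p \<in> {..<n}" using p by simp
  have "(\<lambda>i. if i = p then - 1 else if i \<in> J then B i p else 0) \<in> rels fixed blk s (entry E0) {..<n}"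
    by (subst column_relation_iff[OF _ JP B p' False]) (use lin0 p' in \<open>auto simp: hom_uminus\<close>)
  hence "(\<lambda>i. if i = p then - 1 else if i \<in> J then B i p else 0) \<in> rels fixed blk s (entry E) {..<n}"
    using E by (simp add: fiber_def)
  hence "\<forall>r<s. entry E r p = (\<Sum>j\<in>J. B j p * entry E r j)"
    by (subst (asm) column_relation_iff[OF _ JP B p' False]) (auto simp: hom_uminus)
  thus ?thesis using r by simp
qed

text \<open>Multiplication by \<open>B\<close> maps independent tuples into the fiber, by
  \<open>rels_extend\<close>. It is injective because the columns in \<open>J\<close> of the product
  are the given ones.\<close>

lemma card_bindep_tuples_le_fiber: "card (bindep_tuples s blk J) \<le> card (fiber s n blk E0)"
proof (rule card_inj_on_le[OF _ _ finite_fiber])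
  define f where "f A = mat s n (\<lambda>(r, p). \<Sum>j\<in>J. B j p * A j r)" for A :: "nat \<Rightarrow> nat \<Rightarrow> 'a"
  have fe: "entry (f A) r p = (\<Sum>j\<in>J. B j p * A j r)" if "r < s" "p < n" for A r p
    using that by (simp add: f_def)
  have fJ: "entry (f A) r j = A j r" if "r < s" "j \<in> J" for A r j
  proof -
    have "entry (f A) r j = (\<Sum>i\<in>J. B i j * A i r)" using that JP by (intro fe) auto
    also have "\<dots> = (\<Sum>i\<in>J. if i = j then A i r else 0)"
      by (intro sum.cong refl) (use basis_coeffsD(3)[OF B _ that(2)] in simp)
    finally show ?thesis using that finite_fiber_basis by simp
  qed
  show "inj_on f (bindep_tuples s blk J)"
  proof (rule inj_onI)
    fix A A' assume A: "A \<in> bindep_tuples s blk J" "A' \<in> bindep_tuples s blk J" and eq: "f A = f A'"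
    have PA: "A \<in> J \<rightarrow>\<^sub>E ({..<s} \<rightarrow>\<^sub>E UNIV)" "A' \<in> J \<rightarrow>\<^sub>E ({..<s} \<rightarrow>\<^sub>E UNIV)"
      using A by (simp_all add: bindep_tuples_def)
    show "A = A'"
    proof (rule PiE_ext[OF PA])
      fix j assume j: "j \<in> J"
      have Pj: "A j \<in> {..<s} \<rightarrow>\<^sub>E UNIV" "A' j \<in> {..<s} \<rightarrow>\<^sub>E UNIV"
        using PiE_mem[OF PA(1) j] PiE_mem[OF PA(2) j] by blast+
      show "A j = A' j"
      proof (rule PiE_ext[OF Pj])
        fix r assume "r \<in> {..<s}"
        hence "r < s" by simp
        thus "A j r = A' j r" using fJ[OF _ j, of r A] fJ[OF _ j, of r A'] eq by simp
      qed
    qed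
  qed
  show "f ` bindep_tuples s blk J \<subseteq> fiber s n blk E0"
  proof (rule image_subsetI)
    fix A assume "A \<in> bindep_tuples s blk J"
    hence "bindep fixed blk s (\<lambda>r j. A j r) J" by (simp add: bindep_tuples_def)
    hence ind: "bindep fixed blk s (entry (f A)) J"
      by (subst bindep_cong[where Y = "\<lambda>r j. A j r"]) (use fJ in simp_all)
    have lin: "entry (f A) r p = (\<Sum>j\<in>J. B j p * entry (f A) r j)" if "r < s" "p \<in> {..<n}" for r p
    proof -
      have "entry (f A) r p = (\<Sum>j\<in>J. B j p * A j r)" using that by (intro fe) simp_all
      also have "\<dots> = (\<Sum>j\<in>J. B j p * entry (f A) r j)"
        by (intro sum.cong refl) (use fJ[OF that(1)] in simp)
      finally show ?thesis .
    qed
    have "rels fixed blk s (entry (f A)) {..<n} = rels fixed blk s (entry E0) {..<n}"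
      using rels_extend[OF _ JP B ind lin] rels_extend[OF _ JP B ind0] lin0 by simp
    thus "f A \<in> fiber s n blk E0" by (simp add: fiber_def f_def)
  qed
qed

lemma orthogonal_contract:
  assumes E: "E \<in> fiber s n blk E0" and orth: "orthogonal blk \<alpha> N v E" and r: "r < s" and e: "e < N"
  shows "(\<Sum>j\<in>J. entry E r j * gen_op \<phi> e (\<Sum>p<n. B j p * v p) (\<alpha> (blk j))) = 0"
proof -
  have dim: "dim_row E = s" "dim_col E = n" using E by (auto simp: fiber_def)
  have "0 = (\<Sum>p<n. entry E r p * gen_op \<phi> e (v p) (\<alpha> (blk p)))"
    using orth r e by (simp add: orthogonal_def dim)
  also have "\<dots> = (\<Sum>p<n. (\<Sum>j\<in>J. B j p * entry E r j) * gen_op \<phi> e (v p) (\<alpha> (blk p)))"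
    by (intro sum.cong refl arg_cong2[where f = "(*)"] fiber_lincomb[OF E r]) simp
  also have "\<dots> = (\<Sum>j\<in>J. entry E r j * gen_op \<phi> e (\<Sum>p<n. B j p * v p) (\<alpha> (blk j)))"
    by (rule gen_op_contract[OF _ finite_fiber_basis B]) simp
  finally show ?thesis by simp
qed

lemma orthogonal_fiber_empty:
  assumes sep: "separated blk \<alpha> {..<n}" and j0: "j0 \<in> J" "(\<Sum>p<n. B j0 p * v p) \<noteq> 0"
    and mx: "maximal_bindep fixed blk 1 (\<lambda>_ j. \<Sum>p<n. B j p * v p) J T" and le: "card T \<le> N"
    and E: "E \<in> fiber s n blk E0"
  shows "\<not> orthogonal blk \<alpha> N v E"
proof
  assume orth: "orthogonal blk \<alpha> N v E"
  show False
    by (rule bindep_not_orthogonal[OF finite_fiber_basis separated_subset[OF sep JP]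
          j0(1) j0(2) mx le fiber_bindep[OF E] orthogonal_contract[OF E orth]])
qed

text \<open>If the contracted vector has at most \<open>N\<close> independent entries, nothing in
  the fiber is orthogonal. Otherwise choose \<open>N\<close> independent positions \<open>U\<close>;
  in every row the equations determine the entries in \<open>U\<close> from those in
  \<open>J - U\<close>.\<close>

lemma card_orthogonal_fiber_le:
  assumes sep: "separated blk \<alpha> {..<n}" and j0: "j0 \<in> J" "(\<Sum>p<n. B j0 p * v p) \<noteq> 0"
  shows "card {E \<in> fiber s n blk E0. orthogonal blk \<alpha> N v E} * CARD('a) ^ (s * N) \<le> CARD('a) ^ (s * card J)"
proof -
  let ?w = "\<lambda>j. \<Sum>p<n. B j p * v p"
  let ?O = "{E \<in> fiber s n blk E0. orthogonal blk \<alpha> N v E}"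
  obtain T where mx: "maximal_bindep fixed blk 1 (\<lambda>_. ?w) J T"
    using maximal_bindep_exists[OF finite_fiber_basis] by blast
  show ?thesis
  proof (cases "card T \<le> N")
    case True
    have "?O = {}" using orthogonal_fiber_empty[OF sep j0 mx True] by blast
    then show ?thesis by (simp only:) simp
  next
    case False
    then obtain U where U: "U \<subseteq> T" "card U = N" by (meson nat_le_linear obtain_subset_with_card_n)
    have T: "T \<subseteq> J" "bindep fixed blk 1 (\<lambda>_. ?w) T" using mx by (simp_all add: maximal_bindep_def)
    have UJ: "U \<subseteq> J" using U(1) T(1) by (rule subset_trans)
    have finT: "finite T" by (rule finite_subset[OF T(1) finite_fiber_basis])
    have indU: "bindep fixed blk 1 (\<lambda>_. ?w) U" by (rule bindep_subset[OF T(2) finT U(1)]) simp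
    let ?D = "{..<s} \<times> (J - U)"
    let ?P = "?D \<rightarrow>\<^sub>E (UNIV :: 'a set)"
    have finD: "finite ?D" using finite_fiber_basis by simp
    have "inj_on (\<lambda>E. restrict (\<lambda>ij. E $$ ij) ?D) ?O"
    proof (rule inj_onI)
      fix E E' assume EE: "E \<in> ?O" "E' \<in> ?O"
        and eq: "restrict (\<lambda>ij. E $$ ij) ?D = restrict (\<lambda>ij. E' $$ ij) ?D"
      have E: "E \<in> fiber s n blk E0" "orthogonal blk \<alpha> N v E" using EE(1) by simp_all
      have E': "E' \<in> fiber s n blk E0" "orthogonal blk \<alpha> N v E'" using EE(2) by simp_all
      have onJ: "entry E r j = entry E' r j" if r: "r < s" and j: "j \<in> J" for r j
      proof (rule orthogonal_unique[OF finite_fiber_basis separated_subset[OF sep JP] UJ indU _ _ _ j])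
        fix e assume "e < card U"
        hence "e < N" using U(2) by simp
        thus "(\<Sum>j\<in>J. entry E r j * gen_op \<phi> e (?w j) (\<alpha> (blk j))) = 0"
          "(\<Sum>j\<in>J. entry E' r j * gen_op \<phi> e (?w j) (\<alpha> (blk j))) = 0"
          using orthogonal_contract[OF E r] orthogonal_contract[OF E' r] by blast+
      next
        fix j assume "j \<in> J - U"
        hence "(r, j) \<in> ?D" using r by simp
        thus "entry E r j = entry E' r j" using fun_cong[OF eq, of "(r, j)"] by simp
      qed
      show "E = E'"
      proof (rule eq_matI)
        fix r p assume "r < dim_row E'" "p < dim_col E'"
        hence rp: "r < s" "p < n" using E'(1) by (auto simp: fiber_def)
        have "entry E r p = (\<Sum>j\<in>J. B j p * entry E r j)" by (rule fiber_lincomb[OF E(1) rp])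
        also have "\<dots> = (\<Sum>j\<in>J. B j p * entry E' r j)"
          by (intro sum.cong refl) (use onJ[OF rp(1)] in simp)
        also have "\<dots> = entry E' r p" by (rule fiber_lincomb[OF E'(1) rp, symmetric])
        finally show "entry E r p = entry E' r p" .
      next
        show "dim_row E = dim_row E'" "dim_col E = dim_col E'"
          using E(1) E'(1) by (auto simp: fiber_def)
      qed
    qed
    moreover have "(\<lambda>E. restrict (\<lambda>ij. E $$ ij) ?D) ` ?O \<subseteq> ?P" by (intro image_subsetI) simp
    moreover have "finite ?P" using finD by (intro finite_PiE) simp_all
    ultimately have "card ?O \<le> card ?P" by (rule card_inj_on_le)
    also have "card ?P = CARD('a) ^ (s * (card J - N))"
      using finD UJ U(2) finite_fiber_basis finite_subset[OF UJ finite_fiber_basis]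
      by (simp add: card_PiE card_Diff_subset)
    finally have "card ?O * CARD('a) ^ (s * N) \<le> CARD('a) ^ (s * (card J - N)) * CARD('a) ^ (s * N)"
      by (rule mult_right_mono) simp
    also have "\<dots> = CARD('a) ^ (s * card J)"
    proof -
      have "N \<le> card J" using card_mono[OF finite_fiber_basis UJ] U(2) by simp
      hence "s * (card J - N) + s * N = s * card J" by (simp add: add_mult_distrib2[symmetric])
      thus ?thesis by (simp add: power_add[symmetric])
    qed
    finally show ?thesis .
  qed
qed

end
end


section \<open>Sum-rank weight and matrix rank\<close>

lemma block_start_Suc: "i < length ns \<Longrightarrow> block_start ns (Suc i) = block_start ns i + ns ! i"
  by (simp add: block_start_def take_Suc_conv_app_nth)

lemma block_start_mono: "i \<le> j \<Longrightarrow> block_start ns i \<le> block_start ns j"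
proof -
  assume "i \<le> j"
  hence "take j ns = take i ns @ take (j - i) (drop i ns)" by (metis le_add_diff_inverse take_add)
  thus ?thesis by (simp add: block_start_def)
qed

lemma block_of_eq:
  assumes "block_start ns i \<le> p" "p < block_start ns (Suc i)"
  shows "block_of ns p = i"
  unfolding block_of_def
proof (rule Least_equality)
  fix k assume "p < block_start ns (Suc k)"
  thus "i \<le> k" using block_start_mono[of "Suc k" i ns] assms(1) by (cases "i \<le> k") auto
qed (rule assms(2))

lemma block_of_bounds:
  assumes "p < sum_list ns"
  shows "block_of ns p < length ns" "block_start ns (block_of ns p) \<le> p"
    "p < block_start ns (block_of ns p) + ns ! block_of ns p"
proof -
  \<comment> \<open>\<open>take\<close> saturates, so the index \<open>length ns\<close> is a
    witness for the \<open>LEAST\<close> in \<open>block_of\<close>. That the least index is smaller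
    than \<open>length ns\<close> is shown afterwards.\<close>
  have ex: "p < block_start ns (Suc (length ns))" using assms by (simp add: block_start_def)
  have lt: "p < block_start ns (Suc (block_of ns p))" unfolding block_of_def
    using LeastI[of "\<lambda>i. p < block_start ns (Suc i)", OF ex] .
  show ge: "block_start ns (block_of ns p) \<le> p"
  proof (cases "block_of ns p")
    case 0
    then show ?thesis by (simp add: block_start_def)
  next
    case (Suc k)
    hence "\<not> p < block_start ns (Suc k)"
      using not_less_Least[of k "\<lambda>i. p < block_start ns (Suc i)"] by (simp add: block_of_def)
    then show ?thesis using Suc by simp
  qed
  show len: "block_of ns p < length ns"
  proof (rule ccontr)
    assume "\<not> ?thesis"
    hence "block_start ns (block_of ns p) = sum_list ns" by (simp add: block_start_def)
    thus False using ge assms by simp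
  qed
  show "p < block_start ns (block_of ns p) + ns ! block_of ns p"
    using lt block_start_Suc[OF len] by simp
qed

lemma block_of_block_start:
  assumes "i < length ns" "c < ns ! i"
  shows "block_of ns (block_start ns i + c) = i" "block_start ns i + c < sum_list ns"
proof -
  show "block_of ns (block_start ns i + c) = i"
    by (rule block_of_eq) (use assms in \<open>simp_all add: block_start_Suc\<close>)
  have "block_start ns i + c < block_start ns (Suc i)" using assms by (simp add: block_start_Suc)
  also have "\<dots> \<le> block_start ns (length ns)" using assms(1) by (intro block_start_mono) simp
  also have "\<dots> = sum_list ns" by (simp add: block_start_def)
  finally show "block_start ns i + c < sum_list ns" .
qed

lemma bindep_blockwise:
  assumes fin: "finite J" and K: "0 \<in> K"
  shows "bindep K blk s X J \<longleftrightarrow> (\<forall>b. bindep K blk s X {j\<in>J. blk j = b})"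
proof
  assume "bindep K blk s X J"
  from bindep_subset[OF this fin _ K] show "\<forall>b. bindep K blk s X {j\<in>J. blk j = b}" by simp
next
  assume R: "\<forall>b. bindep K blk s X {j\<in>J. blk j = b}"
  show "bindep K blk s X J"
    unfolding bindep_def
  proof (intro ballI)
    fix c j assume c: "c \<in> rels K blk s X J" and j: "j \<in> J"
    have "(\<Sum>i\<in>{i\<in>{i\<in>J. blk i = blk j}. blk i = b}. c i * X r i) = 0" if "r < s" for b r
    proof (cases "b = blk j")
      case True
      hence "{i\<in>{i\<in>J. blk i = blk j}. blk i = b} = {i\<in>J. blk i = b}" by auto
      then show ?thesis using c that unfolding rels_def mem_Collect_eq by simp
    next
      case False
      hence "{i\<in>{i\<in>J. blk i = blk j}. blk i = b} = {}" by auto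
      then show ?thesis by (simp only: sum.empty)
    qed
    hence "c \<in> rels K blk s X {i\<in>J. blk i = blk j}" using c unfolding rels_def mem_Collect_eq by blast
    thus "c j = 0" by (rule bindepD[OF R[rule_format]]) (use j in simp)
  qed
qed

lemma bindep_single_block:
  assumes "\<And>j. j \<in> J \<Longrightarrow> blk j = b"
  shows "bindep K blk s X J \<longleftrightarrow>
    (\<forall>c. (\<forall>j\<in>J. c j \<in> K) \<and> (\<forall>r<s. (\<Sum>j\<in>J. c j * X r j) = 0) \<longrightarrow> (\<forall>j\<in>J. c j = 0))"
proof -
  have J: "{j\<in>J. blk j = b'} = (if b' = b then J else {})" for b' using assms by auto
  have "(\<forall>b'. \<forall>r<s. (\<Sum>j\<in>{j\<in>J. blk j = b'}. c j * X r j) = 0)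
      \<longleftrightarrow> (\<forall>r<s. (\<Sum>j\<in>J. c j * X r j) = 0)" for c
  proof
    assume "\<forall>b'. \<forall>r<s. (\<Sum>j\<in>{j\<in>J. blk j = b'}. c j * X r j) = 0"
    from spec[OF this, of b] show "\<forall>r<s. (\<Sum>j\<in>J. c j * X r j) = 0" unfolding J by simp
  next
    assume z: "\<forall>r<s. (\<Sum>j\<in>J. c j * X r j) = 0"
    show "\<forall>b'. \<forall>r<s. (\<Sum>j\<in>{j\<in>J. blk j = b'}. c j * X r j) = 0"
      unfolding J using z by simp
  qed
  hence "c \<in> rels K blk s X J \<longleftrightarrow> (\<forall>j\<in>J. c j \<in> K) \<and> (\<forall>r<s. (\<Sum>j\<in>J. c j * X r j) = 0)" for c
    unfolding rels_def mem_Collect_eq by (simp only:)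
  thus ?thesis unfolding bindep_def by (simp only: Ball_def imp_conjL)
qed

text \<open>Links column numbers within block \<open>i\<close> to positions in the whole matrix,
  which differ by the offset \<open>block_start ns i\<close>.\<close>

lemma indep_cols_block_iff:
  assumes i: "i < length ns" and J: "J \<subseteq> {..<ns ! i}"
  shows "indep_cols K (block ns i X) J \<longleftrightarrow>
    bindep K (block_of ns) (dim_row X) (entry X) ((+) (block_start ns i) ` J)"
proof -
  let ?b = "block_start ns i"
  have blk: "block_of ns j = i" if "j \<in> (+) ?b ` J" for j
    using that J block_of_block_start(1)[OF i] by auto
  have entry: "block ns i X $$ (r, j) = entry X r (?b + j)" if "r < dim_row X" "j \<in> J" for r j
    using that J by (auto simp: block_def)
  have "indep_cols K (block ns i X) J \<longleftrightarrow> (\<forall>c. (\<forall>j\<in>J. c j \<in> K) \<and>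
      (\<forall>r<dim_row X. (\<Sum>j\<in>J. c j * entry X r (?b + j)) = 0) \<longrightarrow> (\<forall>j\<in>J. c j = 0))"
  proof -
    have "(\<Sum>j\<in>J. c j * block ns i X $$ (r, j)) = (\<Sum>j\<in>J. c j * entry X r (?b + j))"
      if "r < dim_row X" for c r
      by (intro sum.cong refl) (use entry[OF that] in simp)
    thus ?thesis unfolding indep_cols_def by (simp add: block_def)
  qed
  also have "\<dots> \<longleftrightarrow> (\<forall>c. (\<forall>j\<in>J. c (?b + j) \<in> K) \<and>
      (\<forall>r<dim_row X. (\<Sum>j\<in>J. c (?b + j) * entry X r (?b + j)) = 0) \<longrightarrow> (\<forall>j\<in>J. c (?b + j) = 0))"
    (is "?L \<longleftrightarrow> ?R")
  proof
    assume L: ?L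
    show ?R
    proof
      fix c
      show "(\<forall>j\<in>J. c (?b + j) \<in> K) \<and>
        (\<forall>r<dim_row X. (\<Sum>j\<in>J. c (?b + j) * entry X r (?b + j)) = 0) \<longrightarrow> (\<forall>j\<in>J. c (?b + j) = 0)"
        using spec[OF L, of "\<lambda>j. c (?b + j)"] .
    qed
  next
    assume R: ?R
    show ?L
    proof
      fix c
      show "(\<forall>j\<in>J. c j \<in> K) \<and> (\<forall>r<dim_row X. (\<Sum>j\<in>J. c j * entry X r (?b + j)) = 0)
          \<longrightarrow> (\<forall>j\<in>J. c j = 0)"
        using spec[OF R, of "\<lambda>j. c (j - ?b)"] unfolding add_diff_cancel_left' .
    qed
  qed
  also have "\<dots> \<longleftrightarrow> bindep K (block_of ns) (dim_row X) (entry X) ((+) ?b ` J)"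
    using bindep_single_block[of "(+) ?b ` J" "block_of ns" i K "dim_row X" "entry X", OF blk]
    by (simp add: sum.reindex)
  finally show ?thesis .
qed

lemma rk_over_max:
  shows "J \<subseteq> {..<dim_col X} \<Longrightarrow> indep_cols K X J \<Longrightarrow> card J \<le> rk_over K X"
    and "\<exists>J\<subseteq>{..<dim_col X}. indep_cols K X J \<and> card J = rk_over K X"
proof -
  let ?S = "{card J | J. J \<subseteq> {..<dim_col X} \<and> indep_cols K X J}"
  have "?S = card ` {J. J \<subseteq> {..<dim_col X} \<and> indep_cols K X J}" by blast
  hence fin: "finite ?S" by simp
  show "card J \<le> rk_over K X" if "J \<subseteq> {..<dim_col X}" "indep_cols K X J" for J
    unfolding rk_over_def by (rule Max_ge[OF fin]) (use that in blast)
  have "indep_cols K X {}" by (simp add: indep_cols_def)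
  hence "?S \<noteq> {}" by blast
  from Max_in[OF fin this] show "\<exists>J\<subseteq>{..<dim_col X}. indep_cols K X J \<and> card J = rk_over K X"
    unfolding rk_over_def by auto
qed

text \<open>Together with \<open>sum_rank_wt_attained\<close> this identifies the sum-rank weight as
  the largest size of a blockwise independent set of positions.\<close>

lemma sum_rank_wt_ge:
  assumes K: "0 \<in> K" and n: "sum_list ns = n" and J: "J \<subseteq> {..<n}"
    and ind: "bindep K (block_of ns) (dim_row X) (entry X) J"
  shows "card J \<le> sum_rank_wt K ns X"
proof -
  have finJ: "finite J" by (rule finite_subset[OF J]) simp
  define Ji where "Ji i = {j\<in>J. block_of ns j = i}" for i
  have J_eq: "J = (\<Union>i<length ns. Ji i)"
  proof (intro equalityI subsetI)
    fix j assume "j \<in> J"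
    moreover from this have "j < sum_list ns" using J n by blast
    ultimately show "j \<in> (\<Union>i<length ns. Ji i)" using block_of_bounds(1)[of j ns] by (simp add: Ji_def)
  qed (simp add: Ji_def)
  have "card J = (\<Sum>i<length ns. card (Ji i))"
    by (subst J_eq, rule card_UN_disjoint) (use finJ in \<open>auto simp: Ji_def\<close>)
  also have "\<dots> \<le> (\<Sum>i<length ns. rk_over K (block ns i X))"
  proof (rule sum_mono)
    fix i assume "i \<in> {..<length ns}"
    hence i: "i < length ns" by simp
    let ?b = "block_start ns i"
    define L where "L = (\<lambda>p. p - ?b) ` Ji i"
    have bnd: "?b \<le> p" "p < ?b + ns ! i" if "p \<in> Ji i" for p
      using block_of_bounds(2,3)[of p ns] that J n by (auto simp: Ji_def)
    have LI: "(+) ?b ` L = Ji i" unfolding L_def image_image using bnd by force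
    have L: "L \<subseteq> {..<ns ! i}" using bnd by (fastforce simp: L_def)
    have "bindep K (block_of ns) (dim_row X) (entry X) (Ji i)"
      using bindep_blockwise[OF finJ K] ind by (simp add: Ji_def)
    hence "indep_cols K (block ns i X) L" by (subst indep_cols_block_iff[OF i L]) (simp only: LI)
    moreover have "L \<subseteq> {..<dim_col (block ns i X)}" using L by (simp add: block_def)
    ultimately have "card L \<le> rk_over K (block ns i X)" by (intro rk_over_max(1))
    moreover have "card (Ji i) = card L"
      unfolding LI[symmetric] by (intro card_image) simp
    ultimately show "card (Ji i) \<le> rk_over K (block ns i X)" by simp
  qed
  finally show ?thesis by (simp add: sum_rank_wt_def)
qed

text \<open>Choose a largest independent set in every block. The shifted sets are disjoint, and
  independence of their union is tested block by block.\<close>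

lemma sum_rank_wt_attained:
  assumes K: "0 \<in> K" and n: "sum_list ns = n"
  shows "\<exists>J\<subseteq>{..<n}. bindep K (block_of ns) (dim_row X) (entry X) J \<and> card J = sum_rank_wt K ns X"
proof -
  have "\<forall>i. \<exists>L. L \<subseteq> {..<dim_col (block ns i X)} \<and> indep_cols K (block ns i X) L
      \<and> card L = rk_over K (block ns i X)"
    using rk_over_max(2) by blast
  then obtain L where L0: "\<forall>i. L i \<subseteq> {..<dim_col (block ns i X)} \<and> indep_cols K (block ns i X) (L i)
      \<and> card (L i) = rk_over K (block ns i X)"
    by (rule choice[THEN exE])
  have L: "L i \<subseteq> {..<ns ! i}" "indep_cols K (block ns i X) (L i)" "card (L i) = rk_over K (block ns i X)" for i
    using spec[OF L0, of i] by (simp_all add: block_def)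
  define Ji where "Ji i = (+) (block_start ns i) ` L i" for i
  define J where "J = (\<Union>i<length ns. Ji i)"
  have blk: "block_of ns p = i" "p < n" if i: "i < length ns" and p: "p \<in> Ji i" for p i
  proof -
    obtain c where "p = block_start ns i + c" "c < ns ! i" using p L(1)[of i] by (auto simp: Ji_def)
    thus "block_of ns p = i" "p < n" using block_of_block_start[OF i, of c] n by simp_all
  qed
  have finL: "finite (L i)" for i by (rule finite_subset[OF L(1)]) simp
  have finJi: "finite (Ji i)" for i unfolding Ji_def by (intro finite_imageI finL)
  have J: "J \<subseteq> {..<n}"
  proof
    fix p assume "p \<in> J"
    then obtain i where "i < length ns" "p \<in> Ji i" by (auto simp: J_def)
    thus "p \<in> {..<n}" using blk(2)[of i p] by simp
  qed
  have finJ: "finite J" by (rule finite_subset[OF J]) simp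
  have Jb: "{j\<in>J. block_of ns j = b} = (if b < length ns then Ji b else {})" for b
  proof (intro equalityI subsetI)
    fix p assume "p \<in> {j\<in>J. block_of ns j = b}"
    then obtain i where "i < length ns" "p \<in> Ji i" "block_of ns p = b" by (auto simp: J_def)
    thus "p \<in> (if b < length ns then Ji b else {})" using blk(1)[of i p] by simp
  next
    fix p assume "p \<in> (if b < length ns then Ji b else {})"
    hence "b < length ns" "p \<in> Ji b" by (simp_all split: if_splits)
    thus "p \<in> {j\<in>J. block_of ns j = b}" using blk(1)[of b p] by (auto simp: J_def)
  qed
  have "bindep K (block_of ns) (dim_row X) (entry X) J"
  proof (subst bindep_blockwise[OF finJ K], rule allI)
    fix b
    show "bindep K (block_of ns) (dim_row X) (entry X) {j\<in>J. block_of ns j = b}"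
    proof (cases "b < length ns")
      case True
      have "bindep K (block_of ns) (dim_row X) (entry X) (Ji b)"
        using indep_cols_block_iff[OF True L(1)[of b], where K = K and X = X] L(2)[of b]
        by (simp only: Ji_def)
      then show ?thesis using True by (simp only: Jb if_True)
    next
      case False
      then show ?thesis by (simp only: Jb if_False) (simp add: bindep_def)
    qed
  qed
  moreover have "card J = sum_rank_wt K ns X"
  proof -
    have "card J = (\<Sum>i<length ns. card (Ji i))"
      unfolding J_def
    proof (rule card_UN_disjoint)
      show "\<forall>i\<in>{..<length ns}. \<forall>j\<in>{..<length ns}. i \<noteq> j \<longrightarrow> Ji i \<inter> Ji j = {}"
      proof (intro ballI impI equals0I)
        fix i j p assume "i \<in> {..<length ns}" "j \<in> {..<length ns}" "i \<noteq> j" "p \<in> Ji i \<inter> Ji j"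
        thus False using blk(1)[of i p] blk(1)[of j p] by simp
      qed
    qed (use finJi in simp_all)
    also have "\<dots> = (\<Sum>i<length ns. rk_over K (block ns i X))"
    proof (rule sum.cong[OF refl])
      fix i
      have "card (Ji i) = card (L i)" unfolding Ji_def by (intro card_image) simp
      thus "card (Ji i) = rk_over K (block ns i X)" using L(3) by simp
    qed
    finally show ?thesis by (simp add: sum_rank_wt_def)
  qed
  ultimately show ?thesis using J by blast
qed

section \<open>Rank deficiency and kernel vectors\<close>

lemma mat_rank_le: "mat_rank A \<le> dim_col A"
  unfolding mat_rank_def by (rule vec_space.rank_le_nc[of A "dim_row A"]) simp

text \<open>Linear dependence is formulated for the set of columns, which does not see repetitions.
  Equal columns are therefore treated apart; their kernel vector is the difference of two unit
  vectors.\<close>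

lemma mat_rank_less_imp_kernel:
  assumes "mat_rank A < dim_col A"
  shows "\<exists>u. (\<exists>c<dim_col A. u c \<noteq> 0) \<and> (\<forall>i<dim_row A. (\<Sum>c<dim_col A. A $$ (i, c) * u c) = 0)"
proof (cases "distinct (cols A)")
  case True
  interpret vec_space "TYPE('a)" "dim_row A" .
  have A: "A \<in> carrier_mat (dim_row A) (dim_col A)" by simp
  have "\<not> lin_indpt (set (cols A))"
  proof
    assume "lin_indpt (set (cols A))"
    from lin_indpt_full_rank[OF A True this] show False using assms by (simp add: mat_rank_def)
  qed
  then obtain v where v: "v \<in> carrier_vec (dim_col A)" "v \<noteq> 0\<^sub>v (dim_col A)" "A *\<^sub>v v = 0\<^sub>v (dim_row A)"
    using lin_depE[OF A _ True] by blast
  have "\<exists>c<dim_col A. v $ c \<noteq> 0"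
  proof (rule ccontr)
    assume "\<not> ?thesis"
    hence z: "v $ c = 0" if "c < dim_col A" for c using that by blast
    have "v = 0\<^sub>v (dim_col A)"
    proof (rule eq_vecI)
      fix c assume "c < dim_vec (0\<^sub>v (dim_col A) :: 'a vec)"
      thus "v $ c = 0\<^sub>v (dim_col A) $ c" using z[of c] by simp
    qed (use v(1) in simp)
    thus False using v(2) by contradiction
  qed
  moreover have "(\<Sum>c<dim_col A. A $$ (i, c) * v $ c) = 0" if "i < dim_row A" for i
  proof -
    have "(A *\<^sub>v v) $ i = (\<Sum>c<dim_col A. A $$ (i, c) * v $ c)"
      using that v(1) by (simp add: scalar_prod_def lessThan_atLeast0)
    thus ?thesis using v(3) that by simp
  qed
  ultimately show ?thesis by (intro exI[of _ "\<lambda>c. v $ c"]) simp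
next
  case False
  then obtain i j where ij: "i < dim_col A" "j < dim_col A" "i \<noteq> j" "col A i = col A j"
    unfolding distinct_conv_nth by auto
  have "(\<Sum>c<dim_col A. A $$ (r, c) * ((if c = i then 1 else 0) - (if c = j then 1 else 0))) = 0"
    if r: "r < dim_row A" for r
  proof -
    have delta: "(\<Sum>c<dim_col A. A $$ (r, c) * (if c = k then 1 else 0)) = A $$ (r, k)" if "k < dim_col A" for k
    proof -
      have "(\<Sum>c<dim_col A. A $$ (r, c) * (if c = k then 1 else 0)) = (\<Sum>c\<in>{k}. A $$ (r, c) * (if c = k then 1 else 0))"
        by (rule sum.mono_neutral_right) (use that in simp_all)
      also have "\<dots> = A $$ (r, k)" by simp
      finally show ?thesis .
    qed
    have "(\<Sum>c<dim_col A. A $$ (r, c) * ((if c = i then 1 else 0) - (if c = j then 1 else 0)))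
        = A $$ (r, i) - A $$ (r, j)"
      by (simp only: right_diff_distrib sum_subtractf delta[OF ij(1)] delta[OF ij(2)])
    also have "\<dots> = col A i $ r - col A j $ r" using ij(1,2) r by (simp add: col_def)
    finally show ?thesis using ij(4) by simp
  qed
  moreover have "\<exists>c<dim_col A. (if c = i then 1 else 0) - (if c = j then 1 else (0::'a)) \<noteq> 0"
    using ij(1,3) by (intro exI[of _ i]) simp
  ultimately show ?thesis
    by (intro exI[of _ "\<lambda>c. (if c = i then 1 else 0) - (if c = j then 1 else 0)"] conjI allI impI)
qed


section \<open>Syndromes\<close>

locale inverse_field_aut = finite_field_aut \<phi> for \<phi> :: "'a::{field,finite} \<Rightarrow> 'a" +
  fixes \<theta> :: "'a \<Rightarrow> 'a"
  assumes right_inv [simp]: "\<theta> (\<phi> x) = x" and left_inv [simp]: "\<phi> (\<theta> x) = x"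
begin

lemma field_aut_inverse: "field_aut \<theta>"
proof
  fix x y
  have "\<phi> (\<theta> (x + y)) = \<phi> (\<theta> x + \<theta> y)" by (simp add: hom_add del: hom_eq_iff)
  thus "\<theta> (x + y) = \<theta> x + \<theta> y" by (simp only: hom_eq_iff)
  have "\<phi> (\<theta> (x * y)) = \<phi> (\<theta> x * \<theta> y)" by (simp add: hom_mult del: hom_eq_iff)
  thus "\<theta> (x * y) = \<theta> x * \<theta> y" by (simp only: hom_eq_iff)
next
  show "bij \<theta>" by (rule o_bij[of \<phi>]) (simp_all add: fun_eq_iff)
qed

lemma funpow_right_inv: "(\<theta> ^^ i) ((\<phi> ^^ i) x) = x"
  by (induction i arbitrary: x) (simp_all add: funpow_swap1)

lemma funpow_left_inv: "(\<phi> ^^ i) ((\<theta> ^^ i) x) = x"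
  by (induction i arbitrary: x) (simp_all add: funpow_swap1)

text \<open>\<open>\<theta> ^^ i\<close> carries the factors of the norm of \<open>\<phi> a\<close>
  under \<open>\<phi>\<close> to those of the norm of \<open>a\<close> under
  \<open>\<theta>\<close>, in reverse order.\<close>

lemma gen_norm_inverse: "(\<theta> ^^ i) (gen_norm \<phi> i (\<phi> a)) = gen_norm \<theta> i a"
proof (induction i)
  case 0
  interpret t: field_aut \<theta> by (rule field_aut_inverse)
  show ?case by (simp add: gen_norm_def)
next
  case (Suc i)
  interpret t: field_aut \<theta> by (rule field_aut_inverse)
  interpret ti: field_aut "\<theta> ^^ Suc i" by (rule t.field_aut_funpow)
  have "gen_norm \<phi> (Suc i) (\<phi> a) = gen_norm \<phi> i (\<phi> a) * (\<phi> ^^ Suc i) a"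
    by (simp add: gen_norm_def funpow_swap1)
  hence "(\<theta> ^^ Suc i) (gen_norm \<phi> (Suc i) (\<phi> a))
      = (\<theta> ^^ Suc i) (gen_norm \<phi> i (\<phi> a)) * (\<theta> ^^ Suc i) ((\<phi> ^^ Suc i) a)"
    by (simp only: ti.hom_mult)
  also have "\<dots> = \<theta> (gen_norm \<theta> i a) * a" by (simp only: funpow_right_inv) (simp add: Suc.IH)
  also have "\<dots> = gen_norm \<theta> (Suc i) a"
    using t.gen_norm_add[of 1 i a] by (simp add: gen_norm_def mult.commute)
  finally show ?case .
qed

lemma gen_op_inverse: "(\<theta> ^^ i) (gen_op \<phi> i x (\<phi> a)) = x * gen_norm \<theta> i a"
proof -
  interpret t: field_aut \<theta> by (rule field_aut_inverse)
  interpret ti: field_aut "\<theta> ^^ i" by (rule t.field_aut_funpow)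
  show ?thesis by (simp add: gen_op_def ti.hom_mult funpow_right_inv gen_norm_inverse)
qed

text \<open>Applying \<open>\<theta> ^^ i\<close> trades \<open>i\<close> steps of the inverse
  operator on \<open>h\<close> for \<open>i\<close> further steps on \<open>\<beta>\<close>. This
  explains the parameters \<open>\<phi> (\<xi> p)\<close> of the parity-check matrix.\<close>

lemma evaluations_orthogonal:
  assumes "(\<Sum>p\<in>P. h p * gen_op \<theta> (i + j) (\<beta> p) (\<xi> p)) = 0"
  shows "(\<Sum>p\<in>P. gen_op \<theta> j (\<beta> p) (\<xi> p) * gen_op \<phi> i (h p) (\<phi> (\<xi> p))) = 0"
proof -
  interpret t: field_aut \<theta> by (rule field_aut_inverse)
  interpret ti: field_aut "\<theta> ^^ i" by (rule t.field_aut_funpow)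
  have "(\<theta> ^^ i) (\<Sum>p\<in>P. gen_op \<theta> j (\<beta> p) (\<xi> p) * gen_op \<phi> i (h p) (\<phi> (\<xi> p)))
      = (\<Sum>p\<in>P. h p * gen_op \<theta> (i + j) (\<beta> p) (\<xi> p))"
    unfolding ti.hom_sum
  proof (rule sum.cong[OF refl])
    fix p
    show "(\<theta> ^^ i) (gen_op \<theta> j (\<beta> p) (\<xi> p) * gen_op \<phi> i (h p) (\<phi> (\<xi> p)))
        = h p * gen_op \<theta> (i + j) (\<beta> p) (\<xi> p)"
      by (simp only: ti.hom_mult gen_op_inverse t.gen_op_add mult_ac)
  qed
  thus ?thesis using assms ti.hom_eq_0_iff by simp
qed

text \<open>Applying \<open>\<phi> ^^ e\<close> to the hypothesis cancels
  \<open>\<theta> ^^ e\<close> and turns \<open>u c\<close> into \<open>(\<phi> ^^ e) (u c)\<close>,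
  which is what \<open>gen_op \<phi> e\<close> makes of a coefficient \<open>u c\<close> in its
  argument.\<close>

lemma kernel_imp_orthogonal:
  assumes "\<And>r e. r < dim_row E \<Longrightarrow> e < N \<Longrightarrow>
    (\<Sum>c<t. (\<theta> ^^ e) (\<Sum>p<dim_col E. E $$ (r, p) * gen_op \<phi> (e + Suc c) (h p) (\<alpha> (blk p))) * u c) = 0"
  shows "orthogonal blk \<alpha> N (\<lambda>p. \<Sum>c<t. u c * gen_op \<phi> (Suc c) (h p) (\<alpha> (blk p))) E"
  unfolding orthogonal_def
proof (intro allI impI)
  fix r e assume re: "r < dim_row E" "e < N"
  interpret t: field_aut \<theta> by (rule field_aut_inverse)
  interpret f: field_aut "\<phi> ^^ e" by (rule field_aut_funpow)
  let ?g = "\<lambda>c p. gen_op \<phi> (Suc c) (h p) (\<alpha> (blk p))"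
  have "(\<Sum>p<dim_col E. E $$ (r, p) * gen_op \<phi> e (\<Sum>c<t. u c * ?g c p) (\<alpha> (blk p)))
      = (\<Sum>p<dim_col E. \<Sum>c<t. E $$ (r, p) * gen_op \<phi> (e + Suc c) (h p) (\<alpha> (blk p)) * (\<phi> ^^ e) (u c))"
  proof (rule sum.cong[OF refl])
    fix p
    have "gen_op \<phi> e (\<Sum>c<t. u c * ?g c p) (\<alpha> (blk p))
        = (\<Sum>c<t. (\<phi> ^^ e) (u c) * gen_op \<phi> (e + Suc c) (h p) (\<alpha> (blk p)))"
      unfolding gen_op_add gen_op_def[of _ e] f.hom_sum f.hom_mult sum_distrib_right
      by (simp only: mult.assoc)
    thus "E $$ (r, p) * gen_op \<phi> e (\<Sum>c<t. u c * ?g c p) (\<alpha> (blk p))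
        = (\<Sum>c<t. E $$ (r, p) * gen_op \<phi> (e + Suc c) (h p) (\<alpha> (blk p)) * (\<phi> ^^ e) (u c))"
      by (simp only: sum_distrib_left mult.assoc mult.commute mult.left_commute)
  qed
  also have "\<dots> = (\<Sum>c<t. (\<Sum>p<dim_col E. E $$ (r, p) * gen_op \<phi> (e + Suc c) (h p) (\<alpha> (blk p))) * (\<phi> ^^ e) (u c))"
    by (subst sum.swap) (simp only: sum_distrib_right)
  also have "\<dots> = (\<phi> ^^ e) (\<Sum>c<t. (\<theta> ^^ e) (\<Sum>p<dim_col E. E $$ (r, p) * gen_op \<phi> (e + Suc c) (h p) (\<alpha> (blk p))) * u c)"
    by (simp only: f.hom_sum f.hom_mult funpow_left_inv)
  also have "\<dots> = 0" using assms[OF re] f.hom_zero by simp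
  finally show "(\<Sum>p<dim_col E. E $$ (r, p) * gen_op \<phi> e (\<Sum>c<t. u c * ?g c p) (\<alpha> (blk p))) = 0" .
qed

end

text \<open>The index in \<open>h_orth\<close> counts from zero, so \<open>Suc l < n\<close> covers
  the \<open>n - 1\<close> orthogonality conditions on \<open>h\<close>.\<close>

locale lrs_syndrome = inverse_field_aut \<phi> \<theta> for \<phi> \<theta> :: "'a::{field,finite} \<Rightarrow> 'a" +
  fixes ns :: "nat list" and n k s :: nat and \<beta> \<xi> h :: "'a vec" and H C :: "'a mat"
  assumes n: "sum_list ns = n" and k: "k \<le> n"
    and \<xi>: "\<xi> \<in> carrier_vec (length ns)" and h: "h \<in> carrier_vec n"
    and h_orth: "\<And>l. Suc l < n \<Longrightarrow> h \<bullet> gen_op_vec \<theta> ns l \<beta> \<xi> = 0"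
    and H: "H = moore \<phi> ns (n - k) h (map_vec \<phi> \<xi>)"
    and C: "C \<in> VILRS \<theta> \<beta> \<xi> s ns k"
begin

abbreviation par :: "nat \<Rightarrow> 'a" where "par b \<equiv> \<phi> (\<xi> $ b)"

lemma dim_H: "dim_row H = n - k" "dim_col H = n"
  by (simp_all add: H moore_def n)

lemma H_entry:
  assumes "i < n - k" "p < n"
  shows "H $$ (i, p) = gen_op \<phi> i (h $ p) (par (block_of ns p))"
proof -
  have "block_of ns p < length ns" using block_of_bounds(1)[of p ns] assms(2) n by simp
  hence "map_vec \<phi> \<xi> $ block_of ns p = par (block_of ns p)" using \<xi> by simp
  thus ?thesis using assms by (simp add: H moore_def mat_of_rows_def gen_op_vec_def n)
qed

lemma C_dim: "C \<in> carrier_mat s n"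
  using C n by (simp add: VILRS_def)

lemma codeword_orthogonal:
  assumes j: "j < s" and i: "i < n - k"
  shows "(\<Sum>p<n. C $$ (j, p) * H $$ (i, p)) = 0"
proof -
  have "row C j \<in> LRS \<theta> \<beta> \<xi> ns k" using C j by (simp add: VILRS_def)
  then obtain f where f: "row C j = op_eval_vec \<theta> ns f \<beta> \<xi>" "f = 0 \<or> degree f < k"
    by (auto simp: LRS_def)
  let ?b = "\<lambda>p. \<xi> $ block_of ns p"
  have Cjp: "C $$ (j, p) = (\<Sum>l\<le>degree f. coeff f l * gen_op \<theta> l (\<beta> $ p) (?b p))" if "p < n" for p
  proof -
    have "C $$ (j, p) = row C j $ p" using C_dim j that by simp
    also have "\<dots> = op_eval \<theta> f (\<beta> $ p) (?b p)" unfolding f(1) using that n by (simp add: op_eval_vec_def)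
    finally show ?thesis by (simp only: op_eval_def)
  qed
  have orth: "coeff f l * (\<Sum>p<n. gen_op \<theta> l (\<beta> $ p) (?b p) * H $$ (i, p)) = 0" if l: "l \<le> degree f" for l
  \<comment> \<open>The zero polynomial has degree 0, which need not be below \<open>k\<close>, but
    its coefficient vanishes.\<close>
  proof (cases "f = 0")
    case False
    hence lk: "l < k" using f(2) l by simp
    \<comment> \<open>From \<open>l < k\<close> and \<open>i < n - k\<close> follows
      \<open>i + l \<le> n - 2\<close>, the last index at which \<open>h\<close> is
      orthogonal.\<close>
    have "h \<bullet> gen_op_vec \<theta> ns (i + l) \<beta> \<xi> = 0" by (rule h_orth) (use lk i in linarith)
    hence "(\<Sum>p<n. h $ p * gen_op \<theta> (i + l) (\<beta> $ p) (?b p)) = 0"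
      by (simp add: scalar_prod_def gen_op_vec_def n lessThan_atLeast0)
    hence "(\<Sum>p<n. gen_op \<theta> l (\<beta> $ p) (?b p) * gen_op \<phi> i (h $ p) (\<phi> (?b p))) = 0"
      by (rule evaluations_orthogonal)
    also have "(\<Sum>p<n. gen_op \<theta> l (\<beta> $ p) (?b p) * gen_op \<phi> i (h $ p) (\<phi> (?b p)))
        = (\<Sum>p<n. gen_op \<theta> l (\<beta> $ p) (?b p) * H $$ (i, p))"
      by (intro sum.cong refl) (simp add: H_entry[OF i])
    finally show ?thesis by simp
  qed simp
  have "(\<Sum>p<n. C $$ (j, p) * H $$ (i, p))
      = (\<Sum>p<n. \<Sum>l\<le>degree f. coeff f l * (gen_op \<theta> l (\<beta> $ p) (?b p) * H $$ (i, p)))"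
    by (intro sum.cong refl) (simp add: Cjp sum_distrib_right mult.assoc)
  also have "\<dots> = (\<Sum>l\<le>degree f. coeff f l * (\<Sum>p<n. gen_op \<theta> l (\<beta> $ p) (?b p) * H $$ (i, p)))"
    by (subst sum.swap) (simp only: sum_distrib_left)
  also have "\<dots> = 0" by (intro sum.neutral ballI) (use orth in simp)
  finally show ?thesis .
qed

lemma syndrome_entry:
  assumes E: "E \<in> carrier_mat s n" and j: "j < s" and i: "i < n - k"
  shows "((C + E) * transpose_mat H) $$ (j, i)
    = (\<Sum>p<n. E $$ (j, p) * gen_op \<phi> i (h $ p) (par (block_of ns p)))"
proof -
  have "((C + E) * transpose_mat H) $$ (j, i) = (\<Sum>p<n. (C + E) $$ (j, p) * H $$ (i, p))"
    using C_dim E j i dim_H by (simp add: scalar_prod_def lessThan_atLeast0)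
  also have "\<dots> = (\<Sum>p<n. C $$ (j, p) * H $$ (i, p) + E $$ (j, p) * H $$ (i, p))"
    by (intro sum.cong refl) (use C_dim E j in \<open>simp add: distrib_right\<close>)
  also have "\<dots> = (\<Sum>p<n. E $$ (j, p) * H $$ (i, p))"
    using codeword_orthogonal[OF j i] by (simp add: sum.distrib)
  also have "\<dots> = (\<Sum>p<n. E $$ (j, p) * gen_op \<phi> i (h $ p) (par (block_of ns p)))"
    by (intro sum.cong refl) (simp add: H_entry[OF i])
  finally show ?thesis .
qed

text \<open>Rows are read from the bottom, with \<open>e\<close> the distance from the last one.
  Then the syndrome has index \<open>Suc c + e\<close>, and \<open>\<phi> ^^ Suc c\<close> cancels
  all of \<open>\<theta> ^^ (Suc c + e)\<close> except \<open>\<theta> ^^ e\<close>.\<close>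

lemma syndrome_block_entry:
  assumes E: "E \<in> carrier_mat s n" and j: "j < s" and e: "e < n - k - t" and c: "c < t"
    and \<phi>: "\<phi> = inv_into UNIV \<theta>"
  shows "syndrome_block \<theta> H t (C + E) j $$ (n - k - t - Suc e, c)
    = (\<theta> ^^ e) (\<Sum>p<n. E $$ (j, p) * gen_op \<phi> (e + Suc c) (h $ p) (par (block_of ns p)))"
proof -
  have idx: "n - k - (t + Suc (n - k - t - Suc e) - Suc c) = Suc c + e" and lt: "Suc c + e < n - k"
    using e c by linarith+
  have "syndrome_block \<theta> H t (C + E) j $$ (n - k - t - Suc e, c)
      = (\<phi> ^^ Suc c) (mod_syndrome \<theta> H (C + E) j (t + Suc (n - k - t - Suc e) - Suc c))"
    unfolding syndrome_block_def \<phi>[symmetric] using e c by (simp add: dim_H)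
  also have "\<dots> = (\<phi> ^^ Suc c) ((\<theta> ^^ (Suc c + e)) (((C + E) * transpose_mat H) $$ (j, Suc c + e)))"
    unfolding mod_syndrome_def Let_def dim_H idx ..
  also have "\<dots> = (\<theta> ^^ e) (((C + E) * transpose_mat H) $$ (j, Suc c + e))"
    unfolding funpow_add o_apply funpow_left_inv ..
  also have "\<dots> = (\<theta> ^^ e) (\<Sum>p<n. E $$ (j, p) * gen_op \<phi> (e + Suc c) (h $ p) (par (block_of ns p)))"
    unfolding syndrome_entry[OF E j lt] by (simp only: add.commute[of "Suc c" e])
  finally show ?thesis .
qed

lemma syndrome_mat_dim: "dim_col (syndrome_mat \<theta> H t Y) = t"
  by (simp add: syndrome_mat_def)

lemma syndrome_mat_row:
  assumes "j < dim_row Y" "r < dim_row H - t"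
  shows "\<exists>i<dim_row (syndrome_mat \<theta> H t Y). \<forall>c<t.
    syndrome_mat \<theta> H t Y $$ (i, c) = syndrome_block \<theta> H t Y j $$ (r, c)"
proof -
  let ?L = "concat (map (\<lambda>j. rows (syndrome_block \<theta> H t Y j)) [0..<dim_row Y])"
  let ?b = "syndrome_block \<theta> H t Y j"
  have dimb: "dim_row ?b = dim_row H - t" "dim_col ?b = t" by (simp_all add: syndrome_block_def)
  have "row ?b r \<in> set (rows ?b)" using assms(2) dimb by (auto simp: rows_def)
  hence "row ?b r \<in> set ?L" using assms(1) by auto
  then obtain i where i: "i < length ?L" "?L ! i = row ?b r" by (meson in_set_conv_nth)
  have "syndrome_mat \<theta> H t Y $$ (i, c) = ?b $$ (r, c)" if "c < t" for c
  proof -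
    have "syndrome_mat \<theta> H t Y $$ (i, c) = ?L ! i $ c"
      unfolding syndrome_mat_def by (rule mat_of_rows_index[OF i(1) that])
    thus ?thesis unfolding i(2) using assms(2) dimb that by simp
  qed
  moreover have "i < dim_row (syndrome_mat \<theta> H t Y)" using i(1) by (simp add: syndrome_mat_def)
  ultimately show ?thesis by blast
qed

definition syndrome_kernel :: "nat \<Rightarrow> 'a mat \<Rightarrow> (nat \<Rightarrow> 'a) \<Rightarrow> bool" where
  "syndrome_kernel t E u \<longleftrightarrow> (\<forall>i<dim_row (syndrome_mat \<theta> H t (C + E)).
    (\<Sum>c<t. syndrome_mat \<theta> H t (C + E) $$ (i, c) * u c) = 0)"

lemma syndrome_kernel_orthogonal:
  assumes E: "E \<in> carrier_mat s n" and \<phi>: "\<phi> = inv_into UNIV \<theta>" and ker: "syndrome_kernel t E u"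
  shows "orthogonal (block_of ns) par (n - k - t)
    (\<lambda>p. \<Sum>c<t. u c * gen_op \<phi> (Suc c) (h $ p) (par (block_of ns p))) E"
proof (rule kernel_imp_orthogonal)
  fix j e assume j: "j < dim_row E" and e: "e < n - k - t"
  have j': "j < s" using j E by simp
  have jY: "j < dim_row (C + E)" using j by simp
  have r: "n - k - t - Suc e < dim_row H - t" unfolding dim_H using e by linarith
  obtain i where i: "i < dim_row (syndrome_mat \<theta> H t (C + E))" and
    row: "\<forall>c<t. syndrome_mat \<theta> H t (C + E) $$ (i, c) = syndrome_block \<theta> H t (C + E) j $$ (n - k - t - Suc e, c)"
    using syndrome_mat_row[OF jY r] by blast
  have "(\<Sum>c<t. (\<theta> ^^ e) (\<Sum>p<n. E $$ (j, p) * gen_op \<phi> (e + Suc c) (h $ p) (par (block_of ns p))) * u c)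
      = (\<Sum>c<t. syndrome_mat \<theta> H t (C + E) $$ (i, c) * u c)"
  proof (rule sum.cong[OF refl])
    fix c assume "c \<in> {..<t}"
    hence c: "c < t" by simp
    show "(\<theta> ^^ e) (\<Sum>p<n. E $$ (j, p) * gen_op \<phi> (e + Suc c) (h $ p) (par (block_of ns p))) * u c
        = syndrome_mat \<theta> H t (C + E) $$ (i, c) * u c"
      by (simp only: row[rule_format, OF c] syndrome_block_entry[OF E j' e c \<phi>])
  qed
  also have "\<dots> = 0" using ker i by (simp add: syndrome_kernel_def)
  finally show "(\<Sum>c<t. (\<theta> ^^ e) (\<Sum>p<dim_col E. E $$ (j, p) *
      gen_op \<phi> (e + Suc c) (h $ p) (par (block_of ns p))) * u c) = 0"
    using E by simp
qed

lemma mat_rank_syndrome_less: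
  assumes "mat_rank (syndrome_mat \<theta> H t (C + E)) < t"
  shows "\<exists>u. (\<exists>c<t. u c \<noteq> 0) \<and> syndrome_kernel t E u"
  using mat_rank_less_imp_kernel[of "syndrome_mat \<theta> H t (C + E)"] assms
  unfolding syndrome_mat_dim syndrome_kernel_def .

end


context finite_field_aut
begin

text \<open>Different coefficients give different combinations of the independent entries of one
  block. In the application this bounds the length of a block by the extension degree.\<close>

lemma bindep_card_le:
  assumes fin: "finite P" and ind: "bindep fixed blk 1 (\<lambda>_. x) P"
  shows "card fixed ^ card {p\<in>P. blk p = b} \<le> CARD('a)"
proof -
  let ?P = "{p\<in>P. blk p = b}"
  let ?C = "?P \<rightarrow>\<^sub>E fixed"
  have finP: "finite ?P" using fin by simp
  have indP: "bindep fixed blk 1 (\<lambda>_. x) ?P" by (rule bindep_subset[OF ind fin]) auto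
  have inj: "inj_on (\<lambda>c. \<Sum>p\<in>?P. c p * x p) ?C"
  proof (rule inj_onI)
    fix c c' assume c: "c \<in> ?C" "c' \<in> ?C" and eq: "(\<Sum>p\<in>?P. c p * x p) = (\<Sum>p\<in>?P. c' p * x p)"
    have mem: "\<phi> (c p) = c p" "\<phi> (c' p) = c' p" if "p \<in> ?P" for p
      using PiE_mem[OF c(1) that] PiE_mem[OF c(2) that] by simp_all
    have sum0: "(\<Sum>p\<in>?P. (c p - c' p) * x p) = 0"
      using eq by (simp add: left_diff_distrib sum_subtractf)
    have "(\<Sum>p\<in>{p\<in>?P. blk p = b'}. (c p - c' p) * x p) = 0" for b'
    proof (cases "b' = b")
      case True
      hence "{p\<in>?P. blk p = b'} = ?P" by blast
      then show ?thesis using sum0 by (simp only:)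
    next
      case False
      hence "{p\<in>?P. blk p = b'} = {}" by blast
      then show ?thesis by (simp only: sum.empty)
    qed
    moreover have "\<forall>p\<in>?P. c p - c' p \<in> fixed"
    proof
      fix p assume "p \<in> ?P"
      thus "c p - c' p \<in> fixed" using mem[of p] by (simp only: mem_Collect_eq hom_diff)
    qed
    ultimately have "(\<lambda>p. c p - c' p) \<in> rels fixed blk 1 (\<lambda>_. x) ?P"
      unfolding rels_def by blast
    hence "c p - c' p = 0" if "p \<in> ?P" for p using bindepD[OF indP _ that, of "\<lambda>p. c p - c' p"] by simp
    thus "c = c'" by (intro PiE_ext[OF c]) simp
  qed
  have "card fixed ^ card ?P = card ?C" using finP by (simp add: card_PiE)
  also have "\<dots> = card ((\<lambda>c. \<Sum>p\<in>?P. c p * x p) ` ?C)" by (rule card_image[OF inj, symmetric])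
  also have "\<dots> \<le> CARD('a)" by (rule card_mono) simp_all
  finally show ?thesis .
qed

end

section \<open>The probability bound\<close>

text \<open>A bound on the proportion of \<open>P\<close> that holds in every class of the partition
  by \<open>key\<close> holds overall.\<close>

lemma card_le_by_fibers:
  fixes \<rho> :: real
  assumes fin: "finite S"
    and le: "\<And>x. x \<in> S \<Longrightarrow> real (card {y\<in>S. key y = key x \<and> P y}) \<le> \<rho> * real (card {y\<in>S. key y = key x})"
  shows "real (card {y\<in>S. P y}) \<le> \<rho> * real (card S)"
proof -
  have part: "real (card {y\<in>S. Q y}) = (\<Sum>z\<in>key ` S. real (card {y\<in>S. key y = z \<and> Q y}))" for Q
  proof -
    have "real (card {y\<in>S. Q y}) = (\<Sum>y\<in>S. if Q y then 1 else 0)"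
      using fin by (simp add: sum.inter_filter[symmetric])
    also have "\<dots> = (\<Sum>z\<in>key ` S. \<Sum>y\<in>{y\<in>S. key y = z}. if Q y then 1 else 0)"
      by (rule sum.image_gen[OF fin])
    also have "\<dots> = (\<Sum>z\<in>key ` S. real (card {y\<in>S. key y = z \<and> Q y}))"
    proof (rule sum.cong[OF refl])
      fix z
      have "{y\<in>{y\<in>S. key y = z}. Q y} = {y\<in>S. key y = z \<and> Q y}" by blast
      moreover have "(\<Sum>y\<in>{y\<in>S. key y = z}. if Q y then (1::real) else 0) = real (card {y\<in>{y\<in>S. key y = z}. Q y})"
        using fin by (simp add: sum.inter_filter[symmetric])
      ultimately show "(\<Sum>y\<in>{y\<in>S. key y = z}. if Q y then (1::real) else 0) = real (card {y\<in>S. key y = z \<and> Q y})"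
        by (simp only:)
    qed
    finally show ?thesis .
  qed
  have "real (card {y\<in>S. P y}) = (\<Sum>z\<in>key ` S. real (card {y\<in>S. key y = z \<and> P y}))" by (rule part)
  also have "\<dots> \<le> (\<Sum>z\<in>key ` S. \<rho> * real (card {y\<in>S. key y = z}))"
  proof (rule sum_mono)
    fix z assume "z \<in> key ` S"
    then obtain x where "x \<in> S" "z = key x" by blast
    thus "real (card {y\<in>S. key y = z \<and> P y}) \<le> \<rho> * real (card {y\<in>S. key y = z})" using le[of x] by simp
  qed
  also have "\<dots> = \<rho> * (\<Sum>z\<in>key ` S. real (card {y\<in>S. key y = z}))"
    by (simp only: sum_distrib_left)
  also have "\<dots> = \<rho> * real (card S)" using part[of "\<lambda>_. True"] by simp
  finally show ?thesis .
qed

locale lrs_decoding = lrs_syndrome \<phi> \<theta> ns n k s \<beta> \<xi> h H C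
  for \<phi> \<theta> :: "'a::{field,finite} \<Rightarrow> 'a" and ns n k s \<beta> \<xi> h H C +
  fixes q m :: nat
  assumes \<phi>_inv: "\<phi> = inv_into UNIV \<theta>"
    and q: "2 \<le> q" and card_fixed: "card fixed = q" and card_field: "CARD('a) = q ^ m"
    and sep: "separated (block_of ns) par {..<n}"
    and ind_h: "bindep fixed (block_of ns) 1 (\<lambda>_ p. h $ p) {..<n}"
begin

definition errors :: "nat \<Rightarrow> 'a mat set" where
  "errors t = {E \<in> carrier_mat s n. sum_rank_wt fixed ns E = t}"

abbreviation annihilator :: "nat \<Rightarrow> (nat \<Rightarrow> 'a) \<Rightarrow> nat \<Rightarrow> 'a" where
  "annihilator t u p \<equiv> \<Sum>c<t. u c * gen_op \<phi> (Suc c) (h $ p) (par (block_of ns p))"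

text \<open>Contraction with \<open>B\<close> commutes with the operators, so the contracted vector
  combines, with coefficients \<open>u\<close>, the shifted Moore rows of the contracted
  \<open>h\<close>. The latter is independent, and the system is square because \<open>u\<close> has
  \<open>card J\<close> entries.\<close>

lemma annihilator_contract_nonzero:
  assumes JP: "J \<subseteq> {..<n}" and B: "basis_coeffs fixed (block_of ns) {..<n} J B"
    and u: "c < card J" "u c \<noteq> 0"
  shows "\<exists>j\<in>J. (\<Sum>p<n. B j p * annihilator (card J) u p) \<noteq> 0"
proof (rule ccontr)
  assume neg: "\<not> ?thesis"
  let ?x = "\<lambda>j. \<Sum>p<n. B j p * h $ p"
  have finJ: "finite J" by (rule finite_subset[OF JP]) simp
  have ind: "bindep fixed (block_of ns) 1 (\<lambda>_. ?x) J"
    by (rule bindep_contract[OF _ JP B ind_h]) simp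
  have "u c = 0"
  proof (rule moore_indep_rows_Suc[OF finJ ind separated_subset[OF sep JP] _ u(1)])
    fix j assume j: "j \<in> J"
    have gop: "gen_op \<phi> (Suc c) (?x j) (par (block_of ns j))
        = (\<Sum>p<n. B j p * gen_op \<phi> (Suc c) (h $ p) (par (block_of ns p)))" for c
    proof -
      have "gen_op \<phi> (Suc c) (?x j) (par (block_of ns j))
          = (\<Sum>p<n. B j p * gen_op \<phi> (Suc c) (h $ p) (par (block_of ns j)))"
        by (rule gen_op_lincomb) (rule basis_coeffsD(1)[OF B j])
      also have "\<dots> = (\<Sum>p<n. B j p * gen_op \<phi> (Suc c) (h $ p) (par (block_of ns p)))"
      proof (rule sum.cong[OF refl])
        fix p assume "p \<in> {..<n}"
        thus "B j p * gen_op \<phi> (Suc c) (h $ p) (par (block_of ns j))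
            = B j p * gen_op \<phi> (Suc c) (h $ p) (par (block_of ns p))"
          using basis_coeffsD(2)[OF B j, of p] by (cases "block_of ns j = block_of ns p") simp_all
      qed
      finally show ?thesis .
    qed
    have "(\<Sum>i<card J. u i * gen_op \<phi> (Suc i) (?x j) (par (block_of ns j)))
        = (\<Sum>i<card J. \<Sum>p<n. B j p * (u i * gen_op \<phi> (Suc i) (h $ p) (par (block_of ns p))))"
      by (simp only: gop sum_distrib_left mult.left_commute)
    also have "\<dots> = (\<Sum>p<n. B j p * annihilator (card J) u p)"
      by (subst sum.swap) (simp only: sum_distrib_left)
    also have "\<dots> = 0"
    proof (rule ccontr)
      assume "(\<Sum>p<n. B j p * annihilator (card J) u p) \<noteq> 0"
      hence "\<exists>j\<in>J. (\<Sum>p<n. B j p * annihilator (card J) u p) \<noteq> 0" using j by (rule bexI)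
      thus False using neg by contradiction
    qed
    finally show "(\<Sum>i<card J. u i * gen_op \<phi> (Suc i) (?x j) (par (block_of ns j))) = 0" .
  qed
  thus False using u(2) by contradiction
qed

text \<open>A set of positions attaining the weight is largest, hence maximal, so
  \<open>maximal_bindep_coeffs\<close> applies.\<close>

lemma error_basis:
  assumes "E \<in> errors t"
  shows "\<exists>J B. J \<subseteq> {..<n} \<and> card J = t \<and> basis_coeffs fixed (block_of ns) {..<n} J B \<and>
    bindep fixed (block_of ns) s (entry E) J \<and>
    (\<forall>r<s. \<forall>p\<in>{..<n}. entry E r p = (\<Sum>j\<in>J. B j p * entry E r j))"
proof -
  have E: "E \<in> carrier_mat s n" "sum_rank_wt fixed ns E = t" and dim: "dim_row E = s"
    using assms by (auto simp: errors_def)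
  have K: "0 \<in> fixed" by simp
  obtain J where J: "J \<subseteq> {..<n}" "bindep fixed (block_of ns) s (entry E) J" "card J = t"
    using sum_rank_wt_attained[OF K n, of E] dim E(2) by blast
  have finJ: "finite J" by (rule finite_subset[OF J(1)]) simp
  have "\<not> bindep fixed (block_of ns) s (entry E) (insert p J)" if p: "p \<in> {..<n} - J" for p
  proof
    assume "bindep fixed (block_of ns) s (entry E) (insert p J)"
    hence "card (insert p J) \<le> t"
      using sum_rank_wt_ge[OF K n, of "insert p J" E] J(1) p dim E(2) by simp
    thus False using p finJ J(3) by simp
  qed
  hence mx: "maximal_bindep fixed (block_of ns) s (entry E) {..<n} J"
    using J(1,2) unfolding maximal_bindep_def by blast
  show ?thesis using maximal_bindep_coeffs[OF _ mx] J by blast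
qed

text \<open>The weight depends only on which sets of columns are independent, thus only on the
  relations. So the errors of one weight are a union of fibers.\<close>

lemma errors_fiber:
  assumes E: "E \<in> errors t"
  shows "fiber s n (block_of ns) E \<subseteq> errors t"
proof
  fix E' assume E': "E' \<in> fiber s n (block_of ns) E"
  have K: "0 \<in> fixed" by simp
  have dim: "dim_row E = s" "dim_row E' = s" using E E' by (auto simp: errors_def fiber_def)
  have rels: "rels fixed (block_of ns) s (entry E') {..<n} = rels fixed (block_of ns) s (entry E) {..<n}"
    using E' by (simp add: fiber_def)
  have iff: "bindep fixed (block_of ns) s (entry E') J \<longleftrightarrow> bindep fixed (block_of ns) s (entry E) J"
    if "J \<subseteq> {..<n}" for J
    by (rule bindep_iff_rels[OF rels _ that K]) simp
  have le: "sum_rank_wt fixed ns A \<le> sum_rank_wt fixed ns A'"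
    if A: "dim_row A = s" "dim_row A' = s"
      and i: "\<And>J. J \<subseteq> {..<n} \<Longrightarrow> bindep fixed (block_of ns) s (entry A) J \<Longrightarrow> bindep fixed (block_of ns) s (entry A') J"
    for A A'
  proof -
    obtain J where J: "J \<subseteq> {..<n}" "bindep fixed (block_of ns) s (entry A) J" "card J = sum_rank_wt fixed ns A"
      using sum_rank_wt_attained[OF K n, of A] A(1) by blast
    have "bindep fixed (block_of ns) (dim_row A') (entry A') J" using i[OF J(1,2)] A(2) by simp
    from sum_rank_wt_ge[OF K n J(1) this] show ?thesis using J(3) by simp
  qed
  have "sum_rank_wt fixed ns E' = sum_rank_wt fixed ns E"
    using le[OF dim(2,1)] le[OF dim(1,2)] iff by (simp add: order.antisym)
  thus "E' \<in> errors t" using E E' by (simp add: errors_def fiber_def)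
qed

lemma finite_errors: "finite (errors t)"
  by (rule finite_subset[OF _ finite_carrier_mat[of s n]]) (auto simp: errors_def)

text \<open>The contracted vector has at most \<open>t\<close> independent entries, and
  \<open>t \<le> n - k - t\<close>. So a nonzero kernel vector contradicts
  \<open>orthogonal_fiber_empty\<close>, applied to \<open>E\<close> in its own fiber.\<close>

lemma rank_eq_of_small_weight:
  assumes E: "E \<in> errors t" and t: "2 * t \<le> n - k"
  shows "mat_rank (syndrome_mat \<theta> H t (C + E)) = t"
proof (rule ccontr)
  assume "\<not> ?thesis"
  hence "mat_rank (syndrome_mat \<theta> H t (C + E)) < t"
    using mat_rank_le[of "syndrome_mat \<theta> H t (C + E)"] syndrome_mat_dim by simp
  then obtain u c where u: "c < t" "u c \<noteq> 0" "syndrome_kernel t E u"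
    using mat_rank_syndrome_less by blast
  obtain J B where J: "J \<subseteq> {..<n}" "card J = t" and B: "basis_coeffs fixed (block_of ns) {..<n} J B"
    and ind: "bindep fixed (block_of ns) s (entry E) J"
    and lin: "\<forall>r<s. \<forall>p\<in>{..<n}. entry E r p = (\<Sum>j\<in>J. B j p * entry E r j)"
    using error_basis[OF E] by blast
  have EC: "E \<in> carrier_mat s n" using E by (simp add: errors_def)
  have finJ: "finite J" by (rule finite_subset[OF J(1)]) simp
  obtain j where j: "j \<in> J" "(\<Sum>p<n. B j p * annihilator t u p) \<noteq> 0"
    using annihilator_contract_nonzero[OF J(1) B, of c u] u(1,2) J(2) by blast
  obtain T where T: "maximal_bindep fixed (block_of ns) 1 (\<lambda>_ j. \<Sum>p<n. B j p * annihilator t u p) J T"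
    using maximal_bindep_exists[OF finJ] by blast
  have "T \<subseteq> J" using T by (simp add: maximal_bindep_def)
  hence "card T \<le> n - k - t" using card_mono[OF finJ, of T] J(2) t by linarith
  moreover have "E \<in> fiber s n (block_of ns) E" using EC by (simp add: fiber_def)
  ultimately have "\<not> orthogonal (block_of ns) par (n - k - t) (annihilator t u) E"
    using orthogonal_fiber_empty[OF J(1) B ind lin sep j T] by blast
  thus False using syndrome_kernel_orthogonal[OF EC \<phi>_inv u(3)] by contradiction
qed

text \<open>By independence of \<open>h\<close>, every block has at most \<open>m\<close> positions,
  so \<open>prod_ge_inverse_kappa\<close> costs at most one factor \<open>kappa q\<close> for each
  block.\<close>

lemma card_fiber_ge:
  assumes s: "0 < s" and J: "J \<subseteq> {..<n}" and B: "basis_coeffs fixed (block_of ns) {..<n} J B"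
    and ind: "bindep fixed (block_of ns) s (entry E) J"
    and lin: "\<forall>r<s. \<forall>p\<in>{..<n}. entry E r p = (\<Sum>j\<in>J. B j p * entry E r j)"
  shows "real (CARD('a) ^ s) ^ card J / kappa q ^ length ns \<le> real (card (fiber s n (block_of ns) E))"
proof -
  have finJ: "finite J" by (rule finite_subset[OF J]) simp
  let ?J = "\<lambda>b. {j\<in>J. block_of ns j = b}"
  have Q: "CARD('a) ^ s = q ^ (m * s)" by (simp add: card_field power_mult)
  have Jm: "card (?J b) \<le> m * s" for b
  proof -
    have "card (?J b) \<le> card {p\<in>{..<n}. block_of ns p = b}" using J by (intro card_mono) auto
    moreover have "q ^ card {p\<in>{..<n}. block_of ns p = b} \<le> q ^ m"
      using bindep_card_le[OF _ ind_h, of b] card_fixed card_field by simp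
    hence "card {p\<in>{..<n}. block_of ns p = b} \<le> m"
      using power_increasing_iff[of q] q by simp
    moreover have "m \<le> m * s" using s by simp
    ultimately show ?thesis by linarith
  qed
  have kpos: "0 < kappa q" using kappa_ge_1[OF q] by simp
  have "(1 / kappa q) ^ length ns = (\<Prod>b<length ns. 1 / kappa q)" by simp
  also have "\<dots> \<le> (\<Prod>b<length ns. \<Prod>i<card (?J b). 1 - real (card fixed) ^ i / real (CARD('a) ^ s))"
  proof (rule prod_mono, intro conjI)
    fix b
    show "0 \<le> 1 / kappa q" using kpos by simp
    show "1 / kappa q \<le> (\<Prod>i<card (?J b). 1 - real (card fixed) ^ i / real (CARD('a) ^ s))"
      unfolding Q card_fixed of_nat_power by (rule prod_ge_inverse_kappa[OF q Jm])
  qed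
  finally have "real (CARD('a) ^ s) ^ card J * (1 / kappa q) ^ length ns
      \<le> real (CARD('a) ^ s) ^ card J *
        (\<Prod>b<length ns. \<Prod>i<card (?J b). 1 - real (card fixed) ^ i / real (CARD('a) ^ s))"
    by (intro mult_left_mono) simp_all
  also have "\<dots> \<le> real (card (bindep_tuples s (block_of ns) J))"
  proof (rule card_bindep_tuples_ge[OF finJ])
    show "block_of ns ` J \<subseteq> {..<length ns}"
      using J n block_of_bounds(1)[of _ ns] by (auto simp: subset_iff)
    show "card fixed ^ card (?J b) \<le> CARD('a) ^ s" for b
      unfolding Q card_fixed using q Jm by (intro power_increasing) simp_all
  qed
  also have "\<dots> \<le> real (card (fiber s n (block_of ns) E))"
    using card_bindep_tuples_le_fiber[OF J B ind lin] by (simp only: of_nat_le_iff)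
  finally show ?thesis by (simp only: power_one_over times_divide_eq_right mult_1_right)
qed

text \<open>With \<open>Q = CARD('a) ^ s\<close>, each fiber has at least
  \<open>Q ^ t / kappa q ^ length ns\<close> elements, of which at most \<open>Q ^ t / Q ^ N\<close>
  are orthogonal. The quotient is the same for all fibers.\<close>

lemma card_orthogonal_errors_le:
  assumes s: "0 < s" and u: "c < t" "u c \<noteq> 0"
  shows "real (card {E\<in>errors t. orthogonal (block_of ns) par N (annihilator t u) E})
    \<le> kappa q ^ length ns / real (CARD('a) ^ s) ^ N * real (card (errors t))"
proof (rule card_le_by_fibers[OF finite_errors, where key = "\<lambda>E. rels fixed (block_of ns) s (entry E) {..<n}"])
  fix E assume E: "E \<in> errors t"
  let ?F = "fiber s n (block_of ns) E" and ?Q = "real (CARD('a) ^ s)"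
  let ?O = "\<lambda>E. orthogonal (block_of ns) par N (annihilator t u) E"
  obtain J B where J: "J \<subseteq> {..<n}" "card J = t" and B: "basis_coeffs fixed (block_of ns) {..<n} J B"
    and ind: "bindep fixed (block_of ns) s (entry E) J"
    and lin: "\<forall>r<s. \<forall>p\<in>{..<n}. entry E r p = (\<Sum>j\<in>J. B j p * entry E r j)"
    using error_basis[OF E] by blast
  obtain j where j: "j \<in> J" "(\<Sum>p<n. B j p * annihilator t u p) \<noteq> 0"
    using annihilator_contract_nonzero[OF J(1) B, of c u] u(1,2) J(2) by blast
  have fib: "{E'\<in>errors t. rels fixed (block_of ns) s (entry E') {..<n} = rels fixed (block_of ns) s (entry E) {..<n}} = ?F"
    using errors_fiber[OF E] by (auto simp: errors_def fiber_def)
  have fibO: "{E'\<in>errors t. rels fixed (block_of ns) s (entry E') {..<n} = rels fixed (block_of ns) s (entry E) {..<n} \<and> ?O E'}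
      = {E'\<in>?F. ?O E'}"
    unfolding fib[symmetric] by blast
  have Qpos: "0 < ?Q" by (simp add: card_gt_0_iff)
  have kpos: "0 < kappa q ^ length ns" using kappa_ge_1[OF q] by simp
  have "card {E'\<in>?F. ?O E'} * (CARD('a) ^ s) ^ N \<le> (CARD('a) ^ s) ^ t"
    using card_orthogonal_fiber_le[OF J(1) B ind lin sep j] J(2) by (simp only: power_mult)
  hence "real (card {E'\<in>?F. ?O E'} * (CARD('a) ^ s) ^ N) \<le> real ((CARD('a) ^ s) ^ t)"
    by (simp only: of_nat_le_iff)
  hence "real (card {E'\<in>?F. ?O E'}) * ?Q ^ N \<le> ?Q ^ t" by (simp only: of_nat_mult of_nat_power)
  also have "\<dots> \<le> kappa q ^ length ns * real (card ?F)"
    using card_fiber_ge[OF s J(1) B ind lin] kpos unfolding J(2)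
    by (simp only: pos_divide_le_eq mult.commute)
  finally have "real (card {E'\<in>?F. ?O E'}) \<le> kappa q ^ length ns * real (card ?F) / ?Q ^ N"
    using Qpos by (simp only: pos_le_divide_eq zero_less_power)
  thus "real (card {E'\<in>errors t. rels fixed (block_of ns) s (entry E') {..<n} = rels fixed (block_of ns) s (entry E) {..<n} \<and> ?O E'})
      \<le> kappa q ^ length ns / ?Q ^ N *
        real (card {E'\<in>errors t. rels fixed (block_of ns) s (entry E') {..<n} = rels fixed (block_of ns) s (entry E) {..<n}})"
    unfolding fib fibO by (simp only: times_divide_eq_left)
qed

text \<open>Double counting of pairs of a rank-deficient error and a nonzero kernel vector. Each
  such error has at least the nonzero multiples of one kernel vector, and each vector occurs at most
  as often as \<open>card_orthogonal_errors_le\<close> allows.\<close>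

lemma card_rank_deficient_le:
  assumes s: "0 < s"
  shows "real (card {E\<in>errors t. mat_rank (syndrome_mat \<theta> H t (C + E)) < t}) * (real (CARD('a)) - 1)
    \<le> real (CARD('a)) ^ t * (kappa q ^ length ns / real (CARD('a) ^ s) ^ (n - k - t) * real (card (errors t)))"
proof -
  let ?Bad = "{E\<in>errors t. mat_rank (syndrome_mat \<theta> H t (C + E)) < t}"
  let ?U = "{u \<in> {..<t} \<rightarrow>\<^sub>E (UNIV :: 'a set). \<exists>c<t. u c \<noteq> 0}"
  let ?\<rho> = "kappa q ^ length ns / real (CARD('a) ^ s) ^ (n - k - t) * real (card (errors t))"
  have finBad: "finite ?Bad" using finite_errors by simp
  have finPi: "finite ({..<t} \<rightarrow>\<^sub>E (UNIV :: 'a set))" by (simp add: finite_PiE)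
  hence finU: "finite ?U" by simp
  have "card ?U \<le> card ({..<t} \<rightarrow>\<^sub>E (UNIV :: 'a set))" by (rule card_mono[OF finPi]) blast
  also have "\<dots> = CARD('a) ^ t" by (simp add: card_PiE)
  finally have cardU: "card ?U \<le> CARD('a) ^ t" .
  have ker_scale: "syndrome_kernel t E (\<lambda>c\<in>{..<t}. l * u c)" if "syndrome_kernel t E u" for E u l
  proof -
    have "(\<Sum>c<t. a c * (\<lambda>c\<in>{..<t}. l * u c) c) = l * (\<Sum>c<t. a c * u c)" for a
      unfolding sum_distrib_left by (intro sum.cong refl) simp
    thus ?thesis using that unfolding syndrome_kernel_def by simp
  qed
  have many: "CARD('a) - 1 \<le> card {u\<in>?U. syndrome_kernel t E u}" if E: "E \<in> ?Bad" for E
  proof -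
    obtain u c where u: "c < t" "u c \<noteq> 0" "syndrome_kernel t E u"
      using mat_rank_syndrome_less E by blast
    let ?f = "\<lambda>l. \<lambda>c\<in>{..<t}. l * u c"
    have "inj_on ?f (UNIV - {0})"
    proof (rule inj_onI)
      fix l l' assume "?f l = ?f l'"
      from fun_cong[OF this, of c] show "l = l'" using u(1,2) by simp
    qed
    moreover have "?f ` (UNIV - {0}) \<subseteq> {u\<in>?U. syndrome_kernel t E u}"
    proof (rule image_subsetI)
      fix l :: 'a assume l: "l \<in> UNIV - {0}"
      have "?f l c \<noteq> 0" using l u(1,2) by simp
      hence "\<exists>c<t. ?f l c \<noteq> 0" using u(1) by blast
      moreover have "?f l \<in> {..<t} \<rightarrow>\<^sub>E UNIV" by (intro restrict_PiE_iff[THEN iffD2] ballI UNIV_I)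
      ultimately show "?f l \<in> {u\<in>?U. syndrome_kernel t E u}" by (intro CollectI conjI ker_scale[OF u(3)])
    qed
    moreover have "finite {u\<in>?U. syndrome_kernel t E u}" by (rule finite_subset[OF _ finU]) blast
    ultimately have "card (UNIV - {0::'a}) \<le> card {u\<in>?U. syndrome_kernel t E u}" by (rule card_inj_on_le)
    thus ?thesis by (simp add: card_Diff_singleton)
  qed
  have few: "real (card {E\<in>?Bad. syndrome_kernel t E u}) \<le> ?\<rho>" if u: "u \<in> ?U" for u
  proof -
    obtain c where c: "c < t" "u c \<noteq> 0" using u by blast
    have "{E\<in>?Bad. syndrome_kernel t E u}
        \<subseteq> {E\<in>errors t. orthogonal (block_of ns) par (n - k - t) (annihilator t u) E}"
    proof
      fix E assume E: "E \<in> {E\<in>?Bad. syndrome_kernel t E u}"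
      hence "E \<in> carrier_mat s n" by (simp add: errors_def)
      from syndrome_kernel_orthogonal[OF this \<phi>_inv] E
      show "E \<in> {E\<in>errors t. orthogonal (block_of ns) par (n - k - t) (annihilator t u) E}" by blast
    qed
    hence "card {E\<in>?Bad. syndrome_kernel t E u}
        \<le> card {E\<in>errors t. orthogonal (block_of ns) par (n - k - t) (annihilator t u) E}"
      using finite_errors by (intro card_mono) simp_all
    thus ?thesis using card_orthogonal_errors_le[OF s, of c t u "n - k - t", OF c] by linarith
  qed
  have "real (CARD('a)) - 1 = real (CARD('a) - 1)"
    by (simp add: of_nat_diff Suc_leI card_gt_0_iff)
  hence "real (card ?Bad) * (real (CARD('a)) - 1) = (\<Sum>E\<in>?Bad. real (CARD('a) - 1))" by simp
  also have "\<dots> \<le> (\<Sum>E\<in>?Bad. real (card {u\<in>?U. syndrome_kernel t E u}))"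
  proof (rule sum_mono)
    fix E assume "E \<in> ?Bad"
    thus "real (CARD('a) - 1) \<le> real (card {u\<in>?U. syndrome_kernel t E u})"
      using many by (simp only: of_nat_le_iff)
  qed
  also have "\<dots> = (\<Sum>E\<in>?Bad. \<Sum>u\<in>{u\<in>?U. syndrome_kernel t E u}. 1)"
    by (simp only: card_eq_sum of_nat_sum of_nat_1)
  also have "\<dots> = (\<Sum>u\<in>?U. \<Sum>E\<in>{E\<in>?Bad. syndrome_kernel t E u}. 1)"
    by (rule sum.swap_restrict[OF finBad finU])
  also have "\<dots> = (\<Sum>u\<in>?U. real (card {E\<in>?Bad. syndrome_kernel t E u}))" by simp
  also have "\<dots> \<le> (\<Sum>u\<in>?U. ?\<rho>)" by (rule sum_mono) (rule few)
  also have "\<dots> = real (card ?U) * ?\<rho>" by simp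
  also have "\<dots> \<le> real (CARD('a) ^ t) * ?\<rho>"
  proof (rule mult_right_mono)
    show "real (card ?U) \<le> real (CARD('a) ^ t)" using cardU by (simp only: of_nat_le_iff)
    show "0 \<le> ?\<rho>" using kappa_ge_1[OF q] by simp
  qed
  finally show ?thesis by (simp only: of_nat_power)
qed

end


section \<open>The subfield of order \<open>q\<close>, inverse automorphisms and conjugacy
  classes\<close>

lemma finite_field_power_card_minus_1:
  fixes x :: "'a::{field,finite}"
  assumes "x \<noteq> 0"
  shows "x ^ (CARD('a) - 1) = 1"
proof -
  let ?U = "UNIV - {0::'a}"
  have "(\<Prod>y\<in>?U. x * y) = (\<Prod>y\<in>?U. y)"
    \<comment> \<open>Multiplication by \<open>x\<close> permutes the nonzero elements.\<close>
    by (rule prod.reindex_bij_witness[of _ "\<lambda>y. y / x" "\<lambda>y. x * y"]) (use assms in simp_all)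
  moreover have "(\<Prod>y\<in>?U. x * y) = x ^ card ?U * (\<Prod>y\<in>?U. y)" by (simp add: prod.distrib)
  moreover have "(\<Prod>y\<in>?U. y) \<noteq> 0" by simp
  ultimately have "x ^ card ?U = 1" by simp
  thus ?thesis by (simp add: card_Diff_singleton)
qed

text \<open>With \<open>d = q - 1\<close> and \<open>N = q ^ m - 1\<close>, every nonzero element is
  a root of \<open>x ^ N - 1\<close>, which is \<open>x ^ d - 1\<close> times \<open>G\<close>.
  Since \<open>G\<close> has at most \<open>N - d\<close> roots, \<open>x ^ d - 1\<close> has
  exactly \<open>d\<close>; zero completes \<open>Fq q\<close>.\<close>

lemma card_Fq:
  assumes q: "2 \<le> q" and m: "1 \<le> m" and card: "CARD('a::{field,finite}) = q ^ m"
  shows "card (Fq q :: 'a set) = q"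
proof -
  let ?d = "q - 1" and ?N = "CARD('a) - 1"
  let ?R = "{x :: 'a. x ^ ?d = 1}"
  have d: "0 < ?d" using q by simp
  have "?d dvd ?N"
  proof -
    have "int q ^ m - 1 = (int q - 1) * (\<Sum>i<m. int q ^ i)" by (rule power_diff_1_eq)
    hence "int q - 1 dvd int q ^ m - 1" by simp
    moreover have "int q - 1 = int ?d" using q by (simp add: of_nat_diff)
    moreover have "int q ^ m - 1 = int ?N" using q unfolding card by (simp add: of_nat_diff)
    ultimately show ?thesis by (simp only: int_dvd_int_iff)
  qed
  then obtain e where e: "?N = ?d * e" by (rule dvdE)
  have Nd: "?d \<le> ?N" unfolding card using q m by (intro diff_le_mono self_le_power) simp_all
  hence e0: "0 < e" using d e by (cases e) auto
  let ?G = "\<Sum>i<e. monom (1::'a) (?d * i)"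
  let ?F = "monom (1::'a) ?d - 1"
  have G: "poly ?G x = (\<Sum>i<e. (x ^ ?d) ^ i)" for x
    by (simp add: poly_sum poly_monom power_mult)
  \<comment> \<open>The value one at zero shows that \<open>G\<close> is not the zero polynomial, so
    that its degree bounds the number of roots.\<close>
  have "poly ?G 0 = (\<Sum>i<e. if i = 0 then 1 else 0)"
    unfolding G by (rule sum.cong[OF refl]) (use d in \<open>simp add: power_0_left\<close>)
  also have "\<dots> = 1" using e0 by simp
  finally have G0: "?G \<noteq> 0" by auto
  have "degree ?G \<le> ?d * (e - 1)"
  proof (rule degree_sum_le)
    fix i assume "i \<in> {..<e}"
    hence "?d * i \<le> ?d * (e - 1)" by (intro mult_le_mono2) auto
    thus "degree (monom (1::'a) (?d * i)) \<le> ?d * (e - 1)" by (rule order.trans[OF degree_monom_le])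
  qed simp
  hence G_roots: "card {x. poly ?G x = 0} \<le> ?d * (e - 1)"
    using card_poly_roots_bound[OF G0] by linarith
  have dF: "degree ?F \<le> ?d" by (intro degree_diff_le degree_monom_le) simp
  have zd: "(0::'a) ^ ?d = 0" by (rule zero_power[OF d])
  have "poly ?F 0 = - 1" by (simp only: poly_diff poly_monom zd poly_1) simp
  hence F0: "?F \<noteq> 0" by auto
  have F_roots: "{x. poly ?F x = 0} = ?R" by (simp add: poly_monom)
  have R_le: "card ?R \<le> ?d" using card_poly_roots_bound[OF F0] dF unfolding F_roots by (rule order.trans)
  have "UNIV - {0} \<subseteq> ?R \<union> {x. poly ?G x = 0}"
  proof
    fix x :: 'a assume "x \<in> UNIV - {0}"
    hence "(x ^ ?d) ^ e = 1" using finite_field_power_card_minus_1[of x] e by (simp add: power_mult)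
    moreover have "1 - (x ^ ?d) ^ e = (1 - x ^ ?d) * (\<Sum>i<e. (x ^ ?d) ^ i)" by (rule one_diff_power_eq)
    ultimately have "x ^ ?d = 1 \<or> poly ?G x = 0" unfolding G by simp
    thus "x \<in> ?R \<union> {x. poly ?G x = 0}" by blast
  qed
  hence "card (UNIV - {0::'a}) \<le> card (?R \<union> {x. poly ?G x = 0})" by (intro card_mono) simp_all
  also have "\<dots> \<le> card ?R + card {x. poly ?G x = 0}" by (rule card_Un_le)
  finally have "?N \<le> card ?R + ?d * (e - 1)" using G_roots by (simp add: card_Diff_singleton)
  moreover have "?N = ?d + ?d * (e - 1)" using e e0 by (cases e) simp_all
  ultimately have R: "card ?R = ?d" using R_le by linarith
  have "Fq q = insert (0::'a) ?R"
  proof (intro equalityI subsetI)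
    fix x :: 'a assume "x \<in> Fq q"
    hence "x * x ^ ?d = x * 1" using q by (simp add: Fq_def power_Suc[symmetric] del: power_Suc)
    thus "x \<in> insert 0 ?R" by (simp only: mult_cancel_left) auto
  next
    fix x :: 'a assume "x \<in> insert 0 ?R"
    hence "x = 0 \<or> x ^ Suc ?d = x" by auto
    thus "x \<in> Fq q" using q by (auto simp: Fq_def)
  qed
  moreover have "0 \<notin> ?R"
  proof
    assume "0 \<in> ?R"
    hence "(0::'a) ^ ?d = 1" by (rule CollectD)
    thus False unfolding zd by simp
  qed
  ultimately have "card (Fq q :: 'a set) = Suc ?d" using R by simp
  thus ?thesis using q by simp
qed

lemma field_isom_inverse:
  fixes \<theta> :: "'a::{field,finite} \<Rightarrow> 'a"
  assumes "field_isom \<theta>"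
  shows "inverse_field_aut (inv_into UNIV \<theta>) \<theta>"
proof -
  interpret field_isom \<theta> by (rule assms)
  have add: "\<theta> (x + y) = \<theta> x + \<theta> y" and mult: "\<theta> (x * y) = \<theta> x * \<theta> y" for x y
    by (rule hom_add, rule hom_mult)
  have inj: "inj \<theta>" by (rule inj_f)
  have surj: "surj \<theta>" using inj by (simp add: finite_UNIV_inj_surj)
  let ?\<phi> = "inv_into UNIV \<theta>"
  have r: "\<theta> (?\<phi> x) = x" and l: "?\<phi> (\<theta> x) = x" for x
    by (rule surj_f_inv_f[OF surj], rule inv_into_f_f[OF inj UNIV_I])
  show ?thesis
  proof
    fix x y
    show "?\<phi> (x + y) = ?\<phi> x + ?\<phi> y" by (rule injD[OF inj]) (simp only: add r)
    show "?\<phi> (x * y) = ?\<phi> x * ?\<phi> y" by (rule injD[OF inj]) (simp only: mult r)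
    show "bij ?\<phi>" using inj surj by (intro bij_imp_bij_inv) (simp add: bij_def)
    show "\<theta> (?\<phi> x) = x" by (rule r)
    show "?\<phi> (\<theta> x) = x" by (rule l)
  qed
qed

text \<open>Applying \<open>\<theta>\<close> to the hypothesis gives
  \<open>x * \<theta> t = t * y\<close>, so \<open>x\<close> and \<open>y\<close> are conjugate. In
  this way distinct classes under \<open>\<theta>\<close> become separation under
  \<open>\<phi>\<close>.\<close>

lemma (in inverse_field_aut) conj_class_eqI:
  assumes t: "t \<noteq> 0" and eq: "\<phi> x * t = \<phi> t * \<phi> y"
  shows "conj_class \<theta> x = conj_class \<theta> y"
proof -
  interpret t: field_aut \<theta> by (rule field_aut_inverse)
  have "\<theta> (\<phi> x * t) = \<theta> (\<phi> t * \<phi> y)" using eq by (simp only:)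
  hence *: "x * \<theta> t = t * y" by (simp only: t.hom_mult right_inv)
  have nz: "\<theta> t \<noteq> 0" using t t.hom_eq_0_iff by simp
  have y: "y = \<theta> t * x * inverse t" using * t by (simp add: field_simps)
  have x: "x = t * y * inverse (\<theta> t)" using * nz by (simp add: field_simps)
  have \<theta>inv: "\<theta> (c / d) = \<theta> c / \<theta> d" for c d by (rule t.hom_divide)
  show ?thesis
  proof (intro equalityI subsetI)
    fix z assume "z \<in> conj_class \<theta> x"
    then obtain c where c: "c \<noteq> 0" "z = \<theta> c * x * inverse c" by (auto simp: conj_class_def)
    have "z = \<theta> (c / t) * y * inverse (c / t)"
      unfolding c(2) \<theta>inv y using c(1) t nz by (simp add: field_simps)
    thus "z \<in> conj_class \<theta> y" using c(1) t unfolding conj_class_def by (intro CollectI exI[of _ "c / t"]) simp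
  next
    fix z assume "z \<in> conj_class \<theta> y"
    then obtain c where c: "c \<noteq> 0" "z = \<theta> c * y * inverse c" by (auto simp: conj_class_def)
    have "z = \<theta> (c * t) * x * inverse (c * t)"
      unfolding c(2) t.hom_mult y using c(1) t nz by (simp add: field_simps)
    thus "z \<in> conj_class \<theta> x" using c(1) t unfolding conj_class_def by (intro CollectI exI[of _ "c * t"]) simp
  qed
qed

section \<open>Existence of errors and the probability estimate\<close>

context lrs_decoding
begin

text \<open>The first \<open>t\<close> entries of \<open>h\<close>, placed in the top row, give
  weight exactly \<open>t\<close>, the other columns being zero. Nonemptiness is what makes
  \<open>pmf_of_set\<close> the uniform distribution.\<close>

lemma errors_nonempty:
  assumes s: "0 < s" and t: "t \<le> n"
  shows "errors t \<noteq> {}"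
proof -
  define E where "E = mat s n (\<lambda>(r, p). if r = 0 \<and> p < t then h $ p else 0)"
  have E: "E \<in> carrier_mat s n" "dim_row E = s" by (simp_all add: E_def)
  have K: "0 \<in> fixed" by simp
  have entry: "entry E r p = (if r = 0 \<and> p < t then h $ p else 0)" if "r < s" "p < n" for r p
    using that by (simp add: E_def)
  have tn: "{..<t} \<subseteq> {..<n}" using t by auto
  have indt: "bindep fixed (block_of ns) 1 (\<lambda>_ p. h $ p) {..<t}"
    by (rule bindep_subset[OF ind_h _ tn]) simp_all
  have "bindep fixed (block_of ns) s (entry E) {..<t}"
    unfolding bindep_def
  proof (intro ballI)
    fix c j assume c: "c \<in> rels fixed (block_of ns) s (entry E) {..<t}" and j: "j \<in> {..<t}"
    have "(\<Sum>p\<in>{p\<in>{..<t}. block_of ns p = b}. c p * h $ p) = 0" for b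
    proof -
      have "(\<Sum>p\<in>{p\<in>{..<t}. block_of ns p = b}. c p * h $ p)
          = (\<Sum>p\<in>{p\<in>{..<t}. block_of ns p = b}. c p * entry E 0 p)"
        by (rule sum.cong[OF refl]) (use t s in \<open>simp add: entry\<close>)
      also have "\<dots> = 0" using c s unfolding rels_def mem_Collect_eq by blast
      finally show ?thesis .
    qed
    hence "c \<in> rels fixed (block_of ns) 1 (\<lambda>_ p. h $ p) {..<t}"
      using c unfolding rels_def mem_Collect_eq by simp
    thus "c j = 0" by (rule bindepD[OF indt _ j])
  qed
  hence ge: "t \<le> sum_rank_wt fixed ns E" using sum_rank_wt_ge[OF K n tn, of E] E(2) by simp
  obtain J where J: "J \<subseteq> {..<n}" "bindep fixed (block_of ns) s (entry E) J" "card J = sum_rank_wt fixed ns E"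
    using sum_rank_wt_attained[OF K n, of E] E(2) by blast
  have "J \<subseteq> {..<t}"
  proof (rule subsetI, rule ccontr)
    fix p assume p: "p \<in> J" "p \<notin> {..<t}"
    let ?c = "\<lambda>i. if i = p then 1 else 0"
    have "?c i * entry E r i = 0" if "i \<in> J" "r < s" for i r
    proof -
      have "i < n" using that(1) J(1) by blast
      thus ?thesis using entry[OF that(2), of i] p(2) by simp
    qed
    hence "?c \<in> rels fixed (block_of ns) s (entry E) J"
      unfolding rels_def by (auto intro!: sum.neutral)
    from bindepD[OF J(2) this p(1)] show False by simp
  qed
  hence "card J \<le> t" using card_mono[of "{..<t}" J] by simp
  hence "E \<in> errors t" using ge J(3) E(1) by (simp add: errors_def)
  thus ?thesis by blast
qed

lemma prob_rank_deficient_le: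
  assumes m: "1 \<le> m" and t: "real t \<le> real s / (real s + 1) * (real n - real k)"
  shows "measure_pmf.prob (pmf_of_set (errors t)) {E. mat_rank (syndrome_mat \<theta> H t (C + E)) < t}
    \<le> kappa q ^ (length ns + 1) *
      real q powr (- (real m * ((real s + 1) * (real s / (real s + 1) * (real n - real k) - real t) + 1)))"
    (is "?P \<le> ?R")
proof (cases "t = 0")
  \<comment> \<open>No rank is below zero, so the probability vanishes here. For positive
    \<open>t\<close> the bound on \<open>t\<close> forces \<open>s\<close> to be positive as
    well.\<close>
  case True
  have "0 \<le> ?R" using kappa_ge_1[OF q] by (intro mult_nonneg_nonneg zero_le_power) simp_all
  then show ?thesis using True by simp
next
  case False
  have s: "0 < s" using t False by (cases "s = 0") simp_all
  have kn: "real n - real k = real (n - k)" using k by (simp add: of_nat_diff)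
  \<comment> \<open>This gives \<open>t \<le> n - k\<close>, so the subtraction in \<open>N\<close>
    does not truncate.\<close>
  have "real s / (real s + 1) * real (n - k) \<le> 1 * real (n - k)" by (intro mult_right_mono) simp_all
  hence tnk: "t \<le> n - k" using t unfolding kn by linarith
  define N where "N = n - k - t"
  let ?Q = "real (CARD('a) ^ s)" and ?S = "errors t"
  let ?Bad = "{E\<in>?S. mat_rank (syndrome_mat \<theta> H t (C + E)) < t}"
  have ne: "?S \<noteq> {}" by (rule errors_nonempty[OF s]) (use tnk in linarith)
  have Spos: "0 < real (card ?S)" using ne finite_errors by (simp add: card_gt_0_iff)
  have "?P = real (card (?S \<inter> {E. mat_rank (syndrome_mat \<theta> H t (C + E)) < t})) / real (card ?S)"
    by (rule measure_pmf_of_set[OF ne finite_errors])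
  also have "?S \<inter> {E. mat_rank (syndrome_mat \<theta> H t (C + E)) < t} = ?Bad" by blast
  finally have P: "?P = real (card ?Bad) / real (card ?S)" .
  have qm: "real (CARD('a)) = real q ^ m" by (simp add: card_field)
  have qm2: "2 \<le> real q ^ m" using two_le_power_Suc[OF q, of "m - 1"] m by simp
  have Q: "?Q ^ N = real q ^ (m * s * N)" by (simp add: card_field power_mult)
  have bad: "real (card ?Bad) * (real q ^ m - 1)
      \<le> real q ^ (m * t) * (kappa q ^ length ns / real q ^ (m * s * N) * real (card ?S))"
    using card_rank_deficient_le[OF s, of t] unfolding N_def[symmetric] Q qm by (simp only: power_mult)
  \<comment> \<open>The ratio of \<open>q ^ m\<close> to the number \<open>q ^ m - 1\<close> of
    nonzero scalars is at most \<open>1 / (1 - 1 / q)\<close>, the first factor of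
    \<open>kappa q\<close>. Hence the exponent \<open>length ns + 1\<close>.\<close>
  have "y * (1 / (y - 1)) = 1 / (1 - 1 / y)" if "2 \<le> y" for y :: real
    using that by (simp add: field_simps)
  from this[OF qm2] have "real q ^ m * (1 / (real q ^ m - 1)) = 1 / (1 - 1 / real q ^ m)" .
  also have "\<dots> \<le> 1 / (1 - 1 / real q ^ 1)"
  proof (rule divide_left_mono)
    have "real q ^ 1 \<le> real q ^ m" using q m by (intro power_increasing) simp_all
    thus "1 - 1 / real q ^ 1 \<le> 1 - 1 / real q ^ m" using q by (simp add: frac_le)
    have "0 < 1 - 1 / real q ^ 1" using q by simp
    moreover have "0 < 1 - 1 / real q ^ m" by (rule kappa_factor_bounds(3)[OF qm2])
    ultimately show "0 < (1 - 1 / real q ^ m) * (1 - 1 / real q ^ 1)" by (intro mult_pos_pos)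
  qed simp
  also have "\<dots> \<le> kappa q" using kappa_ge_prod[OF q, of 1] by simp
  finally have kap: "real q ^ m * (1 / (real q ^ m - 1)) \<le> kappa q" .
  have qpos: "0 < real q" using q by simp
  define A where "A = real q ^ (m * t) * (kappa q ^ length ns / real q ^ (m * s * N))"
  have A0: "0 \<le> A / real q ^ m" using kappa_ge_1[OF q] by (simp add: A_def)
  have "?P * (real q ^ m - 1) = real (card ?Bad) * (real q ^ m - 1) / real (card ?S)"
    by (simp only: P times_divide_eq_left)
  also have "\<dots> \<le> A" using bad Spos by (simp only: A_def pos_divide_le_eq mult.assoc)
  finally have "?P \<le> A / (real q ^ m - 1)" using qm2 by (subst pos_le_divide_eq) linarith+
  also have "\<dots> = A / real q ^ m * (real q ^ m * (1 / (real q ^ m - 1)))" using qpos by simp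
  also have "\<dots> \<le> A / real q ^ m * kappa q" by (rule mult_left_mono[OF kap A0])
  also have "\<dots> = kappa q ^ (length ns + 1) * (real q ^ (m * t) / (real q ^ m * real q ^ (m * s * N)))"
    by (simp add: A_def mult_ac)
  also have "real q ^ (m * t) / (real q ^ m * real q ^ (m * s * N))
      = real q powr (- (real m * ((real s + 1) * (real s / (real s + 1) * (real n - real k) - real t) + 1)))"
  proof -
    have Nr: "real N = real n - real k - real t" using tnk k by (simp add: N_def of_nat_diff)
    have s1: "real s + 1 \<noteq> 0" by linarith
    \<comment> \<open>This product equals \<open>s * (n - k) - (s + 1) * t\<close>, that is
      \<open>s * N - t\<close>, so the exponent on both sides is
      \<open>m * (t - 1 - s * N)\<close>.\<close>
    have "(real s + 1) * (real s / (real s + 1) * (real n - real k) - real t)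
        = ((real s + 1) * (real s / (real s + 1))) * (real n - real k) - (real s + 1) * real t"
      by (simp only: right_diff_distrib mult.assoc)
    also have "(real s + 1) * (real s / (real s + 1)) = real s" using s1 by simp
    finally have cancel: "(real s + 1) * (real s / (real s + 1) * (real n - real k) - real t)
        = real s * (real n - real k) - (real s + 1) * real t" .
    have ex: "- (real m * ((real s + 1) * (real s / (real s + 1) * (real n - real k) - real t) + 1))
        = real (m * t) - (real m + real (m * s * N))"
      unfolding cancel by (simp add: Nr algebra_simps)
    have "real q ^ (m * t) / (real q ^ m * real q ^ (m * s * N))
        = real q powr real (m * t) / (real q powr real m * real q powr real (m * s * N))"
      using qpos by (simp only: powr_realpow)
    also have "\<dots> = real q powr (real (m * t) - (real m + real (m * s * N)))"
      by (simp only: powr_diff powr_add)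
    finally show ?thesis unfolding ex .
  qed
  finally show ?thesis .
qed

end

section \<open>Failure probability and guaranteed decoding radius\<close>

theorem lemma2:
  fixes \<theta> :: "'a::{field,finite} \<Rightarrow> 'a"
    and q m n ell s k \<tau> :: nat
    and ns :: "nat list"
    and \<beta> \<xi> h :: "'a vec"
    and H C :: "'a mat"
    and \<tau>_max :: real
  assumes q: "\<exists>p e. prime p \<and> 1 \<le> e \<and> q = p ^ e"
    and m: "1 \<le> m"
    and card: "CARD('a) = q ^ m"
    and aut: "field_isom \<theta>"
    and fixed_field: "{x. \<theta> x = x} = Fq q"
    and part: "length_partition ns n" "length ns = ell"
    and k: "k \<le> n"
    and \<beta>: "\<beta> \<in> carrier_vec n"
      "\<forall>i<ell. indep_cols (Fq q) (block ns i (mat_of_rows n [\<beta>])) {..<ns ! i}"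
    and \<xi>: "\<xi> \<in> carrier_vec ell"
      "\<forall>i<ell. \<xi> $ i \<noteq> 0"
      "\<forall>i<ell. \<forall>j<ell. i \<noteq> j \<longrightarrow> conj_class \<theta> (\<xi> $ i) \<noteq> conj_class \<theta> (\<xi> $ j)"
    and h: "h \<in> carrier_vec n"
      "\<forall>l\<in>{1..n - 1}. h \<bullet> gen_op_vec \<theta> ns (l - 1) \<beta> \<xi> = 0"
      "sum_rank_wt (Fq q) ns (mat_of_rows n [h]) = n"
    and H: "H = moore (inv_into UNIV \<theta>) ns (n - k) h (map_vec (inv_into UNIV \<theta>) \<xi>)"
    and C: "C \<in> VILRS \<theta> \<beta> \<xi> s ns k"
    and \<tau>_max: "\<tau>_max = real s / (real s + 1) * (real n - real k)"
  shows "(real \<tau> \<le> \<tau>_max \<longrightarrow>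
            measure_pmf.prob
              (pmf_of_set {E \<in> carrier_mat s n. sum_rank_wt (Fq q) ns E = \<tau>})
              {E. mat_rank (syndrome_mat \<theta> H \<tau> (C + E)) < \<tau>}
            \<le> kappa q ^ (ell + 1)
               * real q powr (- (real m * ((real s + 1) * (\<tau>_max - real \<tau>) + 1))))
       \<and> (\<forall>E \<in> carrier_mat s n.
            sum_rank_wt (Fq q) ns E = \<tau> \<and> real \<tau> \<le> (real n - real k) / 2
            \<longrightarrow> mat_rank (syndrome_mat \<theta> H \<tau> (C + E)) = \<tau>)"
proof -
  define \<phi> where "\<phi> = inv_into UNIV \<theta>"
  have q2: "2 \<le> q"
  proof -
    obtain p e where pe: "prime p" "1 \<le> e" "q = p ^ e" using q by blast
    have "2 \<le> p" by (rule prime_ge_2_nat[OF pe(1)])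
    also have "p \<le> p ^ e" using pe(2) \<open>2 \<le> p\<close> by (intro self_le_power) simp_all
    finally show ?thesis by (simp only: pe(3))
  qed
  have n: "sum_list ns = n" using part(1) by (simp add: length_partition_def)
  interpret inverse_field_aut \<phi> \<theta> unfolding \<phi>_def by (rule field_isom_inverse[OF aut])
  \<comment> \<open>An automorphism and its inverse fix the same elements.\<close>
  have fixed: "fixed = Fq q"
  proof -
    have "\<phi> x = x \<longleftrightarrow> \<theta> x = x" for x by (metis left_inv right_inv)
    thus ?thesis using fixed_field by simp
  qed
  have blk: "block_of ns p < ell" if "p \<in> {..<n}" for p
    using block_of_bounds(1)[of p ns] that n part(2) by simp
  have sep: "separated (block_of ns) (\<lambda>b. \<phi> (\<xi> $ b)) {..<n}"
    unfolding separated_def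
  proof (intro conjI ballI allI impI)
    fix p assume "p \<in> {..<n}"
    from blk[OF this] have "\<xi> $ block_of ns p \<noteq> 0" using \<xi>(2) by blast
    thus "\<phi> (\<xi> $ block_of ns p) \<noteq> 0" by (simp only: hom_eq_0_iff not_False_eq_True)
  next
    fix p p' t assume p: "p \<in> {..<n}" "p' \<in> {..<n}" and t: "t \<noteq> 0"
      and eq: "\<phi> (\<xi> $ block_of ns p) * t = \<phi> t * \<phi> (\<xi> $ block_of ns p')"
    have "conj_class \<theta> (\<xi> $ block_of ns p) = conj_class \<theta> (\<xi> $ block_of ns p')"
      by (rule conj_class_eqI[OF t eq])
    thus "block_of ns p = block_of ns p'" using \<xi>(3) blk[OF p(1)] blk[OF p(2)] by blast
  qed
  have ind_h: "bindep fixed (block_of ns) 1 (\<lambda>_ p. h $ p) {..<n}"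
  proof -
    let ?h = "mat_of_rows n [h]"
    have K: "0 \<in> Fq q" using q2 by (simp add: Fq_def)
    obtain J where J: "J \<subseteq> {..<n}" "bindep (Fq q) (block_of ns) (dim_row ?h) (entry ?h) J" "card J = n"
      using sum_rank_wt_attained[OF K n, of ?h] h(3) by auto
    \<comment> \<open>A weight of \<open>n\<close> is attained by \<open>n\<close> independent
      positions, which must be all of them.\<close>
    have "J = {..<n}" by (rule card_subset_eq[OF _ J(1)]) (simp_all add: J(3))
    hence "bindep (Fq q) (block_of ns) 1 (entry ?h) {..<n}" using J(2) by simp
    thus ?thesis
      unfolding fixed by (subst (asm) bindep_cong[where Y = "\<lambda>_ p. h $ p"]) (simp_all add: mat_of_rows_def)
  qed
  interpret lrs_decoding \<phi> \<theta> ns n k s \<beta> \<xi> h H C q m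
  proof
    show "h \<bullet> gen_op_vec \<theta> ns l \<beta> \<xi> = 0" if "Suc l < n" for l
      using bspec[OF h(2), of "Suc l"] that by simp
    show "Finite_Set.card fixed = q" unfolding fixed by (rule card_Fq[OF q2 m card])
  qed (use n k \<xi>(1) part(2) h(1) H C q2 card sep ind_h in \<open>simp_all add: \<phi>_def\<close>)
  have err: "{E \<in> carrier_mat s n. sum_rank_wt (Fq q) ns E = \<tau>} = errors \<tau>"
    by (simp only: errors_def fixed)
  show ?thesis
    unfolding err
  proof (intro conjI impI ballI)
    assume "real \<tau> \<le> \<tau>_max"
    thus "measure_pmf.prob (pmf_of_set (errors \<tau>)) {E. mat_rank (syndrome_mat \<theta> H \<tau> (C + E)) < \<tau>}
        \<le> kappa q ^ (ell + 1) * real q powr (- (real m * ((real s + 1) * (\<tau>_max - real \<tau>) + 1)))"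
      unfolding \<tau>_max part(2)[symmetric] by (rule prob_rank_deficient_le[OF m])
  next
    fix E :: "'a mat" assume E: "E \<in> carrier_mat s n" "sum_rank_wt (Fq q) ns E = \<tau> \<and> real \<tau> \<le> (real n - real k) / 2"
    have "E \<in> errors \<tau>" using E by (simp add: err[symmetric])
    moreover have "2 * \<tau> \<le> n - k"
    proof -
      have "real (2 * \<tau>) \<le> real (n - k)" using E(2) k by (simp add: of_nat_diff)
      thus ?thesis by (simp only: of_nat_le_iff)
    qed
    ultimately show "mat_rank (syndrome_mat \<theta> H \<tau> (C + E)) = \<tau>" by (rule rank_eq_of_small_weight)
  qed
qed

end
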